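(* Fix a compact metric space $(X,\mathcal{D})$. (a) The Lipschitz MAB problem on $(X,\mathcal{D})$ is either $f(t)$-tractable for every $f\in\omega(\log t)$, or it is not $g(t)$-tractable for any $g\in o(\sqrt t)$. (b) The Lipschitz experts problem on $(X,\mathcal{D})$ is either $1$-tractable, even with double feedback, or it is not $g(t)$-tractable for any $g\in o(\sqrt t)$, even with full feedback and uniformly Lipschitz payoffs. In both cases, the first alternative occurs if and only if $X$ is countable.
   Context: Lipschitz MAB problem on $(X,\mathcal{D})$ (diameter at most 1, known): unknown $\mu:X\to[0,1]$ with $|\mu(x)-\mu(y)|\le\mathcal{D}(x,y)$ and for each arm a reward distribution on $[0,1]$ with mean $\mu(x)$; each round the algorithm picks $x_t$ and gets an independent reward from that distribution. Lipschitz experts problem: an instance is an unknown Borel probability measure $\mathbb{P}$ on $[0,1]^X$ with $\mu(x)=\mathbb{E}_{f\sim\mathbb{P}}[f(x)]$ $1$-Lipschitz; each round the algorithm picks $x_t$, $f_t\sim\mathbb{P}$ independently, the algorithm receives $f_t(x_t)$; with full feedback it may query $f_t$ at any finitely many points; with double feedback it picks one extra point $y_t$ and observes only $f_t(x_t)$ and $f_t(y_t)$. Uniformly Lipschitz payoffs: every $f$ in the support of $\mathbb{P}$ is $1$-Lipschitz. Regret $R(t)=t\sup\mu-\mathbb{E}[\sum_{s\le t}\mu(x_s)]$. $f(t)$-tractable: some algorithm has, for every instance, $R(t)\le Cf(t)$ for all $t$ with $C$ depending on the instance; $1$-tractable means $f\equiv1$. $f\in\omega(\log t)$: $f(t)/\log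 t\to\infty$; $g\in o(\sqrt t)$: $g(t)/\sqrt t\to0$.
   Formalization: In (a) the rates f in ω(log t) are also required to be positive for all t ≥ 1, since R(t) ≤ C f(t) for all t is impossible where f(t) ≤ 0 (e.g. f(t) = (log t)² at t = 1 on a two-point space). *)

theory Defs
  imports "HOL-Probability.Probability"
begin

abbreviation arms :: "'a::metric_space set \<Rightarrow> 'a measure" where
  "arms X \<equiv> restrict_space borel X"

text \<open>
  Randomized algorithms draw one private seed \<open>\<omega>\<close> from a law \<open>Q\<close> on the reals; every later decision
  is a measurable function of the seed and of the feedback observed so far. As compact metric
  spaces are standard Borel, this is as general as letting the algorithm draw every
  decision from a history-dependent distribution. Rounds are numbered from 0.
\<close>

definition seed_law :: "real measure \<Rightarrow> bool" where
  "seed_law Q \<longleftrightarrow> prob_space Q \<and> sets Q = sets borel"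


subsection \<open>The Lipschitz MAB problem\<close>

text \<open>
  The reward distributions form a Markov kernel, so that a reward drawn from the distribution
  of a random arm makes sense. For countable \<open>X\<close> this is no restriction, see
  \<open>reward_kernel_countable\<close> below.
\<close>

definition mab_instance ::
    "'a::metric_space set \<Rightarrow> ('a \<Rightarrow> real) \<Rightarrow> ('a \<Rightarrow> real measure) \<Rightarrow> bool" where
  "mab_instance X \<mu> \<nu> \<longleftrightarrow>
     \<mu> ` X \<subseteq> {0..1} \<and> 1-lipschitz_on X \<mu> \<and>
     \<nu> \<in> arms X \<rightarrow>\<^sub>M prob_algebra borel \<and>
     (\<forall>x\<in>X. (AE y in \<nu> x. y \<in> {0..1}) \<and> (\<integral>y. y \<partial>\<nu> x) = \<mu> x)"

definition mab_algorithm ::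
    "'a::metric_space set \<Rightarrow> real measure \<Rightarrow> (nat \<Rightarrow> real \<Rightarrow> (nat \<Rightarrow> real) \<Rightarrow> 'a) \<Rightarrow> bool" where
  "mab_algorithm X Q a \<longleftrightarrow> seed_law Q \<and>
     (\<forall>t. (\<lambda>(\<omega>, r). a t \<omega> r) \<in> Q \<Otimes>\<^sub>M (\<Pi>\<^sub>M s\<in>{..<t}. borel) \<rightarrow>\<^sub>M arms X)"

text \<open>The joint law of the seed and of the rewards of the rounds \<open>s < t\<close>.\<close>

primrec mab_law ::
    "real measure \<Rightarrow> (nat \<Rightarrow> real \<Rightarrow> (nat \<Rightarrow> real) \<Rightarrow> 'a) \<Rightarrow> ('a \<Rightarrow> real measure) \<Rightarrow>
     nat \<Rightarrow> (real \<times> (nat \<Rightarrow> real)) measure" where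
  "mab_law Q a \<nu> 0 = distr Q (Q \<Otimes>\<^sub>M (\<Pi>\<^sub>M s\<in>{..<0}. borel)) (\<lambda>\<omega>. (\<omega>, \<lambda>_. undefined))"
| "mab_law Q a \<nu> (Suc t) = mab_law Q a \<nu> t \<bind>
     (\<lambda>(\<omega>, r). distr (\<nu> (a t \<omega> r)) (Q \<Otimes>\<^sub>M (\<Pi>\<^sub>M s\<in>{..<Suc t}. borel)) (\<lambda>y. (\<omega>, r(t := y))))"

definition mab_regret ::
    "'a::metric_space set \<Rightarrow> real measure \<Rightarrow> (nat \<Rightarrow> real \<Rightarrow> (nat \<Rightarrow> real) \<Rightarrow> 'a) \<Rightarrow>
     ('a \<Rightarrow> real) \<Rightarrow> ('a \<Rightarrow> real measure) \<Rightarrow> nat \<Rightarrow> real" where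
  "mab_regret X Q a \<mu> \<nu> t = real t * (SUP x\<in>X. \<mu> x) -
     (\<integral>(\<omega>, r). (\<Sum>s<t. \<mu> (a s \<omega> (restrict r {..<s}))) \<partial>mab_law Q a \<nu> t)"

definition mab_tractable :: "'a::metric_space set \<Rightarrow> (nat \<Rightarrow> real) \<Rightarrow> bool" where
  "mab_tractable X f \<longleftrightarrow>
     (\<exists>Q a. mab_algorithm X Q a \<and>
       (\<forall>\<mu> \<nu>. mab_instance X \<mu> \<nu> \<longrightarrow> (\<exists>C. \<forall>t\<ge>1. mab_regret X Q a \<mu> \<nu> t \<le> C * f t)))"


subsection \<open>The Lipschitz experts problem\<close>

definition payoff_topology :: "'a set \<Rightarrow> ('a \<Rightarrow> real) topology" where
  "payoff_topology X = product_topology (\<lambda>_. top_of_set {0..1}) X"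

definition payoff_borel :: "'a set \<Rightarrow> ('a \<Rightarrow> real) measure" where
  "payoff_borel X = sigma (topspace (payoff_topology X)) {U. openin (payoff_topology X) U}"

definition expert_mean :: "('a \<Rightarrow> real) measure \<Rightarrow> 'a \<Rightarrow> real" where
  "expert_mean P x = (\<integral>f. f x \<partial>P)"

text \<open>
  Evaluating a random payoff function at a random point is not measurable for every Borel measure
  on the product space, so the payoff functions have to form a measurable process,
  up to a null set. This is no restriction for countable \<open>X\<close>, nor for measures
  that are concentrated on Lipschitz functions, see \<open>measurable_evaluation_countable\<close> and
  \<open>measurable_evaluation_lipschitz\<close> below.
\<close>

definition measurable_evaluation :: "'a::metric_space set \<Rightarrow> ('a \<Rightarrow> real) measure \<Rightarrow> bool" where
  "measurable_evaluation X P \<longleftrightarrow>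
     (\<exists>S\<in>sets P. emeasure P S = 1 \<and>
       (\<lambda>(f, x). f x) \<in> borel_measurable (restrict_space P S \<Otimes>\<^sub>M arms X))"

definition expert_instance :: "'a::metric_space set \<Rightarrow> ('a \<Rightarrow> real) measure \<Rightarrow> bool" where
  "expert_instance X P \<longleftrightarrow>
     prob_space P \<and> sets P = sets (payoff_borel X) \<and> measurable_evaluation X P \<and>
     1-lipschitz_on X (expert_mean P)"

definition payoff_support :: "'a set \<Rightarrow> ('a \<Rightarrow> real) measure \<Rightarrow> ('a \<Rightarrow> real) set" where
  "payoff_support X P =
     {f \<in> topspace (payoff_topology X).
        \<forall>U. openin (payoff_topology X) U \<and> f \<in> U \<longrightarrow> emeasure P U > 0}"

definition uniformly_lipschitz :: "'a::metric_space set \<Rightarrow> ('a \<Rightarrow> real) measure \<Rightarrow> bool" where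
  "uniformly_lipschitz X P \<longleftrightarrow> (\<forall>f\<in>payoff_support X P. 1-lipschitz_on X f)"

text \<open>
  The seed together with the independent payoff functions \<open>f\<^sub>0, f\<^sub>1, \<dots>\<close>. The completion
  takes care of the null set in \<open>measurable_evaluation\<close>.
\<close>

definition expert_space :: "real measure \<Rightarrow> ('a \<Rightarrow> real) measure \<Rightarrow>
    (real \<times> (nat \<Rightarrow> 'a \<Rightarrow> real)) measure" where
  "expert_space Q P = completion (Q \<Otimes>\<^sub>M (\<Pi>\<^sub>M t\<in>UNIV. P))"

definition expert_regret :: "'a set \<Rightarrow> real measure \<Rightarrow>
    (nat \<Rightarrow> real \<Rightarrow> (nat \<Rightarrow> 'a \<Rightarrow> real) \<Rightarrow> 'a) \<Rightarrow> ('a \<Rightarrow> real) measure \<Rightarrow> nat \<Rightarrow> real" where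
  "expert_regret X Q pick P t = real t * (SUP x\<in>X. expert_mean P x) -
     (\<integral>(\<omega>, \<phi>). (\<Sum>s<t. expert_mean P (pick s \<omega> \<phi>)) \<partial>expert_space Q P)"


paragraph \<open>Double feedback.\<close>

text \<open>In round \<open>t\<close> the algorithm chooses the pair \<open>a t \<omega> v = (x\<^sub>t, y\<^sub>t)\<close>, where \<open>v\<close> lists the pairs of
  values observed in the rounds \<open>s < t\<close>.\<close>

type_synonym 'a double_rule = "nat \<Rightarrow> real \<Rightarrow> (nat \<Rightarrow> real \<times> real) \<Rightarrow> 'a \<times> 'a"

definition double_algorithm ::
    "'a::metric_space set \<Rightarrow> real measure \<Rightarrow> 'a double_rule \<Rightarrow> bool" where
  "double_algorithm X Q a \<longleftrightarrow> seed_law Q \<and>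
     (\<forall>t. (\<lambda>(\<omega>, v). a t \<omega> v) \<in>
        Q \<Otimes>\<^sub>M (\<Pi>\<^sub>M s\<in>{..<t}. borel \<Otimes>\<^sub>M borel) \<rightarrow>\<^sub>M arms X \<Otimes>\<^sub>M arms X)"

primrec double_run :: "'a double_rule \<Rightarrow> real \<Rightarrow> (nat \<Rightarrow> 'a \<Rightarrow> real) \<Rightarrow>
    nat \<Rightarrow> (nat \<Rightarrow> real \<times> real)" where
  "double_run a \<omega> \<phi> 0 = (\<lambda>_. undefined)"
| "double_run a \<omega> \<phi> (Suc t) =
     (let v = double_run a \<omega> \<phi> t; (x, y) = a t \<omega> v in v(t := (\<phi> t x, \<phi> t y)))"

definition double_pick :: "'a double_rule \<Rightarrow> nat \<Rightarrow> real \<Rightarrow> (nat \<Rightarrow> 'a \<Rightarrow> real) \<Rightarrow> 'a" where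
  "double_pick a t \<omega> \<phi> = fst (a t \<omega> (double_run a \<omega> \<phi> t))"

definition double_tractable :: "'a::metric_space set \<Rightarrow> (nat \<Rightarrow> real) \<Rightarrow> bool" where
  "double_tractable X f \<longleftrightarrow>
     (\<exists>Q a. double_algorithm X Q a \<and>
       (\<forall>P. expert_instance X P \<longrightarrow>
         (\<exists>C. \<forall>t\<ge>1. expert_regret X Q (double_pick a) P t \<le> C * f t)))"


paragraph \<open>Full feedback.\<close>

text \<open>
  The algorithm acts in steps and observes one value per step: \<open>a i \<omega> v = (True, x)\<close> starts the
  next round by picking \<open>x\<close>, and \<open>a i \<omega> v = (False, z)\<close> queries the payoff function of the
  current round at \<open>z\<close>, where \<open>v\<close> lists the values observed in the steps before \<open>i\<close>. So the
  queries of a round may depend on each other's answers. As infinitely many steps start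
  a round, each round has finitely many queries.
\<close>

type_synonym 'a full_rule = "nat \<Rightarrow> real \<Rightarrow> (nat \<Rightarrow> real) \<Rightarrow> bool \<times> 'a"

definition full_algorithm ::
    "'a::metric_space set \<Rightarrow> real measure \<Rightarrow> 'a full_rule \<Rightarrow> bool" where
  "full_algorithm X Q a \<longleftrightarrow> seed_law Q \<and>
     (\<forall>i. (\<lambda>(\<omega>, v). a i \<omega> v) \<in>
        Q \<Otimes>\<^sub>M (\<Pi>\<^sub>M j\<in>{..<i}. borel) \<rightarrow>\<^sub>M count_space UNIV \<Otimes>\<^sub>M arms X) \<and>
     (\<forall>\<omega> v. fst (a 0 \<omega> (restrict v {..<0}))) \<and>
     (\<forall>\<omega> v. \<exists>\<^sub>\<infinity>i. fst (a i \<omega> (restrict v {..<i})))"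

text \<open>The number of rounds started before step \<open>i\<close>, and the values observed before step \<open>i\<close>.\<close>

primrec full_run :: "'a full_rule \<Rightarrow> real \<Rightarrow> (nat \<Rightarrow> 'a \<Rightarrow> real) \<Rightarrow>
    nat \<Rightarrow> nat \<times> (nat \<Rightarrow> real)" where
  "full_run a \<omega> \<phi> 0 = (0, \<lambda>_. undefined)"
| "full_run a \<omega> \<phi> (Suc i) =
     (let (k, v) = full_run a \<omega> \<phi> i; (b, x) = a i \<omega> v; k' = (if b then Suc k else k)
      in (k', v(i := \<phi> (k' - 1) x)))"

definition full_pick :: "'a full_rule \<Rightarrow> nat \<Rightarrow> real \<Rightarrow> (nat \<Rightarrow> 'a \<Rightarrow> real) \<Rightarrow> 'a" where
  "full_pick a t \<omega> \<phi> =
     (let i = (LEAST i. fst (full_run a \<omega> \<phi> (Suc i)) = Suc t)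
      in snd (a i \<omega> (snd (full_run a \<omega> \<phi> i))))"

definition full_tractable_uniform :: "'a::metric_space set \<Rightarrow> (nat \<Rightarrow> real) \<Rightarrow> bool" where
  "full_tractable_uniform X f \<longleftrightarrow>
     (\<exists>Q a. full_algorithm X Q a \<and>
       (\<forall>P. expert_instance X P \<and> uniformly_lipschitz X P \<longrightarrow>
         (\<exists>C. \<forall>t\<ge>1. expert_regret X Q (full_pick a) P t \<le> C * f t)))"


subsection \<open>The measurability conditions\<close>

lemma sets_arms_countable:
  fixes X :: "'a::metric_space set"
  assumes "countable X"
  shows "sets (arms X) = Pow X"
proof -
  have "A \<in> (\<inter>) X ` sets borel" if "A \<subseteq> X" for A
  proof -
    have "countable A" using that assms countable_subset by blast
    then have "A \<in> sets borel"
      using sets.countable[of A borel] by auto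
    then show ?thesis using that by (intro image_eqI[of _ _ A]) auto
  qed
  then show ?thesis by (auto simp: sets_restrict_space)
qed

lemma arms_countable:
  "countable X \<Longrightarrow> sets (arms X) = sets (count_space X)"
  by (simp add: sets_arms_countable)

lemma reward_kernel_countable:
  assumes "countable X" "\<And>x. x \<in> X \<Longrightarrow> prob_space (\<nu> x) \<and> sets (\<nu> x) = sets borel"
  shows "\<nu> \<in> arms X \<rightarrow>\<^sub>M prob_algebra borel"
  using assms(2) by (subst measurable_cong_sets[OF arms_countable[OF assms(1)] refl])
    (auto simp: space_prob_algebra)

lemma space_payoff_borel: "space (payoff_borel X) = (X \<rightarrow>\<^sub>E {0..1})"
proof -
  have "{U. openin (payoff_topology X) U} \<subseteq> Pow (topspace (payoff_topology X))"
    by (auto dest: openin_subset)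
  then have "space (payoff_borel X) = topspace (payoff_topology X)"
    unfolding payoff_borel_def by (rule space_measure_of)
  then show ?thesis by (simp add: payoff_topology_def)
qed

lemma openin_payoff_borel: "openin (payoff_topology X) U \<Longrightarrow> U \<in> sets (payoff_borel X)"
  unfolding payoff_borel_def
  by (subst sets_measure_of) (auto dest: openin_subset)

lemma closedin_payoff_borel:
  assumes "closedin (payoff_topology X) S" shows "S \<in> sets (payoff_borel X)"
proof -
  have "topspace (payoff_topology X) - S \<in> sets (payoff_borel X)"
    using assms by (intro openin_payoff_borel) (auto simp: closedin_def)
  from sets.compl_sets[OF this] show ?thesis
    using closedin_subset[OF assms]
    by (simp add: space_payoff_borel payoff_topology_def double_diff)
qed

lemma continuous_map_payoff_eval:
  assumes "x \<in> X" shows "continuous_map (payoff_topology X) euclidean (\<lambda>f. f x)"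
  using continuous_map_product_projection[OF assms, of "\<lambda>_. top_of_set {0..1::real}"]
  unfolding payoff_topology_def by (rule continuous_map_into_fulltopology)

lemma measurable_payoff_eval:
  assumes "x \<in> X" shows "(\<lambda>f. f x) \<in> borel_measurable (payoff_borel X)"
proof (rule borel_measurableI)
  fix S :: "real set" assume "open S"
  then have "openin (payoff_topology X) {f \<in> topspace (payoff_topology X). f x \<in> S}"
    using openin_continuous_map_preimage[OF continuous_map_payoff_eval[OF assms]] by simp
  then have "{f \<in> topspace (payoff_topology X). f x \<in> S} \<in> sets (payoff_borel X)"
    by (rule openin_payoff_borel)
  moreover have "(\<lambda>f. f x) -` S \<inter> space (payoff_borel X) =
      {f \<in> topspace (payoff_topology X). f x \<in> S}"
    by (auto simp: space_payoff_borel payoff_topology_def)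
  ultimately show "(\<lambda>f. f x) -` S \<inter> space (payoff_borel X) \<in> sets (payoff_borel X)"
    by simp
qed

lemma measurable_evaluation_countable:
  assumes "countable X" "prob_space P" "sets P = sets (payoff_borel X)"
  shows "measurable_evaluation X P"
proof -
  have *: "(\<lambda>f. f x) \<in> borel_measurable P" if "x \<in> X" for x
    using measurable_payoff_eval[OF that] assms(3) by (simp cong: measurable_cong_sets)
  have "(\<lambda>p. (fst p) (snd p)) \<in> borel_measurable (P \<Otimes>\<^sub>M count_space X)"
    by (rule measurable_compose_countable'[where f="\<lambda>x p. (fst p) x" and I=X])
      (use assms(1) * in \<open>auto intro: measurable_compose[OF measurable_fst]\<close>)
  then have "(\<lambda>(f, x). f x) \<in> borel_measurable (P \<Otimes>\<^sub>M arms X)"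
    using measurable_cong_sets[OF sets_pair_measure_cong[OF refl[of "sets P"]
          arms_countable[OF assms(1)]] refl[of "sets (borel :: real measure)"]]
    unfolding case_prod_beta' by (simp only:)
  moreover have sets_space: "sets (restrict_space P (space P)) = sets P"
    using sets.sets_into_space by (force simp: sets_restrict_space)
  ultimately have "(\<lambda>(f, x). f x) \<in> borel_measurable (restrict_space P (space P) \<Otimes>\<^sub>M arms X)"
    using measurable_cong_sets[OF sets_pair_measure_cong[OF sets_space
          refl[of "sets (arms X)"]] refl[of "sets (borel :: real measure)"]] by blast
  then show ?thesis
    unfolding measurable_evaluation_def
    using prob_space.emeasure_space_1[OF assms(2)] by (intro bexI[of _ "space P"]) auto
qed

lemma closedin_lipschitz:
  fixes X :: "'a::metric_space set"
  shows "closedin (payoff_topology X) {f \<in> topspace (payoff_topology X). 1-lipschitz_on X f}"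
proof (cases "X = {}")
  case True
  then show ?thesis by (simp add: lipschitz_on_def)
next
  case False
  let ?T = "payoff_topology X"
  let ?S = "\<lambda>x y. {f \<in> topspace ?T. dist (f x) (f y) \<in> {..dist x y}}"
  have cl: "closedin ?T (?S x y)" if "x \<in> X" "y \<in> X" for x y
  proof (rule closedin_continuous_map_preimage)
    show "continuous_map ?T euclideanreal (\<lambda>f. dist (f x) (f y))"
      unfolding dist_real_def
      by (intro continuous_map_real_abs continuous_map_diff continuous_map_payoff_eval that)
  qed simp
  have "{f \<in> topspace ?T. 1-lipschitz_on X f} = \<Inter> ((\<lambda>(x, y). ?S x y) ` (X \<times> X))"
    using False by (auto simp: lipschitz_on_def)
  moreover have "closedin ?T (\<Inter> ((\<lambda>(x, y). ?S x y) ` (X \<times> X)))"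
    using False cl by (intro closedin_Inter) auto
  ultimately show ?thesis by simp
qed

lemma measurable_evaluation_lipschitz:
  assumes "compact X" "prob_space P" "sets P = sets (payoff_borel X)"
    and "AE f in P. 1-lipschitz_on X f"
  shows "measurable_evaluation X P"
proof (cases "X = {}")
  case True
  then show ?thesis using measurable_evaluation_countable assms by blast
next
  case False
  define S where "S = {f \<in> topspace (payoff_topology X). 1-lipschitz_on X f}"
  have S: "S \<in> sets P"
    using closedin_payoff_borel[OF closedin_lipschitz] assms(3) by (simp add: S_def)
  have top: "topspace (payoff_topology X) = space P"
    using sets_eq_imp_space_eq[OF assms(3)] by (simp add: space_payoff_borel payoff_topology_def)
  have "AE f in P. f \<in> S"
    using assms(4) AE_space by eventually_elim (auto simp: S_def top)
  then have S1: "emeasure P S = 1"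
    using prob_space.emeasure_eq_1_AE[OF assms(2) S] by blast
  have "\<exists>K. finite K \<and> K \<subseteq> X \<and> X \<subseteq> (\<Union>x\<in>K. ball x (1 / real (Suc n)))" for n
    using seq_compact_imp_totally_bounded[OF compact_imp_seq_compact[OF assms(1)]] by simp
  then obtain K where K: "\<And>n. finite (K n)" "\<And>n. K n \<subseteq> X"
      "\<And>n. X \<subseteq> (\<Union>x\<in>K n. ball x (1 / real (Suc n)))"
    by metis
  define D where "D = (\<Union>n. K n)"
  have D: "countable D" "D \<subseteq> X"
    using K(1,2) by (auto simp: D_def intro: countable_finite)
  have dense: "\<exists>y\<in>D. dist y x < 1 / real (Suc n)" if "x \<in> X" for x n
    using K(3)[of n] that by (force simp: D_def)
  have "D \<noteq> {}" using dense False by blast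
  define e where "e = from_nat_into D"
  have e: "e k \<in> X" for k
    using from_nat_into[OF \<open>D \<noteq> {}\<close>] D(2) by (auto simp: e_def)
  define d where "d n x = (LEAST k. dist (e k) x < 1 / real (Suc n))" for n and x :: 'a
  have d: "dist (e (d n x)) x < 1 / real (Suc n)" if "x \<in> X" for n x
  proof -
    have "\<exists>k. dist (e k) x < 1 / real (Suc n)"
      unfolding e_def using dense[OF that] from_nat_into_surj[OF D(1)] by metis
    then show ?thesis unfolding d_def by (rule LeastI_ex)
  qed
  have [measurable]: "dist (e k) \<in> borel_measurable (arms X)" for k
    by (intro measurable_restrict_space1 borel_measurable_continuous_onI continuous_intros)
  have "Measurable.pred (arms X) (\<lambda>x. dist (e k) x < 1 / real (Suc n))" for n k
    by (rule borel_measurable_pred_less) auto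
  then have dm[measurable]: "d n \<in> arms X \<rightarrow>\<^sub>M count_space UNIV" for n
    unfolding d_def by (rule measurable_Least)
  let ?M = "restrict_space P S \<Otimes>\<^sub>M arms X"
  have ev: "(\<lambda>f. f (e k)) \<in> borel_measurable (restrict_space P S)" for k
    using measurable_payoff_eval[OF e] assms(3)
    by (intro measurable_restrict_space1) (subst measurable_cong_sets[OF assms(3) refl])
  have "(\<lambda>p. (fst p) (snd p)) \<in> borel_measurable ?M"
  proof (rule borel_measurable_LIMSEQ_real)
    show "(\<lambda>p. (fst p) (e (d n (snd p)))) \<in> borel_measurable ?M" for n
      by (rule measurable_compose_countable[where f="\<lambda>k p. (fst p) (e k)"])
        (auto intro: measurable_compose[OF measurable_fst ev])
    fix p assume "p \<in> space ?M"
    then have p: "1-lipschitz_on X (fst p)" "snd p \<in> X"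
      by (auto simp: space_pair_measure space_restrict_space S_def)
    show "(\<lambda>n. (fst p) (e (d n (snd p)))) \<longlonglongrightarrow> (fst p) (snd p)"
    proof (rule tendsto_dist_iff[THEN iffD2], rule tendsto_sandwich[OF _ _ tendsto_const])
      show "(\<lambda>n. 1 / real (Suc n)) \<longlonglongrightarrow> 0"
        using LIMSEQ_inverse_real_of_nat by (simp add: inverse_eq_divide)
      have "dist ((fst p) (e (d n (snd p)))) ((fst p) (snd p)) \<le> 1 / real (Suc n)" for n
        using lipschitz_onD[OF p(1) e[of "d n (snd p)"] p(2)] d[OF p(2), of n] by simp
      then show "\<forall>\<^sub>F n in sequentially.
          dist ((fst p) (e (d n (snd p)))) ((fst p) (snd p)) \<le> 1 / real (Suc n)"
        by simp
    qed simp
  qed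
  then show ?thesis
    unfolding measurable_evaluation_def using S S1
    by (intro bexI[of _ S]) (auto simp: case_prod_beta')
qed

lemma uniformly_lipschitz_AE:
  assumes "prob_space P" "sets P = sets (payoff_borel X)" "AE f in P. 1-lipschitz_on X f"
  shows "uniformly_lipschitz X P"
proof -
  define U where "U = topspace (payoff_topology X) - {f \<in> topspace (payoff_topology X). 1-lipschitz_on X f}"
  have U: "openin (payoff_topology X) U"
    unfolding U_def using closedin_lipschitz by blast
  have "emeasure P U = 0"
  proof (subst AE_iff_measurable[symmetric, where P="\<lambda>f. 1-lipschitz_on X f"])
    show "U \<in> sets P" using openin_payoff_borel[OF U] assms(2) by simp
    show "{f \<in> space P. \<not> 1-lipschitz_on X f} = U"
      using sets_eq_imp_space_eq[OF assms(2)]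
      by (auto simp: U_def space_payoff_borel payoff_topology_def)
  qed fact
  then show ?thesis
    using U unfolding uniformly_lipschitz_def payoff_support_def
    by (auto simp: U_def simp del: topspace_product_topology)
qed

end

theory Submission
  imports Defs "HOL-Library.Bourbaki_Witt_Fixpoint" "HOL-Library.Discrete_Functions"
    "HOL-Real_Asymp.Real_Asymp"
begin

text \<open>
  If \<open>X\<close> is countable, removing isolated points transfinitely often gives a total order on \<open>X\<close> for
  which the mean payoff has a last maximizer \<open>x\<close>, and compactness separates \<open>\<mu> x\<close> from the values of
  \<open>\<mu>\<close> at all points after \<open>x\<close>. Hence the last point of a finite sample of arms whose estimated mean
  is nearly maximal is exactly \<open>x\<close>, up to an exponentially small error probability. With double
  feedback the exploration is free and the error probabilities are summable. In the bandit problem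
  one explores at the start of the epochs \<open>[2 ^ 2 ^ j, 2 ^ 2 ^ (j + 1))\<close>, with slightly more than
  logarithmically many rounds.

  If \<open>X\<close> is uncountable, condensation points yield Lipschitz functions \<open>h k\<close> with values in
  \<open>[- r k, r k]\<close> such that every pattern of signs is attained by some point with \<open>h k = \<plusminus> r k\<close> for
  all \<open>k\<close>. The payoff functions are \<open>1/2 \<plusminus> h K\<close> for a random level \<open>K\<close>, and at level \<open>k\<close> the sign
  has a bias of order \<open>1 / sqrt (T k)\<close>, which \<open>T k\<close> rounds do not reveal. Choosing the favoured
  signs recursively against the algorithm forces regret of order \<open>sqrt (T k)\<close> at time \<open>T k\<close> for all
  \<open>k\<close>, up to a factor that depends only on \<open>k\<close>; and \<open>T\<close> may be chosen as sparse as one likes.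
\<close>


subsection \<open>Uncountable compact metric spaces\<close>

definition condensation_point :: "'a::metric_space \<Rightarrow> 'a set \<Rightarrow> bool" where
  "condensation_point p C \<longleftrightarrow> (\<forall>e>0. uncountable (C \<inter> cball p e))"

lemma condensation_point_mono:
  assumes "condensation_point p C" "C \<subseteq> D"
  shows "condensation_point p D"
proof -
  have "C \<inter> cball p e \<subseteq> D \<inter> cball p e" for e
    using assms(2) by blast
  then show ?thesis
    using assms(1) countable_subset unfolding condensation_point_def by metis
qed

lemma compact_condensation_point:
  fixes C :: "'a::metric_space set"
  assumes "compact C" "uncountable C"
  shows "\<exists>p\<in>C. condensation_point p C"
proof (rule ccontr)
  assume "\<not> ?thesis"
  then obtain e where e: "\<And>p. p \<in> C \<Longrightarrow> e p > 0 \<and> countable (C \<inter> cball p (e p))"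
    unfolding condensation_point_def by metis
  then have "C \<subseteq> (\<Union>p\<in>C. ball p (e p))"
    by auto
  then obtain K where K: "K \<subseteq> C" "finite K" "C \<subseteq> (\<Union>p\<in>K. ball p (e p))"
    by (rule compactE_image[OF assms(1) open_ball])
  have "countable (\<Union>p\<in>K. C \<inter> cball p (e p))"
    using K e by (intro countable_UN) (auto intro: countable_finite)
  moreover have "C \<subseteq> (\<Union>p\<in>K. C \<inter> cball p (e p))"
    using K(3) by (force simp: subset_iff)
  ultimately show False
    using assms(2) countable_subset by blast
qed

lemma infinite_condensation_points:
  fixes C :: "'a::metric_space set"
  assumes C: "compact C" "uncountable C"
  shows "infinite {p\<in>C. condensation_point p C}"
proof
  let ?F = "{p\<in>C. condensation_point p C}"
  assume F: "finite ?F"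
  have "openin (top_of_set C) (C - ?F)"
    using openin_open_Int[OF open_Compl[OF finite_imp_closed[OF F]], of C] by (simp add: Diff_eq)
  moreover have "metrizable_space (top_of_set C)"
    by (intro metrizable_space_subtopology metrizable_space_euclidean)
  ultimately have "fsigma_in (top_of_set C) (C - ?F)"
    by (intro open_imp_fsigma_in)
  then obtain \<D> where \<D>: "countable \<D>" "\<And>D. D \<in> \<D> \<Longrightarrow> closedin (top_of_set C) D" "\<Union>\<D> = C - ?F"
    by (auto simp: fsigma_in_def union_of_def subset_iff)
  have "uncountable (\<Union>\<D>)"
    using C(2) F by (simp add: \<D>(3) countable_finite uncountable_minus_countable)
  then obtain D where D: "D \<in> \<D>" "uncountable D"
    using \<D>(1) countable_UN[of \<D> "\<lambda>D. D"] by auto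
  then obtain p where p: "p \<in> D" "condensation_point p D"
    using compact_condensation_point closedin_compact[OF C(1) \<D>(2)] by blast
  moreover have "D \<subseteq> C - ?F"
    using D(1) \<D>(3) by blast
  ultimately show False
    using condensation_point_mono by blast
qed

lemma distinct_representatives_of_infinite_sets:
  assumes "finite I" "\<And>i. i \<in> I \<Longrightarrow> infinite (S i)"
  shows "\<exists>g. inj_on g I \<and> (\<forall>i\<in>I. g i \<in> S i)"
  using assms
proof (induction I)
  case (insert i I)
  then obtain g where g: "inj_on g I" "\<forall>i\<in>I. g i \<in> S i"
    by auto
  have "infinite (S i - g ` I)"
    using insert.prems insert.hyps(1) by simp
  then obtain p where p: "p \<in> S i" "p \<notin> g ` I"
    by (metis DiffE ex_in_conv finite.emptyI)
  have "inj_on (g(i := p)) (insert i I)"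
    using g(1) p(2) insert.hyps(2) by (auto simp: inj_on_def)
  moreover have "\<forall>j\<in>insert i I. (g(i := p)) j \<in> S j"
    using g(2) p(1) by simp
  ultimately show ?case by blast
qed simp

lemma finite_imp_uniform_discrete: "finite S \<Longrightarrow> uniform_discrete S"
  by (induction S rule: finite_induct) (simp_all add: uniform_discrete_insert)

lemma uncountable_compacts_split:
  fixes \<C> :: "'a::metric_space set set"
  assumes "finite \<C>" "\<And>C. C \<in> \<C> \<Longrightarrow> compact C \<and> uncountable C"
  shows "\<exists>A :: bool \<Rightarrow> 'a set. (\<forall>b. closed (A b)) \<and> A True \<inter> A False = {} \<and>
    (\<forall>C\<in>\<C>. \<forall>b. uncountable (C \<inter> A b))"
proof -
  let ?I = "\<C> \<times> (UNIV :: bool set)"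
  have "\<exists>g. inj_on g ?I \<and> (\<forall>i\<in>?I. g i \<in> {p \<in> fst i. condensation_point p (fst i)})"
    using assms by (intro distinct_representatives_of_infinite_sets infinite_condensation_points) auto
  then obtain g where g: "inj_on g ?I" "\<And>C b. C \<in> \<C> \<Longrightarrow> condensation_point (g (C, b)) C"
    by force
  have "finite (g ` ?I)"
    using assms(1) by simp
  then obtain d where d: "d > 0" "\<And>i j. i \<in> ?I \<Longrightarrow> j \<in> ?I \<Longrightarrow> dist (g i) (g j) < d \<Longrightarrow> g i = g j"
    using finite_imp_uniform_discrete unfolding uniform_discrete_def by (metis imageI)
  define A where "A b = (\<Union>C\<in>\<C>. cball (g (C, b)) (d / 3))" for b
  have "A True \<inter> A False = {}"
  proof (rule ccontr)
    assume "A True \<inter> A False \<noteq> {}"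
    then obtain x C D where CD: "C \<in> \<C>" "D \<in> \<C>"
      and x: "dist (g (C, True)) x \<le> d / 3" "dist (g (D, False)) x \<le> d / 3"
      by (auto simp: A_def)
    have "dist (g (C, True)) (g (D, False)) < d"
      using dist_triangle2[of "g (C, True)" "g (D, False)" x] x d(1) by linarith
    then have "g (C, True) = g (D, False)"
      using CD by (intro d(2)) auto
    then show False
      using inj_onD[OF g(1), of "(C, True)" "(D, False)"] CD by auto
  qed
  moreover have "uncountable (C \<inter> A b)" if "C \<in> \<C>" for C b
  proof -
    have "C \<inter> cball (g (C, b)) (d / 3) \<subseteq> C \<inter> A b"
      using that by (auto simp: A_def)
    then show ?thesis
      using g(2)[OF that] d(1) countable_subset unfolding condensation_point_def
      by (metis divide_pos_pos zero_less_numeral)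
  qed
  moreover have "closed (A b)" for b
    unfolding A_def using assms(1) by auto
  ultimately show ?thesis by blast
qed

lemma compact_INT_nonempty:
  fixes S :: "nat \<Rightarrow> 'a::t2_space set"
  assumes "\<And>n. compact (S n)" "\<And>n. S n \<noteq> {}" "decseq S"
  shows "\<Inter>(range S) \<noteq> {}"
proof -
  have "S 0 \<inter> \<Inter>(range S) \<noteq> {}"
  proof (rule compact_imp_fip_image[OF assms(1)])
    show "closed (S n)" for n
      using assms(1) by (rule compact_imp_closed)
    show "S 0 \<inter> \<Inter>(S ` I) \<noteq> {}" if "finite I" for I
    proof -
      have "S (Max (insert 0 I)) \<subseteq> S n" if "n \<in> insert 0 I" for n
        using decseqD[OF assms(3) Max_ge] \<open>finite I\<close> that by blast
      then have "S (Max (insert 0 I)) \<subseteq> S 0 \<inter> \<Inter>(S ` I)"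
        by blast
      then show ?thesis
        using assms(2) by blast
    qed
  qed
  then show ?thesis by blast
qed

lemma uncountable_compact_binary_scheme:
  fixes X :: "'a::metric_space set"
  assumes "compact X" "uncountable X"
  obtains A :: "nat \<Rightarrow> bool \<Rightarrow> 'a set" where "\<And>k b. closed (A k b)" "\<And>k. A k True \<inter> A k False = {}"
    "\<And>\<beta> k. uncountable (X \<inter> (\<Inter>j<k. A j (\<beta> j)))"
proof -
  define good where "good \<C> \<longleftrightarrow> finite \<C> \<and> (\<forall>C\<in>\<C>. compact C \<and> uncountable C)"
    for \<C> :: "'a set set"
  have "\<forall>\<C>. \<exists>A :: bool \<Rightarrow> 'a set. good \<C> \<longrightarrow> (\<forall>b. closed (A b)) \<and> A True \<inter> A False = {} \<and>
      (\<forall>C\<in>\<C>. \<forall>b. uncountable (C \<inter> A b))"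
    using uncountable_compacts_split unfolding good_def by metis
  then obtain A :: "'a set set \<Rightarrow> bool \<Rightarrow> 'a set" where A: "\<And>\<C> b. good \<C> \<Longrightarrow> closed (A \<C> b)"
    "\<And>\<C>. good \<C> \<Longrightarrow> A \<C> True \<inter> A \<C> False = {}"
    "\<And>\<C> C b. good \<C> \<Longrightarrow> C \<in> \<C> \<Longrightarrow> uncountable (C \<inter> A \<C> b)"
    by metis
  define \<C> where "\<C> = rec_nat {X} (\<lambda>_ \<C>. (\<lambda>(C, b). C \<inter> A \<C> b) ` (\<C> \<times> UNIV))"
  have good: "good (\<C> k)" for k
  proof (induction k)
    case (Suc k)
    then show ?case
      using A(1,3)[OF Suc] by (auto simp: \<C>_def good_def)
  qed (use assms in \<open>simp add: \<C>_def good_def\<close>)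
  have branch: "X \<inter> (\<Inter>j<k. A (\<C> j) (\<beta> j)) \<in> \<C> k" for \<beta> k
  proof (induction k)
    case (Suc k)
    have "X \<inter> (\<Inter>j<Suc k. A (\<C> j) (\<beta> j)) = X \<inter> (\<Inter>j<k. A (\<C> j) (\<beta> j)) \<inter> A (\<C> k) (\<beta> k)"
      by (auto simp: lessThan_Suc)
    with Suc show ?case by (force simp: \<C>_def)
  qed (simp add: \<C>_def)
  have "uncountable (X \<inter> (\<Inter>j<k. A (\<C> j) (\<beta> j)))" for \<beta> k
    using branch good[of k] unfolding good_def by blast
  with A(1,2)[OF good] show ?thesis
    by (rule that)
qed

lemma independent_closed_pairs:
  fixes X :: "'a::metric_space set"
  assumes "compact X" "uncountable X"
  obtains A :: "nat \<Rightarrow> bool \<Rightarrow> 'a set" where "\<And>k b. closed (A k b)" "\<And>k. A k True \<inter> A k False = {}"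
    "\<And>\<beta>. \<exists>x\<in>X. \<forall>k. x \<in> A k (\<beta> k)"
proof -
  obtain A :: "nat \<Rightarrow> bool \<Rightarrow> 'a set" where A: "\<And>k b. closed (A k b)" "\<And>k. A k True \<inter> A k False = {}"
    "\<And>\<beta> k. uncountable (X \<inter> (\<Inter>j<k. A j (\<beta> j)))"
    using uncountable_compact_binary_scheme[OF assms] by blast
  have "\<exists>x\<in>X. \<forall>k. x \<in> A k (\<beta> k)" for \<beta>
  proof -
    define S where "S k = X \<inter> (\<Inter>j<k. A j (\<beta> j))" for k
    have "\<Inter>(range S) \<noteq> {}"
    proof (rule compact_INT_nonempty)
      show "compact (S k)" for k
        unfolding S_def using assms(1) A(1) by (intro compact_Int_closed closed_INT) auto
      show "S k \<noteq> {}" for k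
        using A(3)[of \<beta> k] unfolding S_def by force
      show "decseq S"
        by (force simp: S_def decseq_def)
    qed
    then obtain x where x: "\<And>k. x \<in> S k" by blast
    have "x \<in> A k (\<beta> k)" for k
      using x[of "Suc k"] by (simp add: S_def)
    then show ?thesis
      using x[of 0] by (auto simp: S_def)
  qed
  with A(1,2) show ?thesis
    by (rule that)
qed

definition unit_sign :: "bool \<Rightarrow> real" where
  "unit_sign b = (if b then 1 else - 1)"

lemma unit_sign_simps [simp]:
  "unit_sign True = 1" "unit_sign False = - 1" "\<bar>unit_sign b\<bar> = 1"
  by (simp_all add: unit_sign_def)

lemma abs_clip_diff_le:
  fixes u v r :: real shows "\<bar>max (- r) (min r u) - max (- r) (min r v)\<bar> \<le> \<bar>u - v\<bar>"
  by (auto simp: max_def min_def)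

lemma compact_closed_separated:
  fixes S T :: "'a::metric_space set"
  assumes "compact S" "closed T" "S \<inter> T = {}"
  shows "\<exists>\<eta>>0. \<forall>x\<in>S. \<forall>y\<in>T. \<eta> \<le> dist x y"
proof (cases "S = {} \<or> T = {}")
  case True
  then show ?thesis
    using zero_less_one by blast
next
  case False
  then obtain x where x: "x \<in> S" "\<And>y. y \<in> S \<Longrightarrow> infdist x T \<le> infdist y T"
    using continuous_attains_inf[OF assms(1) _ continuous_on_infdist[OF continuous_on_id], of T] by auto
  have "infdist x T > 0"
    using x(1) assms(2,3) False by (intro infdist_pos_not_in_closed) auto
  moreover have "infdist x T \<le> dist y z" if "y \<in> S" "z \<in> T" for y z
    using x(2)[OF that(1)] infdist_le[OF that(2), of y] by simp
  ultimately show ?thesis by blast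
qed

lemma lipschitz_sign_function:
  fixes A :: "bool \<Rightarrow> 'a::metric_space set"
  assumes "\<And>b. compact (A b)" "\<And>b. A b \<noteq> {}" "A True \<inter> A False = {}"
  shows "\<exists>r h. 0 < r \<and> r \<le> 1 / 2 \<and> (\<forall>x. \<bar>h x\<bar> \<le> r) \<and> 1-lipschitz_on UNIV h \<and>
    (\<forall>b. \<forall>x\<in>A b. h x = unit_sign b * r)"
proof -
  obtain \<eta> where "\<eta> > 0" and \<eta>: "\<And>x y. x \<in> A True \<Longrightarrow> y \<in> A False \<Longrightarrow> \<eta> \<le> dist x y"
    using compact_closed_separated[OF assms(1) compact_imp_closed[OF assms(1)] assms(3)] by blast
  define r where "r = min (1 / 2) (\<eta> / 2)"
  define u where "u x = (infdist x (A False) - infdist x (A True)) / 2" for x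
  define h where "h x = max (- r) (min r (u x))" for x
  have r: "0 < r" "r \<le> 1 / 2" "r \<le> \<eta> / 2"
    using \<open>\<eta> > 0\<close> by (auto simp: r_def)
  have "\<bar>h x\<bar> \<le> r" for x
    using r(1) by (auto simp: h_def)
  moreover have "1-lipschitz_on UNIV h"
  proof (rule lipschitz_onI)
    fix x y
    have "\<bar>u x - u y\<bar> \<le> dist x y"
      using infdist_triangle_abs[of x "A True" y] infdist_triangle_abs[of x "A False" y]
      unfolding u_def abs_le_iff by argo
    then show "dist (h x) (h y) \<le> 1 * dist x y"
      unfolding dist_real_def h_def by (intro order_trans[OF abs_clip_diff_le]) auto
  qed simp
  moreover have "h x = unit_sign b * r" if "x \<in> A b" for b x
  proof -
    have "\<eta> \<le> infdist x (A (\<not> b))"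
      unfolding infdist_notempty[OF assms(2)]
      using \<eta> that assms(2) by (intro cINF_greatest) (cases b; force simp: dist_commute)+
    moreover have "infdist x (A b) = 0"
      using that by simp
    ultimately show ?thesis
      using r by (cases b) (auto simp: h_def u_def)
  qed
  ultimately show ?thesis
    using r by blast
qed

lemma uncountable_compact_lipschitz_coordinates:
  fixes X :: "'a::metric_space set"
  assumes "compact X" "uncountable X"
  obtains h :: "nat \<Rightarrow> 'a \<Rightarrow> real" and r :: "nat \<Rightarrow> real"
  where "\<And>k. 0 < r k" "\<And>k. r k \<le> 1 / 2" "\<And>k x. \<bar>h k x\<bar> \<le> r k" "\<And>k. 1-lipschitz_on UNIV (h k)"
    "\<And>\<beta>. \<exists>x\<in>X. \<forall>k. h k x = unit_sign (\<beta> k) * r k"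
proof -
  obtain A :: "nat \<Rightarrow> bool \<Rightarrow> 'a set" where A: "\<And>k b. closed (A k b)" "\<And>k. A k True \<inter> A k False = {}"
    "\<And>\<beta>. \<exists>x\<in>X. \<forall>k. x \<in> A k (\<beta> k)"
    using independent_closed_pairs[OF assms] by blast
  have "\<exists>r h. 0 < r \<and> r \<le> 1 / 2 \<and> (\<forall>x. \<bar>h x\<bar> \<le> r) \<and> 1-lipschitz_on UNIV h \<and>
      (\<forall>b. \<forall>x\<in>X \<inter> A k b. h x = unit_sign b * r)" for k
  proof (rule lipschitz_sign_function)
    show "compact (X \<inter> A k b)" for b
      using assms(1) A(1) by (rule compact_Int_closed)
    show "X \<inter> A k b \<noteq> {}" for b
      using A(3)[of "\<lambda>_. b"] by blast
    show "X \<inter> A k True \<inter> (X \<inter> A k False) = {}"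
      using A(2) by blast
  qed
  then obtain r h where rh: "\<And>k. 0 < r k" "\<And>k. r k \<le> 1 / 2" "\<And>k x. \<bar>h k x\<bar> \<le> r k"
    "\<And>k. 1-lipschitz_on UNIV (h k)" "\<And>k b x. x \<in> X \<inter> A k b \<Longrightarrow> h k x = unit_sign b * r k"
    by metis
  have "\<exists>x\<in>X. \<forall>k. h k x = unit_sign (\<beta> k) * r k" for \<beta>
    using A(3)[of \<beta>] rh(5) by blast
  with rh(1-4) show ?thesis
    by (rule that)
qed


subsection \<open>Countable compact metric spaces\<close>

lemma countable_compact_isolated_point:
  fixes C :: "'a::metric_space set"
  assumes "compact C" "countable C" "C \<noteq> {}"
  shows "\<exists>p. p isolated_in C"
proof (rule ccontr)
  assume "\<not> ?thesis"
  then have "\<forall>x\<in>C. x islimpt C"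
    using isolated_in_islimpt_iff by metis
  then have "top_of_set C derived_set_of C = C"
    unfolding derived_set_of_subtopology
    by (auto simp: in_derived_set_of islimpt_def) metis
  moreover have "locally_compact_space (top_of_set C) \<and> Hausdorff_space (top_of_set C)"
    using assms(1)
    by (auto intro!: compact_imp_locally_compact_space
        simp: Hausdorff_space_subtopology compact_space_subtopology)
  ultimately have "(UNIV :: real set) \<lesssim> C"
    using lepoll_perfect_set assms(3) by blast
  then show False
    using assms(2) countable_lepoll uncountable_UNIV_real by blast
qed

lemma compact_diff_isolated_point:
  assumes "compact C" "p isolated_in C"
  shows "compact (C - {p})"
proof -
  obtain T where "open T" "T \<inter> C = {p}"
    using assms(2) by (rule isolated_inE)
  then have "C - {p} = C - T" "compact (C - T)"
    using assms(1) by (auto intro: compact_diff)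
  then show ?thesis by simp
qed

lemma compact_diff_Union:
  fixes X :: "'a::t2_space set"
  assumes "compact X" "\<And>U. U \<in> \<M> \<Longrightarrow> compact (X - U)"
  shows "compact (X - \<Union>\<M>)"
proof -
  have "X - \<Union>\<M> = X \<inter> (\<Inter>U\<in>\<M>. X - U)"
    by auto
  moreover have "closed (\<Inter>U\<in>\<M>. X - U)"
    using assms(2) by (intro closed_INT) (simp add: compact_imp_closed)
  ultimately show ?thesis
    using assms(1) by (simp add: compact_Int_closed)
qed

lemma transfinite_iterates_of_increasing:
  fixes f :: "'a set \<Rightarrow> 'a set"
  assumes "\<And>U. U \<subseteq> f U"
  obtains \<T> where "\<And>U. U \<in> \<T> \<Longrightarrow> f U \<in> \<T>" "\<And>\<M>. \<M> \<subseteq> \<T> \<Longrightarrow> \<Union>\<M> \<in> \<T>"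
    "\<And>U V. U \<in> \<T> \<Longrightarrow> V \<in> \<T> \<Longrightarrow> U \<subseteq> V \<or> V \<subseteq> U"
    "\<And>P. \<forall>U. P U \<longrightarrow> P (f U) \<Longrightarrow> \<forall>\<M>. (\<forall>U\<in>\<M>. P U) \<longrightarrow> P (\<Union>\<M>) \<Longrightarrow> \<forall>U\<in>\<T>. P U"
proof -
  interpret bourbaki_witt_fixpoint Sup "{(x, y). x \<subseteq> y}" f
    using assms by (intro bourbaki_witt_fixpoint_complete_latticeI) auto
  have "{} \<in> Field {(x, y). x \<subseteq> (y :: 'a set)}"
    by (auto simp: Field_def)
  then have chains: "iterates_above {} \<in> Chains {(x, y). x \<subseteq> y}"
    by (rule chain_iterates_above)
  then have chain: "U \<subseteq> V \<or> V \<subseteq> U" if "U \<in> iterates_above {}" "V \<in> iterates_above {}" for U V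
    using that unfolding Chains_def by auto
  have Union: "\<Union>\<M> \<in> iterates_above {}" if "\<M> \<subseteq> iterates_above {}" for \<M>
  proof (cases "\<M> = {}")
    case False
    with that show ?thesis
      using in_Chains_subset[OF chains that] by (intro iterates_above.Sup) auto
  qed (use iterates_above.base in simp)
  have induct: "\<forall>U\<in>iterates_above {}. P U"
    if step: "\<forall>U. P U \<longrightarrow> P (f U)" and Union: "\<forall>\<M>. (\<forall>U\<in>\<M>. P U) \<longrightarrow> P (\<Union>\<M>)" for P
  proof
    show "P U" if "U \<in> iterates_above {}" for U
      using that
    proof (induction rule: iterates_above.induct)
      case base
      show ?case using Union[rule_format, of "{}"] by simp
    qed (use step Union in blast)+
  qed
  show ?thesis
    using iterates_above.step Union chain induct by (rule that)
qed

lemma countable_compact_removal_stages: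
  fixes X :: "'a::metric_space set"
  assumes "compact X" "countable X"
  obtains \<T> where "\<And>U V. U \<in> \<T> \<Longrightarrow> V \<in> \<T> \<Longrightarrow> U \<subseteq> V \<or> V \<subseteq> U" "\<And>\<M>. \<M> \<subseteq> \<T> \<Longrightarrow> \<Union>\<M> \<in> \<T>"
    "\<And>U. U \<in> \<T> \<Longrightarrow> compact (X - U)" "\<And>U. U \<in> \<T> \<Longrightarrow> \<not> X \<subseteq> U \<Longrightarrow> \<exists>p\<in>X - U. insert p U \<in> \<T>"
proof -
  have "\<forall>U. \<exists>p. compact (X - U) \<and> \<not> X \<subseteq> U \<longrightarrow> p isolated_in (X - U)"
    using countable_compact_isolated_point assms(2) by (metis Diff_eq_empty_iff countable_Diff)
  then obtain p where p: "\<And>U. compact (X - U) \<Longrightarrow> \<not> X \<subseteq> U \<Longrightarrow> p U isolated_in (X - U)"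
    by metis
  define f where "f U = (if X \<subseteq> U then U else insert (p U) U)" for U
  have "U \<subseteq> f U" for U
    by (auto simp: f_def)
  then obtain \<T> where step: "\<And>U. U \<in> \<T> \<Longrightarrow> f U \<in> \<T>" and Union: "\<And>\<M>. \<M> \<subseteq> \<T> \<Longrightarrow> \<Union>\<M> \<in> \<T>"
    and chain: "\<And>U V. U \<in> \<T> \<Longrightarrow> V \<in> \<T> \<Longrightarrow> U \<subseteq> V \<or> V \<subseteq> U"
    and induct: "\<And>P. \<forall>U. P U \<longrightarrow> P (f U) \<Longrightarrow> \<forall>\<M>. (\<forall>U\<in>\<M>. P U) \<longrightarrow> P (\<Union>\<M>) \<Longrightarrow> \<forall>U\<in>\<T>. P U"
    by (rule transfinite_iterates_of_increasing) (rule that)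
  have compact: "\<forall>U\<in>\<T>. compact (X - U)"
  proof (rule induct; intro allI impI)
    show "compact (X - f U)" if U: "compact (X - U)" for U
    proof (cases "X \<subseteq> U")
      case False
      then have "X - f U = X - U - {p U}"
        by (auto simp: f_def)
      then show ?thesis
        using compact_diff_isolated_point[OF U p[OF U False]] by simp
    qed (use U in \<open>simp add: f_def\<close>)
    show "compact (X - \<Union>\<M>)" if "\<forall>U\<in>\<M>. compact (X - U)" for \<M>
      using assms(1) that by (intro compact_diff_Union) auto
  qed
  have "\<exists>p\<in>X - U. insert p U \<in> \<T>" if "U \<in> \<T>" "\<not> X \<subseteq> U" for U
  proof
    show "p U \<in> X - U"
      using p[of U] compact that isolated_in_islimpt_iff[of "p U"] by simp
    show "insert (p U) U \<in> \<T>"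
      using step[OF that(1)] that(2) by (simp add: f_def)
  qed
  with chain Union bspec[OF compact] show ?thesis
    by (rule that)
qed

lemma union_closed_family_cut:
  fixes \<T> :: "'a set set"
  assumes Union: "\<And>\<M>. \<M> \<subseteq> \<T> \<Longrightarrow> \<Union>\<M> \<in> \<T>"
    and step: "\<And>U. U \<in> \<T> \<Longrightarrow> \<not> X \<subseteq> U \<Longrightarrow> \<exists>p\<in>X - U. insert p U \<in> \<T>" and x: "x \<in> X"
  shows "\<exists>W\<in>\<T>. x \<notin> W \<and> insert x W \<in> \<T>"
proof -
  define W where "W = \<Union>{U\<in>\<T>. x \<notin> U}"
  have W: "W \<in> \<T>" "x \<notin> W"
    unfolding W_def by (rule Union) auto
  then have "\<not> X \<subseteq> W"
    using x by auto
  then obtain p where p: "p \<notin> W" "insert p W \<in> \<T>"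
    using step[OF W(1)] by auto
  then have "x \<in> insert p W"
    unfolding W_def by blast
  with p W show ?thesis by auto
qed

lemma union_closed_chain_order:
  fixes \<T> :: "'a set set"
  assumes chain: "\<And>U V. U \<in> \<T> \<Longrightarrow> V \<in> \<T> \<Longrightarrow> U \<subseteq> V \<or> V \<subseteq> U"
    and Union: "\<And>\<M>. \<M> \<subseteq> \<T> \<Longrightarrow> \<Union>\<M> \<in> \<T>"
    and step: "\<And>U. U \<in> \<T> \<Longrightarrow> \<not> X \<subseteq> U \<Longrightarrow> \<exists>p\<in>X - U. insert p U \<in> \<T>"
  defines "R \<equiv> {(x, y). \<exists>U\<in>\<T>. x \<in> U \<and> y \<notin> U}"
  shows "strict_linear_order_on X R" "x \<in> X \<Longrightarrow> \<exists>U\<in>\<T>. {y\<in>X. (x, y) \<in> R} = X - U"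
proof -
  have cut: "\<exists>W\<in>\<T>. x \<notin> W \<and> insert x W \<in> \<T> \<and> (\<forall>y. (x, y) \<in> R \<longleftrightarrow> y \<notin> insert x W)"
    if x: "x \<in> X" for x
  proof -
    obtain W where W: "W \<in> \<T>" "x \<notin> W" "insert x W \<in> \<T>"
      using union_closed_family_cut[OF Union step x] by blast
    have "y \<notin> insert x W" if xy: "(x, y) \<in> R" for y
    proof -
      obtain U where U: "U \<in> \<T>" "x \<in> U" "y \<notin> U"
        using xy by (auto simp: R_def)
      then have "W \<subseteq> U"
        using chain[OF U(1) W(1)] W(2) by blast
      with U show ?thesis by auto
    qed
    moreover have "(x, y) \<in> R" if "y \<notin> insert x W" for y
      using W(3) that by (auto simp: R_def)
    ultimately show ?thesis
      using W by blast
  qed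
  have "(x, y) \<in> R \<or> (y, x) \<in> R" if y: "y \<in> X" "x \<noteq> y" for x y
  proof (rule disjCI)
    assume "(y, x) \<notin> R"
    then obtain W where "W \<in> \<T>" "y \<notin> W" "x \<in> W"
      using cut[OF y(1)] y(2) by blast
    then show "(x, y) \<in> R"
      by (auto simp: R_def)
  qed
  moreover have "trans R"
    unfolding R_def trans_def using chain by blast
  moreover have "irrefl R"
    by (auto simp: R_def irrefl_def)
  ultimately show "strict_linear_order_on X R"
    by (auto simp: strict_linear_order_on_def total_on_def)
  show "\<exists>U\<in>\<T>. {y\<in>X. (x, y) \<in> R} = X - U" if "x \<in> X"
    using cut[OF that] by blast
qed

text \<open>
  The order arises by removing isolated points one after the other, transfinitely often:
  \<open>(x, y) \<in> R\<close> means that \<open>x\<close> is removed before \<open>y\<close>.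
\<close>

lemma countable_compact_order:
  fixes X :: "'a::metric_space set"
  assumes "compact X" "countable X"
  obtains R where "strict_linear_order_on X R" "\<And>x. x \<in> X \<Longrightarrow> compact {y\<in>X. (x, y) \<in> R}"
proof -
  obtain \<T> where \<T>: "\<And>U V. U \<in> \<T> \<Longrightarrow> V \<in> \<T> \<Longrightarrow> U \<subseteq> V \<or> V \<subseteq> U" "\<And>\<M>. \<M> \<subseteq> \<T> \<Longrightarrow> \<Union>\<M> \<in> \<T>"
    "\<And>U. U \<in> \<T> \<Longrightarrow> \<not> X \<subseteq> U \<Longrightarrow> \<exists>p\<in>X - U. insert p U \<in> \<T>"
    and compact: "\<And>U. U \<in> \<T> \<Longrightarrow> compact (X - U)"
    by (rule countable_compact_removal_stages[OF assms]) (rule that)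
  let ?R = "{(x, y). \<exists>U\<in>\<T>. x \<in> U \<and> y \<notin> U}"
  show ?thesis
  proof (rule that)
    show "strict_linear_order_on X ?R"
      using \<T> by (rule union_closed_chain_order(1))
    show "compact {y\<in>X. (x, y) \<in> ?R}" if "x \<in> X" for x
    proof -
      have "\<exists>U\<in>\<T>. {y\<in>X. (x, y) \<in> ?R} = X - U"
        using \<T> that by (rule union_closed_chain_order(2))
      then show ?thesis
        using compact by (elim bexE) (simp only:)
    qed
  qed
qed

lemma compact_has_last_element:
  fixes X :: "'a::metric_space set"
  assumes R: "strict_linear_order_on X R" "\<And>x. x \<in> X \<Longrightarrow> closed {y\<in>X. (x, y) \<in> R}"
    and S: "compact S" "S \<noteq> {}" "S \<subseteq> X"
  shows "\<exists>x\<in>S. \<forall>y\<in>S. (x, y) \<notin> R"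
proof (rule ccontr)
  assume no_last: "\<not> ?thesis"
  let ?after = "\<lambda>x. {y\<in>X. (x, y) \<in> R}"
  have "S \<inter> (\<Inter>x\<in>S. ?after x) \<noteq> {}"
  proof (rule compact_imp_fip_image[OF S(1)])
    show "closed (?after x)" if "x \<in> S" for x
      using R(2) S(3) that by blast
    show "S \<inter> (\<Inter>x\<in>F. ?after x) \<noteq> {}" if "finite F" "F \<subseteq> S" for F
      using that
    proof (induction F)
      case (insert x F)
      then obtain z where z: "z \<in> S" "\<And>w. w \<in> F \<Longrightarrow> (w, z) \<in> R"
        by blast
      obtain x' where x': "x' \<in> S" "(x, x') \<in> R"
        using no_last insert.prems by blast
      have "(x', z) \<in> R \<or> x' = z \<or> (z, x') \<in> R"
        using R(1) S(3) x'(1) z(1) unfolding strict_linear_order_on_def total_on_def by blast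
      then have "\<exists>y\<in>{x', z}. \<forall>w\<in>insert x F. (w, y) \<in> R"
        using x'(2) z(2) R(1) unfolding strict_linear_order_on_def by (blast dest: transD)
      then show ?case
        using x'(1) z(1) S(3) by blast
    qed (use S(2) in simp)
  qed
  then show False
    using R(1) by (auto simp: strict_linear_order_on_def irrefl_def)
qed

lemma last_maximizer_with_gap:
  fixes X :: "'a::metric_space set" and \<mu> :: "'a \<Rightarrow> real"
  assumes X: "compact X" "X \<noteq> {}" and \<mu>: "continuous_on X \<mu>"
    and R: "strict_linear_order_on X R" "\<And>x. x \<in> X \<Longrightarrow> compact {y\<in>X. (x, y) \<in> R}"
  obtains x \<delta> where "x \<in> X" "\<delta> > 0" "\<And>y. y \<in> X \<Longrightarrow> \<mu> y \<le> \<mu> x"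
    "\<And>y. y \<in> X \<Longrightarrow> (x, y) \<in> R \<Longrightarrow> \<mu> y \<le> \<mu> x - \<delta>"
proof -
  obtain z where z: "z \<in> X" "\<And>y. y \<in> X \<Longrightarrow> \<mu> y \<le> \<mu> z"
    using continuous_attains_sup[OF X \<mu>] by blast
  define S where "S = {y\<in>X. \<mu> y = \<mu> z}"
  have "S = X \<inter> \<mu> -` {\<mu> z}"
    by (auto simp: S_def)
  then have "compact S"
    using continuous_closedin_preimage[OF \<mu>, of "{\<mu> z}"] closedin_compact[OF X(1)] by auto
  then obtain x where x: "x \<in> S" "\<And>y. y \<in> S \<Longrightarrow> (x, y) \<notin> R"
    using compact_has_last_element[OF R(1) compact_imp_closed[OF R(2)], of S] z(1) by (auto simp: S_def)
  then have x_max: "x \<in> X" "\<mu> x = \<mu> z"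
    by (auto simp: S_def)
  show ?thesis
  proof (cases "{y\<in>X. (x, y) \<in> R} = {}")
    case True
    with x_max z show ?thesis
      by (intro that[of x 1]) auto
  next
    case False
    then obtain w where w: "w \<in> X" "(x, w) \<in> R" "\<And>y. y \<in> X \<Longrightarrow> (x, y) \<in> R \<Longrightarrow> \<mu> y \<le> \<mu> w"
      using continuous_attains_sup[OF R(2)[OF x_max(1)] False continuous_on_subset[OF \<mu>]] by auto
    then have "\<mu> w < \<mu> z"
      using x(2) z(2)[of w] by (force simp: S_def)
    with x_max z w show ?thesis
      by (intro that[of x "\<mu> z - \<mu> w"]) auto
  qed
qed


subsection \<open>Bandit runs on a sequence of payoff functions\<close>

lemma nn_integral_PiM_resample:
  assumes M: "\<And>i. i \<in> I \<Longrightarrow> prob_space (M i)" and t: "t \<in> I" and f: "f \<in> borel_measurable (PiM I M)"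
  shows "(\<integral>\<^sup>+\<kappa>. (\<integral>\<^sup>+z. f (\<kappa>(t := z)) \<partial>M t) \<partial>PiM I M) = (\<integral>\<^sup>+\<kappa>. f \<kappa> \<partial>PiM I M)"
proof -
  interpret prob_space "M t"
    using M t .
  interpret seq: prob_space "PiM I M"
    using M by (rule prob_space_PiM)
  interpret pair_sigma_finite "M t" "PiM I M" ..
  have upd: "(\<lambda>(z, \<kappa>). \<kappa>(t := z)) \<in> M t \<Otimes>\<^sub>M PiM I M \<rightarrow>\<^sub>M PiM I M"
    unfolding case_prod_beta'
    by (rule measurable_fun_upd[where J=I]) (use t in auto)
  have "(\<integral>\<^sup>+\<kappa>. f \<kappa> \<partial>PiM I M) = (\<integral>\<^sup>+\<kappa>. f \<kappa> \<partial>distr (M t \<Otimes>\<^sub>M PiM I M) (PiM I M) (\<lambda>(z, \<kappa>). \<kappa>(t := z)))"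
    using distr_pair_PiM_eq_PiM[of I M t] M t by (simp add: insert_absorb)
  also have "\<dots> = (\<integral>\<^sup>+p. f ((snd p)(t := fst p)) \<partial>(M t \<Otimes>\<^sub>M PiM I M))"
    using f by (subst nn_integral_distr[OF upd]) (simp_all add: case_prod_beta')
  also have "\<dots> = (\<integral>\<^sup>+\<kappa>. (\<integral>\<^sup>+z. f (\<kappa>(t := z)) \<partial>M t) \<partial>PiM I M)"
    using nn_integral_snd[of "\<lambda>(z, \<kappa>). f (\<kappa>(t := z))"] measurable_compose[OF upd f]
    by (simp add: case_prod_beta')
  finally show ?thesis by simp
qed

lemma distr_pair_PiM_resample:
  assumes Q: "sigma_finite_measure Q" and M: "\<And>i. i \<in> I \<Longrightarrow> prob_space (M i)" and t: "t \<in> I"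
  shows "distr ((Q \<Otimes>\<^sub>M PiM I M) \<Otimes>\<^sub>M M t) (Q \<Otimes>\<^sub>M PiM I M) (\<lambda>(p, z). (fst p, (snd p)(t := z))) =
      Q \<Otimes>\<^sub>M PiM I M"
    (is "distr (?L \<Otimes>\<^sub>M _) _ ?upd = _")
proof (rule measure_eqI)
  interpret Q: sigma_finite_measure Q
    by (rule Q)
  interpret M: prob_space "M t"
    using M t .
  interpret seq: prob_space "PiM I M"
    using M by (rule prob_space_PiM)
  have upd: "?upd \<in> ?L \<Otimes>\<^sub>M M t \<rightarrow>\<^sub>M ?L"
    unfolding case_prod_beta'
    by (intro measurable_Pair measurable_fun_upd[where J=I]) (use t in auto)
  fix A assume "A \<in> sets (distr (?L \<Otimes>\<^sub>M M t) ?L ?upd)"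
  then have A: "A \<in> sets ?L" by simp
  then have A_meas: "indicator A \<in> borel_measurable ?L" by simp
  then have A_upd: "(\<lambda>(p, z). indicator A (fst p, (snd p)(t := z)) :: ennreal) \<in>
      borel_measurable (?L \<Otimes>\<^sub>M M t)"
    using measurable_compose[OF upd] by (simp add: case_prod_beta')
  have "emeasure (distr (?L \<Otimes>\<^sub>M M t) ?L ?upd) A = (\<integral>\<^sup>+q. indicator A (?upd q) \<partial>(?L \<Otimes>\<^sub>M M t))"
    using A by (simp add: nn_integral_distr[OF upd] flip: nn_integral_indicator)
  also have "\<dots> = (\<integral>\<^sup>+p. (\<integral>\<^sup>+z. indicator A (fst p, (snd p)(t := z)) \<partial>M t) \<partial>?L)"
    using M.nn_integral_fst[OF A_upd] by (simp add: case_prod_beta')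
  also have "\<dots> = (\<integral>\<^sup>+\<omega>. (\<integral>\<^sup>+\<kappa>. (\<integral>\<^sup>+z. indicator A (\<omega>, \<kappa>(t := z)) \<partial>M t) \<partial>PiM I M) \<partial>Q)"
    using seq.nn_integral_fst[OF M.borel_measurable_nn_integral[OF A_upd]] by simp
  also have "\<dots> = (\<integral>\<^sup>+\<omega>. (\<integral>\<^sup>+\<kappa>. indicator A (\<omega>, \<kappa>) \<partial>PiM I M) \<partial>Q)"
  proof (rule nn_integral_cong)
    fix \<omega> assume "\<omega> \<in> space Q"
    then have "(\<lambda>\<kappa>. indicator A (\<omega>, \<kappa>) :: ennreal) \<in> borel_measurable (PiM I M)"
      using measurable_compose[OF measurable_Pair1' A_meas] by blast
    from nn_integral_PiM_resample[where M=M, OF M t this]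
    show "(\<integral>\<^sup>+\<kappa>. (\<integral>\<^sup>+z. indicator A (\<omega>, \<kappa>(t := z)) \<partial>M t) \<partial>PiM I M) =
        (\<integral>\<^sup>+\<kappa>. indicator A (\<omega>, \<kappa>) \<partial>PiM I M)"
      by simp
  qed
  also have "\<dots> = emeasure ?L A"
    using A seq.nn_integral_fst[OF A_meas] by simp
  finally show "emeasure (distr (?L \<Otimes>\<^sub>M M t) ?L ?upd) A = emeasure ?L A" .
qed simp

lemma bind_distr_eq_distr_pair:
  assumes M: "prob_space M" and N: "prob_space N" and g: "(\<lambda>(x, z). g x z) \<in> M \<Otimes>\<^sub>M N \<rightarrow>\<^sub>M L"
  shows "M \<bind> (\<lambda>x. distr N L (g x)) = distr (M \<Otimes>\<^sub>M N) L (\<lambda>(x, z). g x z)"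
proof (rule measure_eqI)
  interpret M: prob_space M by (rule M)
  interpret N: prob_space N by (rule N)
  have kernel: "(\<lambda>x. distr N L (g x)) \<in> M \<rightarrow>\<^sub>M subprob_algebra L"
    by (rule measurable_distr2[OF g measurable_const[OF N.M_in_subprob]])
  have sets: "sets (M \<bind> (\<lambda>x. distr N L (g x))) = sets L"
    using sets_bind[OF sets_kernel[OF kernel] M.not_empty] .
  then show "sets (M \<bind> (\<lambda>x. distr N L (g x))) = sets (distr (M \<Otimes>\<^sub>M N) L (\<lambda>(x, z). g x z))"
    by simp
  fix A assume "A \<in> sets (M \<bind> (\<lambda>x. distr N L (g x)))"
  then have A: "A \<in> sets L" by (simp only: sets)
  have "emeasure (M \<bind> (\<lambda>x. distr N L (g x))) A = (\<integral>\<^sup>+x. emeasure (distr N L (g x)) A \<partial>M)"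
    by (rule emeasure_bind[OF M.not_empty kernel A])
  also have "\<dots> = (\<integral>\<^sup>+x. emeasure N (Pair x -` ((\<lambda>(x, z). g x z) -` A \<inter> space (M \<Otimes>\<^sub>M N))) \<partial>M)"
  proof (rule nn_integral_cong)
    fix x assume x: "x \<in> space M"
    then have "g x \<in> N \<rightarrow>\<^sub>M L"
      using measurable_compose[OF measurable_Pair1' g] by simp
    then show "emeasure (distr N L (g x)) A =
        emeasure N (Pair x -` ((\<lambda>(x, z). g x z) -` A \<inter> space (M \<Otimes>\<^sub>M N)))"
      using x A by (auto simp: emeasure_distr space_pair_measure intro!: arg_cong[where f="emeasure N"])
  qed
  also have "\<dots> = emeasure (distr (M \<Otimes>\<^sub>M N) L (\<lambda>(x, z). g x z)) A"
    using measurable_sets[OF g A] A g by (simp add: emeasure_distr N.emeasure_pair_measure_alt)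
  finally show "emeasure (M \<bind> (\<lambda>x. distr N L (g x))) A =
      emeasure (distr (M \<Otimes>\<^sub>M N) L (\<lambda>(x, z). g x z)) A" .
qed

primrec mab_run :: "(nat \<Rightarrow> real \<Rightarrow> (nat \<Rightarrow> real) \<Rightarrow> 'a) \<Rightarrow> ('z \<Rightarrow> 'a \<Rightarrow> real) \<Rightarrow>
    real \<Rightarrow> (nat \<Rightarrow> 'z) \<Rightarrow> nat \<Rightarrow> nat \<Rightarrow> real" where
  "mab_run a F \<omega> \<kappa> 0 = (\<lambda>_. undefined)"
| "mab_run a F \<omega> \<kappa> (Suc t) =
     (mab_run a F \<omega> \<kappa> t)(t := F (\<kappa> t) (a t \<omega> (mab_run a F \<omega> \<kappa> t)))"

definition mab_pick :: "(nat \<Rightarrow> real \<Rightarrow> (nat \<Rightarrow> real) \<Rightarrow> 'a) \<Rightarrow> ('z \<Rightarrow> 'a \<Rightarrow> real) \<Rightarrow>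
    nat \<Rightarrow> real \<Rightarrow> (nat \<Rightarrow> 'z) \<Rightarrow> 'a" where
  "mab_pick a F t \<omega> \<kappa> = a t \<omega> (mab_run a F \<omega> \<kappa> t)"

lemma mab_run_Suc: "mab_run a F \<omega> \<kappa> (Suc t) = (mab_run a F \<omega> \<kappa> t)(t := F (\<kappa> t) (mab_pick a F t \<omega> \<kappa>))"
  by (simp add: mab_pick_def)

lemma mab_run_cong:
  "(\<And>s. s < t \<Longrightarrow> \<kappa> s = \<kappa>' s) \<Longrightarrow> mab_run a F \<omega> \<kappa> t = mab_run a F \<omega> \<kappa>' t"
  by (induction t) auto

lemma mab_pick_cong:
  "(\<And>s. s < t \<Longrightarrow> \<kappa> s = \<kappa>' s) \<Longrightarrow> mab_pick a F t \<omega> \<kappa> = mab_pick a F t \<omega> \<kappa>'"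
  unfolding mab_pick_def by (metis mab_run_cong)

lemma mab_run_nth:
  "s < t \<Longrightarrow> mab_run a F \<omega> \<kappa> t s = F (\<kappa> s) (mab_pick a F s \<omega> \<kappa>)"
  by (induction t) (auto simp: less_Suc_eq mab_pick_def)

lemma mab_run_undefined: "t \<le> s \<Longrightarrow> mab_run a F \<omega> \<kappa> t s = undefined"
  by (induction t) auto

lemma restrict_mab_run:
  assumes "s \<le> t" shows "restrict (mab_run a F \<omega> \<kappa> t) {..<s} = mab_run a F \<omega> \<kappa> s"
  using assms by (auto simp: fun_eq_iff restrict_def mab_run_nth mab_run_undefined)

text \<open>
  A bandit run is the deterministic evaluation of the algorithm on an i.i.d. sequence of random
  payoff functions whose one-point marginals are the reward distributions.
\<close>

locale mab_tape = N: prob_space N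
  for X :: "'a::metric_space set" and Q :: "real measure" and a and N :: "'z measure"
    and F :: "'z \<Rightarrow> 'a \<Rightarrow> real" +
  assumes algorithm: "mab_algorithm X Q a"
    and joint_measurable_payoff: "(\<lambda>(z, x). F z x) \<in> borel_measurable (N \<Otimes>\<^sub>M arms X)"
begin

abbreviation "tape \<equiv> Q \<Otimes>\<^sub>M (\<Pi>\<^sub>M t\<in>(UNIV :: nat set). N)"
abbreviation "history t \<equiv> Q \<Otimes>\<^sub>M (\<Pi>\<^sub>M s\<in>{..<t :: nat}. (borel :: real measure))"
abbreviation "run t p \<equiv> (fst p, mab_run a F (fst p) (snd p) t)"

sublocale Q: prob_space Q
  using algorithm by (simp add: mab_algorithm_def seed_law_def)

sublocale seq: prob_space "\<Pi>\<^sub>M t\<in>(UNIV :: nat set). N"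
  by (rule prob_space_PiM) (rule N.prob_space_axioms)

sublocale pair: pair_prob_space Q "\<Pi>\<^sub>M t\<in>(UNIV :: nat set). N" ..

lemma measurable_algorithm: "(\<lambda>(\<omega>, r). a t \<omega> r) \<in> history t \<rightarrow>\<^sub>M arms X"
  using algorithm by (simp add: mab_algorithm_def)

lemma measurable_run: "run t \<in> tape \<rightarrow>\<^sub>M history t"
proof (induction t)
  case (Suc t)
  have "(\<lambda>p. mab_pick a F t (fst p) (snd p)) \<in> tape \<rightarrow>\<^sub>M arms X"
    using measurable_compose[OF Suc measurable_algorithm] by (simp add: mab_pick_def)
  then have "(\<lambda>p. (snd p t, mab_pick a F t (fst p) (snd p))) \<in> tape \<rightarrow>\<^sub>M N \<Otimes>\<^sub>M arms X"
    by (intro measurable_Pair measurable_compose[OF measurable_snd measurable_component_singleton]) auto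
  from measurable_compose[OF this joint_measurable_payoff]
  have "(\<lambda>p. F (snd p t) (mab_pick a F t (fst p) (snd p))) \<in> borel_measurable tape"
    by simp
  moreover have "(\<lambda>p. mab_run a F (fst p) (snd p) t) \<in> tape \<rightarrow>\<^sub>M (\<Pi>\<^sub>M s\<in>{..<t}. borel)"
    using measurable_compose[OF Suc measurable_snd] by simp
  ultimately show ?case
    unfolding mab_run_Suc
    by (intro measurable_Pair measurable_fst measurable_fun_upd[where J="{..<t}"]) auto
qed (auto intro!: measurable_Pair measurable_PiM_single' simp: PiE_iff extensional_def)

lemma measurable_pick: "(\<lambda>p. mab_pick a F t (fst p) (snd p)) \<in> tape \<rightarrow>\<^sub>M arms X"
  using measurable_compose[OF measurable_run measurable_algorithm] by (simp add: mab_pick_def)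

lemma measurable_reward_kernel:
  assumes "\<nu> \<in> arms X \<rightarrow>\<^sub>M prob_algebra borel"
  shows "(\<lambda>(\<omega>, r). distr (\<nu> (a t \<omega> r)) (history (Suc t)) (\<lambda>y. (\<omega>, r(t := y))))
    \<in> history t \<rightarrow>\<^sub>M subprob_algebra (history (Suc t))"
  unfolding case_prod_beta'
proof (rule measurable_distr2)
  show "(\<lambda>p. \<nu> (a t (fst p) (snd p))) \<in> history t \<rightarrow>\<^sub>M subprob_algebra borel"
    using measurable_compose[OF measurable_algorithm measurable_prob_algebraD[OF assms]]
    by (simp add: case_prod_beta')
  show "(\<lambda>(p, y). (fst p, (snd p)(t := y))) \<in> history t \<Otimes>\<^sub>M borel \<rightarrow>\<^sub>M history (Suc t)"
    unfolding case_prod_beta'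
    by (intro measurable_Pair measurable_fun_upd[where J="{..<t}"] measurable_compose[OF measurable_fst]
        measurable_fst measurable_snd) auto
qed

lemma reward_kernel_eq:
  assumes \<nu>: "\<And>x. x \<in> X \<Longrightarrow> \<nu> x = distr N borel (\<lambda>z. F z x)" and p: "p \<in> space tape"
  shows "distr (\<nu> (mab_pick a F t (fst p) (snd p))) (history (Suc t))
      (\<lambda>y. (fst p, (mab_run a F (fst p) (snd p) t)(t := y))) =
    distr N (history (Suc t)) (\<lambda>z. run (Suc t) (fst p, (snd p)(t := z)))"
proof -
  let ?x = "mab_pick a F t (fst p) (snd p)" and ?r = "mab_run a F (fst p) (snd p) t"
  have x: "?x \<in> space (arms X)"
    using measurable_space[OF measurable_pick p] .
  then have payoff: "(\<lambda>z. F z ?x) \<in> borel_measurable N"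
    using measurable_compose[OF measurable_Pair2' joint_measurable_payoff] by simp
  have upd: "(\<lambda>y. (fst p, ?r(t := y))) \<in> borel \<rightarrow>\<^sub>M history (Suc t)"
    using measurable_space[OF measurable_run p, of t]
    by (intro measurable_Pair measurable_fun_upd[where J="{..<t}"] measurable_const)
      (auto simp: space_pair_measure)
  have "mab_run a F (fst p) ((snd p)(t := z)) t = ?r"
    "mab_pick a F t (fst p) ((snd p)(t := z)) = ?x" for z
    by (auto intro: mab_run_cong mab_pick_cong)
  with x show ?thesis
    by (simp add: \<nu> space_restrict_space distr_distr[OF upd payoff] comp_def
        mab_run_Suc del: mab_run.simps)
qed

lemma mab_law_eq:
  assumes \<nu>: "\<nu> \<in> arms X \<rightarrow>\<^sub>M prob_algebra borel" "\<And>x. x \<in> X \<Longrightarrow> \<nu> x = distr N borel (\<lambda>z. F z x)"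
  shows "mab_law Q a \<nu> t = distr tape (history t) (run t)"
proof (induction t)
  case 0
  have "distr tape (history 0) (run 0) = distr (distr tape Q fst) (history 0) (\<lambda>\<omega>. (\<omega>, \<lambda>_. undefined))"
    by (subst distr_distr)
      (auto simp: comp_def space_PiM intro!: measurable_Pair measurable_const measurable_ident_sets)
  then show ?case
    by (simp add: seq.distr_pair_fst)
next
  case (Suc t)
  let ?k = "\<lambda>(\<omega>, r). distr (\<nu> (a t \<omega> r)) (history (Suc t)) (\<lambda>y. (\<omega>, r(t := y)))"
  let ?upd = "\<lambda>(p, z). (fst p, (snd p)(t := z))"
  have upd: "?upd \<in> tape \<Otimes>\<^sub>M N \<rightarrow>\<^sub>M tape"
    unfolding case_prod_beta'
    by (intro measurable_Pair measurable_fun_upd[where J=UNIV] measurable_compose[OF measurable_fst]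
        measurable_fst measurable_snd) auto
  have "mab_law Q a \<nu> (Suc t) = distr tape (history t) (run t) \<bind> ?k"
    by (simp add: Suc)
  also have "\<dots> = tape \<bind> (\<lambda>p. ?k (run t p))"
    by (rule bind_distr[OF measurable_run measurable_reward_kernel[OF \<nu>(1)] pair.not_empty])
  also have "\<dots> = tape \<bind> (\<lambda>p. distr N (history (Suc t)) (\<lambda>z. run (Suc t) (?upd (p, z))))"
    using reward_kernel_eq[OF \<nu>(2)] by (intro bind_cong refl) (simp add: mab_pick_def)
  also have "\<dots> = distr (tape \<Otimes>\<^sub>M N) (history (Suc t)) (\<lambda>(p, z). run (Suc t) (?upd (p, z)))"
    using measurable_compose[OF upd measurable_run]
    by (intro bind_distr_eq_distr_pair pair.prob_space_axioms N.prob_space_axioms)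
      (simp add: case_prod_beta' del: mab_run.simps)
  also have "\<dots> = distr (distr (tape \<Otimes>\<^sub>M N) tape ?upd) (history (Suc t)) (run (Suc t))"
    by (subst distr_distr[OF measurable_run upd]) (simp add: comp_def case_prod_beta')
  also have "distr (tape \<Otimes>\<^sub>M N) tape ?upd = tape"
    by (rule distr_pair_PiM_resample) (auto intro: Q.sigma_finite_measure_axioms N.prob_space_axioms)
  finally show ?case .
qed

lemma mab_regret_eq:
  assumes inst: "mab_instance X \<mu> \<nu>" and \<nu>: "\<And>x. x \<in> X \<Longrightarrow> \<nu> x = distr N borel (\<lambda>z. F z x)"
  shows "mab_regret X Q a \<mu> \<nu> t = real t * (SUP x\<in>X. \<mu> x) -
    (\<integral>p. (\<Sum>s<t. \<mu> (mab_pick a F s (fst p) (snd p))) \<partial>tape)"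
proof -
  have kernel: "\<nu> \<in> arms X \<rightarrow>\<^sub>M prob_algebra borel" and "continuous_on X \<mu>"
    using inst lipschitz_on_continuous_on by (auto simp: mab_instance_def)
  then have \<mu>: "\<mu> \<in> borel_measurable (arms X)"
    by (intro borel_measurable_continuous_on_restrict)
  have "(\<lambda>q. \<mu> (a s (fst q) (restrict (snd q) {..<s}))) \<in> borel_measurable (history t)" if "s < t" for s
  proof -
    have "(\<lambda>q. (fst q, restrict (snd q) {..<s})) \<in> history t \<rightarrow>\<^sub>M history s"
      using that by (intro measurable_Pair measurable_fst measurable_compose[OF measurable_snd]
          measurable_restrict_subset) auto
    from measurable_compose[OF measurable_compose[OF this measurable_algorithm] \<mu>] show ?thesis
      by simp
  qed
  then have "(\<lambda>q. \<Sum>s<t. \<mu> (a s (fst q) (restrict (snd q) {..<s}))) \<in> borel_measurable (history t)"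
    by (intro borel_measurable_sum) auto
  from integral_distr[OF measurable_run this]
  have "(\<integral>q. (\<Sum>s<t. \<mu> (a s (fst q) (restrict (snd q) {..<s}))) \<partial>mab_law Q a \<nu> t) =
      (\<integral>p. (\<Sum>s<t. \<mu> (mab_pick a F s (fst p) (snd p))) \<partial>tape)"
    by (simp add: mab_law_eq[OF kernel \<nu>] restrict_mab_run mab_pick_def)
  then show ?thesis
    by (simp add: mab_regret_def case_prod_beta')
qed

end


subsection \<open>Identifying the last maximizer\<close>

lemma (in prob_space) indep_vars_PiM_coordinates:
  assumes "inj_on \<tau> I"
  shows "prob_space.indep_vars (\<Pi>\<^sub>M t\<in>UNIV. M) (\<lambda>_. M) (\<lambda>i \<kappa>. \<kappa> (\<tau> i)) I"
proof -
  interpret seq: prob_space "\<Pi>\<^sub>M t\<in>UNIV. M"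
    by (rule prob_space_PiM) (rule prob_space_axioms)
  show ?thesis
  proof (cases "I = {}")
    case True
    then show ?thesis by (simp add: seq.indep_vars_def seq.indep_sets_def)
  next
    case False
    have "distr (\<Pi>\<^sub>M t\<in>UNIV. M) (\<Pi>\<^sub>M i\<in>I. M) (\<lambda>\<kappa>. \<lambda>i\<in>I. \<kappa> (\<tau> i)) = (\<Pi>\<^sub>M i\<in>I. M)"
      using distr_PiM_reindex[of UNIV "\<lambda>_. M" \<tau> I] assms prob_space_axioms by simp
    moreover have "distr (\<Pi>\<^sub>M t\<in>UNIV. M) M (\<lambda>\<kappa>. \<kappa> (\<tau> i)) = M" for i
      using distr_PiM_component[of UNIV "\<lambda>_. M" "\<tau> i"] prob_space_axioms by simp
    ultimately show ?thesis
      by (subst seq.indep_vars_iff_distr_eq_PiM'[OF False]) simp_all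
  qed
qed

lemma (in prob_space) sample_mean_deviation:
  fixes Y :: "'a \<Rightarrow> real" and \<tau> :: "nat \<Rightarrow> 't"
  assumes Y: "Y \<in> borel_measurable M" "AE z in M. Y z \<in> {0..1}"
    and \<tau>: "inj_on \<tau> {..<n}" and "n > 0" "c \<ge> 0"
  shows "measure (\<Pi>\<^sub>M t\<in>UNIV. M) {\<kappa>\<in>space (\<Pi>\<^sub>M t\<in>UNIV. M).
      c \<le> \<bar>(\<Sum>l<n. Y (\<kappa> (\<tau> l))) / real n - expectation Y\<bar>} \<le> 2 * exp (- 2 * real n * c\<^sup>2)"
proof -
  let ?S = "\<Pi>\<^sub>M t\<in>(UNIV :: 't set). M"
  interpret seq: prob_space ?S
    by (rule prob_space_PiM) (rule prob_space_axioms)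
  have component: "(\<lambda>\<kappa>. \<kappa> i) \<in> ?S \<rightarrow>\<^sub>M M" "distr ?S M (\<lambda>\<kappa>. \<kappa> i) = M" for i
    using distr_PiM_component[of UNIV "\<lambda>_. M" i] prob_space_axioms by simp_all
  have Y_distr: "distr ?S borel (\<lambda>\<kappa>. Y (\<kappa> i)) = distr M borel Y" for i
    using distr_distr[OF Y(1) component(1), of i] by (simp add: component(2) comp_def)
  have Y_component: "(\<lambda>\<kappa>. Y (\<kappa> i)) \<in> borel_measurable ?S" for i
    using measurable_compose[OF component(1) Y(1)] .
  interpret H: Hoeffding_ineq_iid ?S "{..<n}" "\<lambda>l \<kappa>. Y (\<kappa> (\<tau> l))"
    "\<lambda>\<kappa>. Y (\<kappa> (\<tau> 0))" 0 1 "seq.expectation (\<lambda>\<kappa>. Y (\<kappa> (\<tau> 0)))"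
  proof unfold_locales
    show "seq.indep_vars (\<lambda>_. borel) (\<lambda>l \<kappa>. Y (\<kappa> (\<tau> l))) {..<n}"
      using seq.indep_vars_compose2[OF indep_vars_PiM_coordinates[OF \<tau>], of "\<lambda>_. Y"] Y(1) by simp
    show "AE \<kappa> in ?S. Y (\<kappa> (\<tau> 0)) \<in> {0..1}"
      using AE_PiM_component[of UNIV "\<lambda>_. M" "\<tau> 0", OF _ _ Y(2)] prob_space_axioms by simp
  qed (simp_all add: Y_distr Y_component)
  have "seq.expectation (\<lambda>\<kappa>. Y (\<kappa> (\<tau> 0))) = expectation Y"
    using integral_distr[OF component(1) Y(1), of "\<tau> 0"] by (simp add: component(2))
  moreover have "{..<n} \<noteq> {}"
    using \<open>n > 0\<close> by auto
  ultimately show ?thesis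
    using H.Hoeffding_ineq_abs_ge'[OF \<open>c \<ge> 0\<close>] by simp
qed

lemma (in prob_space) mean_loss_le_prob:
  fixes u :: "'a \<Rightarrow> real"
  assumes u: "u \<in> borel_measurable M" "\<And>w. w \<in> space M \<Longrightarrow> u w \<in> {0..1}"
    and "v \<le> 1" and S: "S \<in> events" "\<And>w. w \<in> space M \<Longrightarrow> w \<notin> S \<Longrightarrow> u w = v"
  shows "v - expectation u \<le> prob S"
proof -
  have int: "integrable M u"
    by (rule integrable_const_bound[where B=1]) (use u in auto)
  have "expectation (\<lambda>w. v - u w) \<le> expectation (indicator S)"
  proof (rule integral_mono)
    show "integrable M (\<lambda>w. v - u w)"
      using int by simp
    show "integrable M (indicat_real S)"
      using S(1) by (simp add: integrable_indicator_iff less_top[symmetric])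
    fix w assume w: "w \<in> space M"
    then show "v - u w \<le> indicat_real S w"
      using u(2)[OF w] S(2)[OF w] \<open>v \<le> 1\<close> by (cases "w \<in> S") auto
  qed
  then show ?thesis
    using int S(1) by (simp add: prob_space)
qed

locale ordered_arms =
  fixes X :: "'a::metric_space set" and R :: "'a rel" and e :: "nat \<Rightarrow> 'a"
  assumes compact_arms: "compact X" and linear_order: "strict_linear_order_on X R"
    and compact_upper: "\<And>x. x \<in> X \<Longrightarrow> compact {y\<in>X. (x, y) \<in> R}" and range_e: "range e = X"
begin

lemma e_in_X: "e i \<in> X"
  using range_e by blast

lemma countable_arms: "countable X"
  unfolding range_e[symmetric] by simp

lemma nonempty_arms: "X \<noteq> {}"
  using e_in_X by blast

lemma measurable_e: "e \<in> count_space UNIV \<rightarrow>\<^sub>M arms X"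
  using e_in_X by (simp add: space_restrict_space)

definition contenders :: "nat \<Rightarrow> real \<Rightarrow> (nat \<Rightarrow> real) \<Rightarrow> nat set" where
  "contenders m c est = {i. i < m \<and> (\<forall>j\<in>{..<m}. est j \<le> est i + 2 * c)}"

text \<open>
  Picking the last contender is what makes the choice exactly optimal: the arms after the last
  maximizer have a positive gap, whereas the arms before it may have arbitrarily small gaps.
\<close>

definition last_contender :: "nat \<Rightarrow> real \<Rightarrow> (nat \<Rightarrow> real) \<Rightarrow> nat" where
  "last_contender m c est =
    (LEAST i. i \<in> contenders m c est \<and> (\<forall>j\<in>contenders m c est. (e i, e j) \<notin> R))"

definition commit :: "nat \<Rightarrow> nat \<Rightarrow> real \<Rightarrow> (nat \<Rightarrow> nat \<Rightarrow> real) \<Rightarrow> 'a" where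
  "commit m n c sample = e (last_contender m c (\<lambda>i. (\<Sum>l<n. sample i l) / real n))"

lemma commit_in_X: "commit m n c sample \<in> X"
  unfolding commit_def by (rule e_in_X)

lemma commit_cong:
  assumes "\<And>i l. i < m \<Longrightarrow> l < n \<Longrightarrow> sample i l = sample' i l"
  shows "commit m n c sample = commit m n c sample'"
proof -
  have "contenders m c (\<lambda>i. (\<Sum>l<n. sample i l) / real n) =
      contenders m c (\<lambda>i. (\<Sum>l<n. sample' i l) / real n)"
    using assms by (auto simp: contenders_def)
  then show ?thesis
    by (simp add: commit_def last_contender_def)
qed

lemma measurable_commit:
  assumes "\<And>i l. i < m \<Longrightarrow> l < n \<Longrightarrow> sample i l \<in> borel_measurable M"
  shows "(\<lambda>z. commit m n c (\<lambda>i l. sample i l z)) \<in> M \<rightarrow>\<^sub>M arms X"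
proof -
  let ?est = "\<lambda>z i. (\<Sum>l<n. sample i l z) / real n"
  have est: "(\<lambda>z. ?est z i) \<in> borel_measurable M" if "i < m" for i
    using assms[OF that] by (intro borel_measurable_divide borel_measurable_sum) auto
  have contender: "Measurable.pred M (\<lambda>z. i \<in> contenders m c (?est z))" for i
  proof (cases "i < m")
    case True
    then have "Measurable.pred M (\<lambda>z. ?est z j \<le> ?est z i + 2 * c)" if "j < m" for j
      unfolding Measurable.pred_def using that
      by (intro borel_measurable_le borel_measurable_add est borel_measurable_const)
    with True show ?thesis
      unfolding contenders_def by (auto intro!: pred_intros_finite)
  qed (simp add: contenders_def)
  have "(\<lambda>z. last_contender m c (?est z)) \<in> M \<rightarrow>\<^sub>M count_space UNIV"
    unfolding last_contender_def Ball_def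
    by (intro measurable_Least pred_intros_logic pred_intros_countable contender) simp
  then show ?thesis
    unfolding commit_def by (rule measurable_compose[OF _ measurable_e])
qed

lemma last_contender_eq_maximizer:
  assumes p: "p < m" "e p = x" and est: "\<And>i. i < m \<Longrightarrow> \<bar>est i - \<mu> (e i)\<bar> < c"
    and max: "\<And>y. y \<in> X \<Longrightarrow> \<mu> y \<le> \<mu> x" and gap: "\<And>y. y \<in> X \<Longrightarrow> (x, y) \<in> R \<Longrightarrow> \<mu> y \<le> \<mu> x - 4 * c"
  shows "e (last_contender m c est) = x"
proof -
  let ?K = "contenders m c est"
  have "est j \<le> est p + 2 * c" if "j < m" for j
    using est[OF that] max[OF e_in_X[of j]] est[OF p(1)] p(2) by simp
  then have p_contends: "p \<in> ?K"
    using p(1) by (simp add: contenders_def)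
  have later: "(x, e j) \<notin> R" if "j \<in> ?K" for j
  proof
    assume "(x, e j) \<in> R"
    moreover have "j < m" "est p \<le> est j + 2 * c"
      using that p(1) by (auto simp: contenders_def)
    ultimately show False
      using gap[OF e_in_X[of j]] est[of j] est[OF p(1)] p(2) by simp
  qed
  define i where "i = last_contender m c est"
  have "p \<in> ?K \<and> (\<forall>j\<in>?K. (e p, e j) \<notin> R)"
    using p_contends later p(2) by simp
  then have i: "i \<in> ?K" "\<forall>j\<in>?K. (e i, e j) \<notin> R"
    unfolding i_def last_contender_def by (rule LeastI2; blast)+
  have "x \<in> X"
    using e_in_X p(2) by blast
  moreover have "(e i, x) \<notin> R" "(x, e i) \<notin> R"
    using i later p_contends p(2) by auto
  ultimately show ?thesis
    using linear_order e_in_X[of i] unfolding i_def strict_linear_order_on_def total_on_def by blast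
qed

end

locale stochastic_payoffs = ordered_arms X R e + N: prob_space N
  for X :: "'a::metric_space set" and R e and N :: "('a \<Rightarrow> real) measure" +
  fixes \<mu> :: "'a \<Rightarrow> real"
  assumes measurable_payoff: "\<And>x. x \<in> X \<Longrightarrow> (\<lambda>z. z x) \<in> borel_measurable N"
    and payoff_01: "\<And>x. x \<in> X \<Longrightarrow> AE z in N. z x \<in> {0..1}"
    and mean_payoff: "\<And>x. x \<in> X \<Longrightarrow> N.expectation (\<lambda>z. z x) = \<mu> x"
    and continuous_mean: "continuous_on X \<mu>"
begin

abbreviation "payoffs \<equiv> \<Pi>\<^sub>M t\<in>(UNIV :: nat set). N"

abbreviation "samples \<tau> \<kappa> \<equiv> \<lambda>i l. \<kappa> (\<tau> i l) (e i)"

sublocale seq: prob_space payoffs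
  by (rule prob_space_PiM) (rule N.prob_space_axioms)

lemma mean_01: "x \<in> X \<Longrightarrow> \<mu> x \<in> {0..1}"
proof -
  assume x: "x \<in> X"
  have "integrable N (\<lambda>z. z x)"
    using payoff_01[OF x] measurable_payoff[OF x] by (intro N.integrable_const_bound[where B=1]) auto
  then have "0 \<le> N.expectation (\<lambda>z. z x)" "N.expectation (\<lambda>z. z x) \<le> 1"
    using payoff_01[OF x] by (auto intro!: integral_nonneg_AE N.integral_le_const)
  then show "\<mu> x \<in> {0..1}"
    by (simp add: mean_payoff[OF x])
qed

lemma measurable_mean: "\<mu> \<in> borel_measurable (arms X)"
  using continuous_mean by (rule borel_measurable_continuous_on_restrict)

lemma measurable_sample: "(\<lambda>\<kappa>. samples \<tau> \<kappa> i l) \<in> borel_measurable payoffs"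
  using measurable_compose[OF measurable_component_singleton[of "\<tau> i l" UNIV "\<lambda>_. N"]
      measurable_payoff[OF e_in_X]]
  by simp

lemma measurable_commit_samples: "(\<lambda>\<kappa>. commit m n c (samples \<tau> \<kappa>)) \<in> payoffs \<rightarrow>\<^sub>M arms X"
  by (intro measurable_commit measurable_sample)

lemma commit_error_event: "{\<kappa>\<in>space payoffs. commit m n c (samples \<tau> \<kappa>) \<noteq> x} \<in> seq.events"
proof -
  have "{\<kappa>\<in>space payoffs. commit m n c (samples \<tau> \<kappa>) \<noteq> x} =
      (\<lambda>\<kappa>. commit m n c (samples \<tau> \<kappa>)) -` (X - {x}) \<inter> space payoffs"
    using commit_in_X by auto
  moreover have "X - {x} \<in> sets (arms X)"
    using sets_arms_countable[OF countable_arms] by simp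
  ultimately show ?thesis
    using measurable_sets[OF measurable_commit_samples] by simp
qed

lemma commit_error:
  assumes p: "p < m" "e p = x" and max: "\<And>y. y \<in> X \<Longrightarrow> \<mu> y \<le> \<mu> x"
    and gap: "\<And>y. y \<in> X \<Longrightarrow> (x, y) \<in> R \<Longrightarrow> \<mu> y \<le> \<mu> x - 4 * c"
    and nc: "n > 0" "c \<ge> 0" and \<tau>: "\<And>i. inj_on (\<tau> i) {..<n}"
  shows "seq.prob {\<kappa>\<in>space payoffs. commit m n c (samples \<tau> \<kappa>) \<noteq> x} \<le>
      2 * real m * exp (- 2 * real n * c\<^sup>2)"
proof -
  define deviation where "deviation i \<kappa> = \<bar>(\<Sum>l<n. samples \<tau> \<kappa> i l) / real n - \<mu> (e i)\<bar>" for i \<kappa>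
  have deviation_meas: "deviation i \<in> borel_measurable payoffs" for i
    unfolding deviation_def
    by (intro borel_measurable_abs borel_measurable_diff borel_measurable_divide borel_measurable_sum
        measurable_sample borel_measurable_const)
  define bad where "bad i = {\<kappa>\<in>space payoffs. c \<le> deviation i \<kappa>}" for i
  have bad[measurable]: "bad i \<in> seq.events" for i
    unfolding bad_def using deviation_meas by measurable
  have "{\<kappa>\<in>space payoffs. commit m n c (samples \<tau> \<kappa>) \<noteq> x} \<subseteq> (\<Union>i\<in>{..<m}. bad i)"
  proof
    fix \<kappa> assume \<kappa>: "\<kappa> \<in> {\<kappa>\<in>space payoffs. commit m n c (samples \<tau> \<kappa>) \<noteq> x}"
    show "\<kappa> \<in> (\<Union>i\<in>{..<m}. bad i)"
    proof (rule ccontr)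
      assume "\<kappa> \<notin> (\<Union>i\<in>{..<m}. bad i)"
      then have "deviation i \<kappa> < c" if "i < m" for i
        using \<kappa> that by (auto simp: bad_def not_le)
      then have "commit m n c (samples \<tau> \<kappa>) = x"
        unfolding commit_def deviation_def
        by (intro last_contender_eq_maximizer[where \<mu>=\<mu>, OF p _ max gap]) auto
      with \<kappa> show False by simp
    qed
  qed
  then have "seq.prob {\<kappa>\<in>space payoffs. commit m n c (samples \<tau> \<kappa>) \<noteq> x} \<le> seq.prob (\<Union>i\<in>{..<m}. bad i)"
    by (intro seq.finite_measure_mono) auto
  also have "\<dots> \<le> (\<Sum>i<m. seq.prob (bad i))"
    by (intro seq.finite_measure_subadditive_finite) auto
  also have "\<dots> \<le> (\<Sum>i<m. 2 * exp (- 2 * real n * c\<^sup>2))"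
    unfolding bad_def deviation_def mean_payoff[OF e_in_X, symmetric]
    by (intro sum_mono N.sample_mean_deviation measurable_payoff payoff_01 e_in_X \<tau> nc)
  finally show ?thesis
    by (simp add: mult_ac)
qed

lemma commit_loss:
  "\<exists>x\<in>X. (\<forall>y\<in>X. \<mu> y \<le> \<mu> x) \<and> (\<exists>m\<^sub>0. \<exists>c\<^sub>0>0. \<forall>m\<ge>m\<^sub>0. \<forall>n>0. \<forall>c\<in>{0..c\<^sub>0}. \<forall>\<tau>. (\<forall>i. inj_on (\<tau> i) {..<n}) \<longrightarrow>
    \<mu> x - seq.expectation (\<lambda>\<kappa>. \<mu> (commit m n c (samples \<tau> \<kappa>))) \<le> 2 * real m * exp (- 2 * real n * c\<^sup>2))"
proof -
  obtain x \<delta> where x: "x \<in> X" "\<delta> > 0" "\<And>y. y \<in> X \<Longrightarrow> \<mu> y \<le> \<mu> x"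
    and gap: "\<And>y. y \<in> X \<Longrightarrow> (x, y) \<in> R \<Longrightarrow> \<mu> y \<le> \<mu> x - \<delta>"
    by (rule last_maximizer_with_gap[OF compact_arms nonempty_arms continuous_mean
        linear_order compact_upper])
      (assumption, rule that)
  obtain p where p: "e p = x"
    using x(1) range_e by blast
  have "\<mu> x - seq.expectation (\<lambda>\<kappa>. \<mu> (commit m n c (samples \<tau> \<kappa>))) \<le>
      2 * real m * exp (- 2 * real n * c\<^sup>2)"
    if "Suc p \<le> m" "n > 0" "c \<in> {0..\<delta> / 4}" "\<forall>i. inj_on (\<tau> i) {..<n}" for m n c \<tau>
  proof -
    let ?E = "{\<kappa>\<in>space payoffs. commit m n c (samples \<tau> \<kappa>) \<noteq> x}"
    have "\<mu> x - seq.expectation (\<lambda>\<kappa>. \<mu> (commit m n c (samples \<tau> \<kappa>))) \<le> seq.prob ?E"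
      using mean_01[OF x(1)] mean_01[OF commit_in_X]
      by (intro seq.mean_loss_le_prob measurable_compose[OF measurable_commit_samples measurable_mean]
          commit_error_event) auto
    also have "\<dots> \<le> 2 * real m * exp (- 2 * real n * c\<^sup>2)"
      using that p x(3) gap by (intro commit_error[where p=p]) force+
    finally show ?thesis .
  qed
  moreover have "\<delta> / 4 > 0"
    using x(2) by simp
  ultimately show ?thesis
    using x(1,3) by blast
qed

end


subsection \<open>Countable spaces: experts with double feedback\<close>

lemma regret_eq_sum_losses:
  fixes \<mu> :: "'a \<Rightarrow> real"
  assumes x: "x \<in> X" "\<And>y. y \<in> X \<Longrightarrow> \<mu> y \<le> \<mu> x" and int: "\<And>s. integrable M (\<lambda>p. \<mu> (pick s p))"
  shows "real t * (SUP x\<in>X. \<mu> x) - (\<integral>p. (\<Sum>s<t. \<mu> (pick s p)) \<partial>M) = (\<Sum>s<t. \<mu> x - (\<integral>p. \<mu> (pick s p) \<partial>M))"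
proof -
  have "(SUP x\<in>X. \<mu> x) = \<mu> x"
    using x by (intro cSup_eq_maximum) auto
  then show ?thesis
    using int by (simp add: sum_subtractf)
qed

lemma sum_le_initial_plus_suminf:
  fixes b err :: "nat \<Rightarrow> real"
  assumes "\<And>s. b s \<le> 1" "\<And>s. s \<ge> s\<^sub>0 \<Longrightarrow> b s \<le> err s" "summable err" "\<And>s. 0 \<le> err s"
  shows "(\<Sum>s<t. b s) \<le> real s\<^sub>0 + (\<Sum>s. err s)"
proof -
  have "(\<Sum>s<t. b s) \<le> (\<Sum>s<t. (if s < s\<^sub>0 then 1 else 0) + err s)"
    using assms by (intro sum_mono) (smt (verit, best) not_less)
  also have "\<dots> = real (card ({..<t} \<inter> {..<s\<^sub>0})) + (\<Sum>s<t. err s)"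
    by (simp add: sum.distrib sum.If_cases lessThan_def)
  also have "\<dots> \<le> real (card {..<s\<^sub>0}) + (\<Sum>s. err s)"
    using assms(3,4) by (intro add_mono sum_le_suminf of_nat_mono card_mono) auto
  finally show ?thesis by simp
qed

lemma summable_inverse_square: "summable (\<lambda>s. 1 / (real s)\<^sup>2)"
  using inverse_power_summable[of 2, where 'a=real] by (simp add: inverse_eq_divide)

lemma seed_law_return: "seed_law (return borel x)"
  by (simp add: seed_law_def prob_space_return)

lemma (in pair_prob_space) distr_pair_snd: "distr (M1 \<Otimes>\<^sub>M M2) M2 snd = M2"
  by (subst distr_pair_swap, subst distr_distr)
    (auto simp: comp_def case_prod_beta' M1.distr_pair_fst)

lemma (in pair_prob_space) integral_pair_snd:
  fixes g :: "'b \<Rightarrow> real"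
  assumes "g \<in> borel_measurable M2"
  shows "(\<integral>p. g (snd p) \<partial>(M1 \<Otimes>\<^sub>M M2)) = (\<integral>y. g y \<partial>M2)"
  using integral_distr[OF measurable_snd assms, of M1] by (simp add: distr_pair_snd)

lemma double_run_nth:
  assumes "s < t"
  shows "double_run a \<omega> \<phi> t s =
      (\<phi> s (fst (a s \<omega> (double_run a \<omega> \<phi> s))), \<phi> s (snd (a s \<omega> (double_run a \<omega> \<phi> s))))"
  using assms by (induction t) (auto simp: Let_def less_Suc_eq split: prod.split)

lemma prod_encode_less:
  assumes "i < m" "l < m"
  shows "prod_encode (i, l) < 2 * m\<^sup>2"
proof -
  obtain k where m: "m = Suc k"
    using assms(1) by (cases m) auto
  have "triangle (i + l) \<le> triangle (2 * k)"
    unfolding triangle_def using assms m by (intro div_le_mono mult_le_mono) auto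
  also have "\<dots> = k * Suc (2 * k)"
    by (simp add: triangle_def)
  finally have "prod_encode (i, l) \<le> k * Suc (2 * k) + k"
    using assms(1) m by (simp add: prod_encode_def)
  also have "\<dots> < 2 * m\<^sup>2"
    by (simp add: m power2_eq_square algebra_simps)
  finally show ?thesis .
qed

definition sample_size :: "nat \<Rightarrow> nat" where
  "sample_size t = nat \<lfloor>sqrt (real t / 2)\<rfloor>"

definition tolerance :: "nat \<Rightarrow> real" where
  "tolerance t = real (sample_size t) powr (- 1 / 4)"

lemma sample_size_square_le: "2 * (sample_size t)\<^sup>2 \<le> t"
proof -
  have "real (sample_size t) ^ 2 \<le> (sqrt (real t / 2))\<^sup>2"
    by (intro power_mono) (auto simp: sample_size_def)
  then have "real (2 * (sample_size t)\<^sup>2) \<le> real t"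
    by simp
  then show ?thesis by (simp only: of_nat_le_iff)
qed

lemma sample_index_less:
  "i < sample_size t \<Longrightarrow> l < sample_size t \<Longrightarrow> prod_encode (i, l) < t"
  using prod_encode_less sample_size_square_le order_less_le_trans by blast

lemma sample_size_tolerance:
  assumes "sample_size t > 0"
  shows "real (sample_size t) * (tolerance t)\<^sup>2 = sqrt (real (sample_size t))"
  using assms
  by (simp add: tolerance_def power2_eq_square flip: powr_add powr_half_sqrt) (simp add: powr_mult_base)

lemma summable_double_error:
  "summable (\<lambda>s. 2 * real (sample_size s) * exp (- 2 * sqrt (real (sample_size s))))"
  (is "summable ?err")
proof -
  have "?err \<in> O(\<lambda>s. 1 / real s ^ 2)"
    unfolding sample_size_def by real_asymp
  moreover have "summable (\<lambda>s. norm (1 / real s ^ 2))"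
    using summable_inverse_square by simp
  ultimately show ?thesis
    by (rule summable_comparison_test_bigo[rotated])
qed

lemma expert_instance_eval:
  assumes "expert_instance X P" "x \<in> X"
  shows "(\<lambda>f. f x) \<in> borel_measurable P" "\<And>f. f \<in> space P \<Longrightarrow> f x \<in> {0..1}"
proof -
  have sets: "sets P = sets (payoff_borel X)"
    using assms by (simp add: expert_instance_def)
  show "(\<lambda>f. f x) \<in> borel_measurable P"
    using measurable_payoff_eval[OF assms(2)] by (subst measurable_cong_sets[OF sets refl])
  show "f x \<in> {0..1}" if "f \<in> space P" for f
    using that assms(2) unfolding sets_eq_imp_space_eq[OF sets] space_payoff_borel by blast
qed

context ordered_arms
begin

text \<open>The extra point of round \<open>prod_encode (i, l)\<close> yields the sample number \<open>l\<close> of the arm \<open>e i\<close>.\<close>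

definition double_commit :: "'a double_rule" where
  "double_commit t \<omega> v =
    (commit (sample_size t) (sample_size t) (tolerance t) (\<lambda>i l. snd (v (prod_encode (i, l)))),
     e (fst (prod_decode t)))"

lemma double_commit_algorithm:
  assumes "seed_law Q"
  shows "double_algorithm X Q double_commit"
  unfolding double_algorithm_def
proof (intro conjI allI)
  fix t :: nat
  let ?M = "Q \<Otimes>\<^sub>M (\<Pi>\<^sub>M s\<in>{..<t}. (borel :: real measure) \<Otimes>\<^sub>M (borel :: real measure))"
  have "(\<lambda>p. snd (snd p (prod_encode (i, l)))) \<in> borel_measurable ?M"
    if "i < sample_size t" "l < sample_size t" for i l
  proof -
    have "(\<lambda>p. snd p (prod_encode (i, l))) \<in> ?M \<rightarrow>\<^sub>M borel \<Otimes>\<^sub>M borel"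
      using measurable_compose[OF measurable_snd measurable_component_singleton]
        sample_index_less[OF that]
      by simp
    then show ?thesis
      by (rule measurable_compose[OF _ measurable_snd])
  qed
  then show "(\<lambda>(\<omega>, v). double_commit t \<omega> v) \<in> ?M \<rightarrow>\<^sub>M arms X \<Otimes>\<^sub>M arms X"
    unfolding double_commit_def case_prod_beta'
    by (intro measurable_Pair measurable_commit measurable_const)
      (use e_in_X in \<open>simp_all add: space_restrict_space\<close>)
qed (rule assms)

definition double_choice :: "nat \<Rightarrow> (nat \<Rightarrow> 'a \<Rightarrow> real) \<Rightarrow> 'a" where
  "double_choice t \<phi> =
    commit (sample_size t) (sample_size t) (tolerance t) (\<lambda>i l. \<phi> (prod_encode (i, l)) (e i))"

lemma double_pick_double_commit: "double_pick double_commit t \<omega> \<phi> = double_choice t \<phi>"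
proof -
  have "snd (double_run double_commit \<omega> \<phi> t (prod_encode (i, l))) = \<phi> (prod_encode (i, l)) (e i)"
    if "i < sample_size t" "l < sample_size t" for i l
    using double_run_nth[OF sample_index_less[OF that], of double_commit \<omega> \<phi>]
    by (simp add: double_commit_def)
  then show ?thesis
    unfolding double_pick_def double_choice_def double_commit_def fst_conv
    by (intro commit_cong) (simp add: double_commit_def)
qed

lemma stochastic_payoffs_expert_instance:
  assumes "expert_instance X P"
  shows "stochastic_payoffs X R e P (expert_mean P)"
proof (intro stochastic_payoffs.intro stochastic_payoffs_axioms.intro ordered_arms_axioms)
  show "prob_space P"
    using assms by (simp add: expert_instance_def)
  show "AE f in P. f x \<in> {0..1}" if "x \<in> X" for x
    using expert_instance_eval(2)[OF assms that] by simp
  show "continuous_on X (expert_mean P)"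
    using assms lipschitz_on_continuous_on by (auto simp: expert_instance_def)
qed (auto simp: expert_mean_def expert_instance_eval[OF assms])

lemma expert_regret_double_commit:
  assumes Q: "seed_law Q" and P: "expert_instance X P"
    and x: "x \<in> X" "\<And>y. y \<in> X \<Longrightarrow> expert_mean P y \<le> expert_mean P x"
  shows "expert_regret X Q (double_pick double_commit) P t =
    (\<Sum>s<t. expert_mean P x - (\<integral>\<phi>. expert_mean P (double_choice s \<phi>) \<partial>(\<Pi>\<^sub>M t\<in>(UNIV :: nat set). P)))"
proof -
  interpret stochastic_payoffs X R e P "expert_mean P"
    using P by (rule stochastic_payoffs_expert_instance)
  interpret Q: prob_space Q
    using Q by (simp add: seed_law_def)
  interpret pair: pair_prob_space Q payoffs ..
  have choice: "(\<lambda>\<phi>. expert_mean P (double_choice s \<phi>)) \<in> borel_measurable payoffs" for s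
    unfolding double_choice_def
    using measurable_compose[OF measurable_commit_samples[of _ _ _ "\<lambda>i l. prod_encode (i, l)"]
        measurable_mean] .
  then have sum: "(\<lambda>\<phi>. \<Sum>s<t. expert_mean P (double_choice s \<phi>)) \<in> borel_measurable payoffs"
    by (intro borel_measurable_sum)
  have "(\<integral>(\<omega>, \<phi>). (\<Sum>s<t. expert_mean P (double_pick double_commit s \<omega> \<phi>)) \<partial>expert_space Q P) =
      (\<integral>p. (\<Sum>s<t. expert_mean P (double_choice s (snd p))) \<partial>(Q \<Otimes>\<^sub>M payoffs))"
    unfolding double_pick_double_commit expert_space_def case_prod_beta'
    by (rule integral_completion[OF measurable_compose[OF measurable_snd sum]])
  also have "\<dots> = (\<integral>\<phi>. (\<Sum>s<t. expert_mean P (double_choice s \<phi>)) \<partial>payoffs)"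
    by (rule pair.integral_pair_snd[OF sum])
  finally have "expert_regret X Q (double_pick double_commit) P t =
      real t * (SUP x\<in>X. expert_mean P x) - (\<integral>\<phi>. (\<Sum>s<t. expert_mean P (double_choice s \<phi>)) \<partial>payoffs)"
    by (simp add: expert_regret_def)
  also have "\<dots> = (\<Sum>s<t. expert_mean P x - (\<integral>\<phi>. expert_mean P (double_choice s \<phi>) \<partial>payoffs))"
  proof (rule regret_eq_sum_losses[where \<mu>="expert_mean P", OF x])
    show "integrable payoffs (\<lambda>\<phi>. expert_mean P (double_choice s \<phi>))" for s
      using choice mean_01[OF commit_in_X] unfolding double_choice_def
      by (intro seq.integrable_const_bound[where B=1]) auto
  qed
  finally show ?thesis .
qed

lemma double_choice_loss:
  assumes P: "expert_instance X P"
  shows "\<exists>x\<in>X. (\<forall>y\<in>X. expert_mean P y \<le> expert_mean P x) \<and> (\<forall>\<^sub>F s in sequentially.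
    expert_mean P x - (\<integral>\<phi>. expert_mean P (double_choice s \<phi>) \<partial>(\<Pi>\<^sub>M t\<in>(UNIV :: nat set). P)) \<le>
      2 * real (sample_size s) * exp (- 2 * sqrt (real (sample_size s))))"
proof -
  interpret stochastic_payoffs X R e P "expert_mean P"
    using P by (rule stochastic_payoffs_expert_instance)
  let ?\<mu> = "expert_mean P"
  obtain x m\<^sub>0 c\<^sub>0 where x: "x \<in> X" "\<forall>y\<in>X. ?\<mu> y \<le> ?\<mu> x" and "c\<^sub>0 > 0"
    and loss: "\<forall>m\<ge>m\<^sub>0. \<forall>n>0. \<forall>c\<in>{0..c\<^sub>0}. \<forall>\<tau>. (\<forall>i. inj_on (\<tau> i) {..<n}) \<longrightarrow>
      ?\<mu> x - seq.expectation (\<lambda>\<kappa>. ?\<mu> (commit m n c (samples \<tau> \<kappa>))) \<le>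
        2 * real m * exp (- 2 * real n * c\<^sup>2)"
    using commit_loss by blast
  have "filterlim sample_size at_top sequentially"
    unfolding sample_size_def by real_asymp
  then have "\<forall>\<^sub>F s in sequentially. max 1 m\<^sub>0 \<le> sample_size s"
    unfolding filterlim_at_top by blast
  moreover have "tolerance \<longlonglongrightarrow> 0"
    unfolding tolerance_def sample_size_def by real_asymp
  then have "\<forall>\<^sub>F s in sequentially. tolerance s < c\<^sub>0"
    using \<open>c\<^sub>0 > 0\<close> by (intro order_tendstoD)
  ultimately have "\<forall>\<^sub>F s in sequentially. ?\<mu> x - seq.expectation (\<lambda>\<phi>. ?\<mu> (double_choice s \<phi>)) \<le>
      2 * real (sample_size s) * exp (- 2 * sqrt (real (sample_size s)))"
  proof eventually_elim
    case (elim s)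
    then have s: "sample_size s \<ge> m\<^sub>0" "sample_size s > 0" "tolerance s \<in> {0..c\<^sub>0}"
      by (auto simp: tolerance_def)
    have "?\<mu> x - seq.expectation (\<lambda>\<phi>. ?\<mu> (double_choice s \<phi>)) \<le>
        2 * real (sample_size s) * exp (- 2 * real (sample_size s) * (tolerance s)\<^sup>2)"
      unfolding double_choice_def
      by (rule loss[rule_format, OF s, of "\<lambda>i l. prod_encode (i, l)"]) (simp add: inj_on_def)
    then show ?case
      using sample_size_tolerance[OF s(2)] by (simp add: mult.assoc)
  qed
  with x show ?thesis by blast
qed

lemma double_commit_regret_bounded:
  assumes Q: "seed_law Q" and P: "expert_instance X P"
  shows "\<exists>C. \<forall>t. expert_regret X Q (double_pick double_commit) P t \<le> C"
proof -
  interpret stochastic_payoffs X R e P "expert_mean P"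
    using P by (rule stochastic_payoffs_expert_instance)
  define b where "b x s = expert_mean P x - seq.expectation (\<lambda>\<phi>. expert_mean P (double_choice s \<phi>))"
    for x s
  let ?err = "\<lambda>s. 2 * real (sample_size s) * exp (- 2 * sqrt (real (sample_size s)))"
  obtain x where x: "x \<in> X" "\<forall>y\<in>X. expert_mean P y \<le> expert_mean P x"
    and "\<forall>\<^sub>F s in sequentially. b x s \<le> ?err s"
    using double_choice_loss[OF P] unfolding b_def by blast
  then obtain s\<^sub>0 where "\<And>s. s \<ge> s\<^sub>0 \<Longrightarrow> b x s \<le> ?err s"
    unfolding eventually_sequentially by blast
  moreover have "b x s \<le> 1" for s
  proof -
    have "0 \<le> seq.expectation (\<lambda>\<phi>. expert_mean P (double_choice s \<phi>))"
      using mean_01[OF commit_in_X] unfolding double_choice_def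
      by (intro Bochner_Integration.integral_nonneg) auto
    then show ?thesis
      using mean_01[OF x(1)] by (simp add: b_def)
  qed
  ultimately have "(\<Sum>s<t. b x s) \<le> real s\<^sub>0 + (\<Sum>s. ?err s)" for t
    by (intro sum_le_initial_plus_suminf summable_double_error) auto
  moreover have "expert_regret X Q (double_pick double_commit) P t = (\<Sum>s<t. b x s)" for t
    using expert_regret_double_commit[OF Q P x(1)] x(2) unfolding b_def by blast
  ultimately show ?thesis by metis
qed

end

lemma countable_ordered_arms:
  fixes X :: "'a::metric_space set"
  assumes "compact X" "X \<noteq> {}" "countable X"
  obtains R where "ordered_arms X R (from_nat_into X)"
proof -
  obtain R where "strict_linear_order_on X R" "\<And>x. x \<in> X \<Longrightarrow> compact {y\<in>X. (x, y) \<in> R}"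
    by (rule countable_compact_order[OF assms(1,3)]) (rule that)
  then have "ordered_arms X R (from_nat_into X)"
    using assms by unfold_locales auto
  then show ?thesis by (rule that)
qed

theorem countable_imp_double_tractable:
  fixes X :: "'a::metric_space set"
  assumes "compact X" "X \<noteq> {}" "countable X"
  shows "double_tractable X (\<lambda>_. 1)"
proof -
  obtain R where "ordered_arms X R (from_nat_into X)"
    using countable_ordered_arms[OF assms] .
  then interpret ordered_arms X R "from_nat_into X" .
  have Q: "seed_law (return borel 0)"
    by (rule seed_law_return)
  have "\<exists>C. \<forall>t\<ge>1. expert_regret X (return borel 0) (double_pick double_commit) P t \<le> C * 1"
    if "expert_instance X P" for P
    using double_commit_regret_bounded[OF Q that] by auto
  with double_commit_algorithm[OF Q] show ?thesis
    unfolding double_tractable_def by blast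
qed


subsection \<open>Countable spaces: the bandit problem\<close>

definition epoch_start :: "nat \<Rightarrow> nat" where
  "epoch_start j = 2 ^ 2 ^ j"

definition epoch :: "nat \<Rightarrow> nat" where
  "epoch t = floor_log (floor_log t)"

lemma less_epoch_start: "j < epoch_start j"
  unfolding epoch_start_def by (meson less_exp order_less_trans)

lemma two_le_epoch_start: "2 \<le> epoch_start j"
  using power_increasing[of 1 "2 ^ j" "2::nat"] by (simp add: epoch_start_def)

lemma le_floor_log_iff:
  assumes "n > 0" shows "k \<le> floor_log n \<longleftrightarrow> 2 ^ k \<le> n"
proof
  assume "k \<le> floor_log n"
  then have "2 ^ k \<le> (2::nat) ^ floor_log n"
    by (rule power_increasing) simp
  also have "\<dots> \<le> n"
    by (rule floor_log_exp2_le[OF assms])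
  finally show "2 ^ k \<le> n" .
next
  assume "2 ^ k \<le> n"
  then show "k \<le> floor_log n"
    using floor_log_le_iff[of "2 ^ k" n] by simp
qed

lemma le_epoch_iff:
  assumes "2 \<le> t" shows "j \<le> epoch t \<longleftrightarrow> epoch_start j \<le> t"
proof -
  have "0 < floor_log t"
    using le_floor_log_iff[of t 1] assms by simp
  then show ?thesis
    using assms by (simp add: epoch_def epoch_start_def le_floor_log_iff)
qed

lemma epoch_start_epoch_le: "2 \<le> t \<Longrightarrow> epoch_start (epoch t) \<le> t"
  by (simp flip: le_epoch_iff)

lemma less_epoch_start_Suc_epoch:
  assumes "2 \<le> t" shows "t < epoch_start (Suc (epoch t))"
  using le_epoch_iff[OF assms, of "Suc (epoch t)"] by simp

lemma epoch_eqI: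
  assumes "epoch_start j \<le> t" "t < epoch_start (Suc j)"
  shows "epoch t = j"
proof (rule antisym)
  have t: "2 \<le> t"
    using two_le_epoch_start assms(1) order_trans by blast
  show "epoch t \<le> j"
    using le_epoch_iff[OF t, of "Suc j"] assms(2) by simp
  show "j \<le> epoch t"
    using le_epoch_iff[OF t] assms(1) by simp
qed

lemma slowly_growing_weights:
  fixes f :: "nat \<Rightarrow> real"
  assumes pos: "\<And>t. t \<ge> 1 \<Longrightarrow> f t > 0" and lim: "filterlim (\<lambda>t. f t / ln (real t)) at_top sequentially"
  obtains w :: "nat \<Rightarrow> nat" where "\<And>j. w j \<le> j" "filterlim w at_top sequentially"
    "\<And>j t. epoch_start j \<le> t \<Longrightarrow> (real (w j))\<^sup>2 * ln (real t) \<le> f t"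
proof -
  define W where "W j = {k\<in>{..j}. \<forall>t\<ge>epoch_start j. (real k)\<^sup>2 * ln (real t) \<le> f t}" for j
  have finite: "finite (W j)" for j
    by (simp add: W_def)
  have "f t \<ge> 0" if "epoch_start j \<le> t" for j t
    using pos[of t] two_le_epoch_start[of j] that by simp
  then have "0 \<in> W j" for j
    by (auto simp: W_def)
  then have Max: "Max (W j) \<in> W j" for j
    using finite by (intro Max_in) auto
  have "filterlim (\<lambda>j. Max (W j)) at_top sequentially"
    unfolding filterlim_at_top
  proof
    fix k :: nat
    obtain t\<^sub>0 where t\<^sub>0: "\<And>t. t \<ge> t\<^sub>0 \<Longrightarrow> (real k)\<^sup>2 \<le> f t / ln (real t)"
      using lim unfolding filterlim_at_top eventually_sequentially by blast
    have "k \<in> W j" if j: "j \<ge> max k t\<^sub>0" for j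
    proof -
      have "(real k)\<^sup>2 * ln (real t) \<le> f t" if t: "epoch_start j \<le> t" for t
      proof -
        have "t \<ge> t\<^sub>0" "t \<ge> 2"
          using less_epoch_start[of j] two_le_epoch_start[of j] t j by auto
        then show ?thesis
          using t\<^sub>0[of t] by (simp add: pos_le_divide_eq)
      qed
      then show ?thesis
        using j by (auto simp: W_def)
    qed
    then show "\<forall>\<^sub>F j in sequentially. k \<le> Max (W j)"
      unfolding eventually_sequentially using Max_ge[OF finite] by blast
  qed
  then show ?thesis
    using that[of "\<lambda>j. Max (W j)"] Max unfolding W_def by blast
qed

text \<open>
  With the tolerance \<open>1 / sqrt (w j)\<close>, this many samples bring the error probability for each arm
  down to \<open>2 * exp (- (2 ^ (j + 3)))\<close>, which is summable over all rounds of all epochs.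
\<close>

definition batch_size :: "(nat \<Rightarrow> nat) \<Rightarrow> nat \<Rightarrow> nat" where
  "batch_size w j = 2 ^ (j + 2) * w j"

definition slot :: "(nat \<Rightarrow> nat) \<Rightarrow> nat \<Rightarrow> nat \<Rightarrow> nat \<Rightarrow> nat" where
  "slot w j i l = epoch_start j + i * batch_size w j + l"

definition exploring :: "(nat \<Rightarrow> nat) \<Rightarrow> nat \<Rightarrow> bool" where
  "exploring w t \<longleftrightarrow> t < 2 \<or> t < epoch_start (epoch t) + w (epoch t) * batch_size w (epoch t)"

lemma inj_on_slot: "inj_on (slot w j i) A"
  by (simp add: inj_on_def slot_def)

lemma slot_bounds:
  assumes "i < w j" "l < batch_size w j"
  shows "epoch_start j \<le> slot w j i l" "slot w j i l < epoch_start j + w j * batch_size w j"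
proof -
  have "i * batch_size w j + l < Suc i * batch_size w j"
    using assms(2) by simp
  also have "\<dots> \<le> w j * batch_size w j"
    using assms(1) by (intro mult_le_mono1) simp
  finally show "slot w j i l < epoch_start j + w j * batch_size w j"
    by (simp add: slot_def)
qed (simp add: slot_def)

lemma
  assumes t: "\<not> exploring w t" and il: "i < w (epoch t)" "l < batch_size w (epoch t)"
  shows slot_less: "slot w (epoch t) i l < t"
    and exploring_slot: "exploring w (slot w (epoch t) i l)"
    and epoch_slot: "epoch (slot w (epoch t) i l) = epoch t"
proof -
  let ?s = "slot w (epoch t) i l"
  show less: "?s < t"
    using slot_bounds[OF il] t by (auto simp: exploring_def)
  have "2 \<le> t"
    using t by (simp add: exploring_def)
  then have "?s < epoch_start (Suc (epoch t))"
    using less less_epoch_start_Suc_epoch order_less_trans by blast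
  then show "epoch ?s = epoch t"
    using slot_bounds(1)[OF il] by (intro epoch_eqI)
  then show "exploring w ?s"
    using slot_bounds(2)[OF il] by (simp add: exploring_def)
qed

lemma card_exploring_le: "card {s. s < t \<and> exploring w s} \<le> 2 + (\<Sum>j\<le>epoch t. w j * batch_size w j)"
proof -
  let ?block = "\<lambda>j. {epoch_start j..<epoch_start j + w j * batch_size w j}"
  have "{s. s < t \<and> exploring w s} \<subseteq> {..<2} \<union> (\<Union>j\<in>{..epoch t}. ?block j)"
  proof
    fix s assume "s \<in> {s. s < t \<and> exploring w s}"
    then have s: "s < t" "exploring w s" by auto
    show "s \<in> {..<2} \<union> (\<Union>j\<in>{..epoch t}. ?block j)"
    proof (cases "s < 2")
      case False
      then have "epoch_start (epoch s) \<le> s"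
        by (intro epoch_start_epoch_le) simp
      moreover have "epoch s \<le> epoch t"
        using calculation False s(1) le_epoch_iff[of t "epoch s"] by simp
      ultimately show ?thesis
        using s(2) False by (auto simp: exploring_def)
    qed simp
  qed
  then have "card {s. s < t \<and> exploring w s} \<le> card ({..<2} \<union> (\<Union>j\<in>{..epoch t}. ?block j))"
    by (intro card_mono) auto
  also have "\<dots> \<le> card {..<2::nat} + card (\<Union>j\<in>{..epoch t}. ?block j)"
    by (rule card_Un_le)
  also have "card (\<Union>j\<in>{..epoch t}. ?block j) \<le> (\<Sum>j\<le>epoch t. card (?block j))"
    by (rule card_UN_le) simp
  finally show ?thesis by simp
qed

lemma exploration_le:
  fixes f :: "nat \<Rightarrow> real"
  assumes w: "\<And>j t. epoch_start j \<le> t \<Longrightarrow> (real (w j))\<^sup>2 * ln (real t) \<le> f t" and "2 \<le> t"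
  shows "real (\<Sum>j\<le>epoch t. w j * batch_size w j) \<le> 16 * f t"
proof -
  let ?J = "epoch t"
  have ln_pos: "ln (real t) > 0"
    using \<open>2 \<le> t\<close> by simp
  have "2 ^ ?J / 2 \<le> 2 ^ ?J * ln (2::real)"
    using ln2_ge_two_thirds by simp
  also have "\<dots> = ln (real (epoch_start ?J))"
    by (simp add: epoch_start_def ln_realpow)
  also have "\<dots> \<le> ln (real t)"
    using epoch_start_epoch_le[OF \<open>2 \<le> t\<close>] two_le_epoch_start[of ?J] by (intro ln_mono) auto
  finally have epoch_le: "2 ^ ?J \<le> 2 * ln (real t)" by simp
  have w_le: "(real (w j))\<^sup>2 \<le> f t / ln (real t)" if "j \<le> ?J" for j
    using w[of j t] that le_epoch_iff[OF \<open>2 \<le> t\<close>] ln_pos by (simp add: pos_le_divide_eq)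
  have ratio_nonneg: "0 \<le> f t / ln (real t)"
    using w_le[of 0] order_trans zero_le_power2 by blast
  have powers: "2 ^ Suc ?J - 1 = (\<Sum>j\<le>?J. (2::real) ^ j)"
    using geometric_sum[of "2::real" "Suc ?J"] by (simp add: lessThan_Suc_atMost)
  have "real (\<Sum>j\<le>?J. w j * batch_size w j) = 4 * (\<Sum>j\<le>?J. 2 ^ j * (real (w j))\<^sup>2)"
    by (simp add: batch_size_def sum_distrib_left power2_eq_square power_add mult_ac)
  also have "\<dots> \<le> 4 * (\<Sum>j\<le>?J. 2 ^ j * (f t / ln (real t)))"
    using w_le by (intro mult_left_mono sum_mono) auto
  also have "\<dots> = 4 * (2 ^ Suc ?J - 1) * (f t / ln (real t))"
    unfolding powers by (simp only: sum_distrib_right mult.assoc)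
  also have "\<dots> \<le> 16 * ln (real t) * (f t / ln (real t))"
    using epoch_le ratio_nonneg by (intro mult_right_mono) auto
  finally show ?thesis
    using ln_pos by simp
qed

lemma commit_error_le_inverse_square:
  assumes "w \<le> j" "s < epoch_start (Suc j)" "s > 0"
  shows "2 * real w * exp (- (2 ^ (j + 3))) \<le> 1 / (real s)\<^sup>2"
proof -
  let ?E = "2 ^ (j + 2) :: real"
  have "(2::real) ^ 2 ^ (j + 2) \<le> exp 1 ^ 2 ^ (j + 2)"
    using exp_ge_add_one_self[of 1] by (intro power_mono) auto
  also have "\<dots> = exp ?E"
    using exp_of_nat_mult[of "2 ^ (j + 2)" "1::real"] by simp
  also have "(2::real) ^ 2 ^ (j + 2) = (real (epoch_start (Suc j)))\<^sup>2"
    by (simp add: epoch_start_def power_mult[symmetric] mult.commute)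
  finally have "(real (epoch_start (Suc j)))\<^sup>2 \<le> exp ?E" .
  moreover have "(real s)\<^sup>2 \<le> (real (epoch_start (Suc j)))\<^sup>2"
    using assms(2) by (intro power_mono) auto
  ultimately have square_le: "(real s)\<^sup>2 \<le> exp ?E"
    by linarith
  have "2 * real w \<le> ?E"
  proof -
    have "real w \<le> real j" "real j < 2 ^ j" "?E = 4 * 2 ^ j"
      using assms(1) of_nat_less_two_power[of j, where 'a=real] by (auto simp: power_add)
    then show ?thesis by linarith
  qed
  then have "2 * real w \<le> exp ?E"
    using exp_ge_add_one_self[of ?E] by linarith
  then have "2 * real w * (real s)\<^sup>2 \<le> exp ?E * exp ?E"
    using square_le by (intro mult_mono) auto
  also have "\<dots> = exp (2 ^ (j + 3))"
    by (simp add: exp_add[symmetric] power_add)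
  finally show ?thesis
    using assms(3) by (simp add: exp_minus divide_simps)
qed

lemma positive_at_top_lower_bound:
  fixes f :: "nat \<Rightarrow> real"
  assumes pos: "\<And>t. t \<ge> n \<Longrightarrow> f t > 0" and lim: "filterlim f at_top sequentially"
  shows "\<exists>\<eta>>0. \<forall>t\<ge>n. \<eta> \<le> f t"
proof -
  obtain t\<^sub>0 where t\<^sub>0: "\<And>t. t \<ge> t\<^sub>0 \<Longrightarrow> 1 \<le> f t"
    using lim unfolding filterlim_at_top eventually_sequentially by blast
  define \<eta> where "\<eta> = Min (insert 1 (f ` {n..t\<^sub>0}))"
  have "\<eta> > 0"
    unfolding \<eta>_def using pos by (subst Min_gr_iff) auto
  moreover have "\<eta> \<le> f t" if "t \<ge> n" for t
  proof (cases "t \<le> t\<^sub>0")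
    case True
    then show ?thesis
      unfolding \<eta>_def using that by (intro Min_le) auto
  next
    case False
    have "\<eta> \<le> 1"
      unfolding \<eta>_def by (intro Min_le) auto
    also have "\<dots> \<le> f t"
      using t\<^sub>0 False by simp
    finally show ?thesis .
  qed
  ultimately show ?thesis by blast
qed

lemma measurable_evaluation_pair_countable:
  fixes X :: "'a::metric_space set"
  assumes "countable X" "\<And>x. x \<in> X \<Longrightarrow> (\<lambda>z. z x) \<in> borel_measurable N"
  shows "(\<lambda>(z, x). z x) \<in> borel_measurable (N \<Otimes>\<^sub>M arms X)"
proof -
  have "(\<lambda>p. (fst p) (snd p)) \<in> borel_measurable (N \<Otimes>\<^sub>M count_space X)"
    by (rule measurable_compose_countable'[where f="\<lambda>x p. (fst p) x" and I=X])
      (use assms in \<open>auto intro: measurable_compose[OF measurable_fst]\<close>)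
  then show ?thesis
    unfolding case_prod_beta'
    by (subst measurable_cong_sets[OF sets_pair_measure_cong[OF refl arms_countable[OF assms(1)]] refl])
qed

context ordered_arms
begin

definition bandit_rule :: "(nat \<Rightarrow> nat) \<Rightarrow> nat \<Rightarrow> real \<Rightarrow> (nat \<Rightarrow> real) \<Rightarrow> 'a" where
  "bandit_rule w t \<omega> r = (let j = epoch t in
    if exploring w t then e ((t - epoch_start j) div batch_size w j)
    else commit (w j) (batch_size w j) (1 / sqrt (real (w j))) (\<lambda>i l. r (slot w j i l)))"

lemma bandit_rule_in_X: "bandit_rule w t \<omega> r \<in> X"
  by (simp add: bandit_rule_def Let_def e_in_X commit_in_X)

lemma bandit_rule_algorithm:
  assumes "seed_law Q"
  shows "mab_algorithm X Q (bandit_rule w)"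
  unfolding mab_algorithm_def
proof (intro conjI allI)
  fix t :: nat
  let ?M = "Q \<Otimes>\<^sub>M (\<Pi>\<^sub>M s\<in>{..<t}. (borel :: real measure))"
  show "(\<lambda>(\<omega>, r). bandit_rule w t \<omega> r) \<in> ?M \<rightarrow>\<^sub>M arms X"
  proof (cases "exploring w t")
    case True
    then show ?thesis
      by (simp add: bandit_rule_def Let_def case_prod_beta' space_restrict_space e_in_X)
  next
    case False
    have "(\<lambda>p. snd p (slot w (epoch t) i l)) \<in> borel_measurable ?M"
      if "i < w (epoch t)" "l < batch_size w (epoch t)" for i l
      using measurable_compose[OF measurable_snd measurable_component_singleton]
        slot_less[OF False that]
      by simp
    from measurable_commit[OF this] show ?thesis
      using False by (simp add: bandit_rule_def Let_def case_prod_beta')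
  qed
qed (rule assms)

lemma mab_pick_bandit_rule:
  assumes t: "\<not> exploring w t"
  shows "mab_pick (bandit_rule w) F t \<omega> \<kappa> = commit (w (epoch t)) (batch_size w (epoch t))
    (1 / sqrt (real (w (epoch t)))) (\<lambda>i l. F (\<kappa> (slot w (epoch t) i l)) (e i))"
proof -
  let ?j = "epoch t"
  have "mab_run (bandit_rule w) F \<omega> \<kappa> t (slot w ?j i l) = F (\<kappa> (slot w ?j i l)) (e i)"
    if il: "i < w ?j" "l < batch_size w ?j" for i l
  proof -
    have "(slot w ?j i l - epoch_start ?j) div batch_size w ?j = i"
      using il(2) by (simp add: slot_def)
    then show ?thesis
      using exploring_slot[OF t il] epoch_slot[OF t il]
      by (simp add: mab_run_nth[OF slot_less[OF t il]] mab_pick_def bandit_rule_def)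
  qed
  then show ?thesis
    using t by (simp add: mab_pick_def bandit_rule_def Let_def cong: commit_cong)
qed

lemma mab_instance_payoff_process:
  assumes "mab_instance X \<mu> \<nu>"
  obtains N where "stochastic_payoffs X R e N \<mu>" "\<And>x. x \<in> X \<Longrightarrow> \<nu> x = distr N borel (\<lambda>z. z x)"
proof -
  have kernel: "\<nu> \<in> arms X \<rightarrow>\<^sub>M prob_algebra borel"
    using assms by (simp add: mab_instance_def)
  have prob: "prob_space (\<nu> x)" "sets (\<nu> x) = sets borel" if "x \<in> X" for x
    using measurable_space[OF kernel, of x] that by (auto simp: space_prob_algebra space_restrict_space)
  define N where "N = PiM X \<nu>"
  have component: "(\<lambda>z. z x) \<in> borel_measurable N" if "x \<in> X" for x
    using measurable_component_singleton[OF that, of \<nu>] prob(2)[OF that]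
    by (simp add: N_def cong: measurable_cong_sets)
  have \<nu>: "\<nu> x = distr N borel (\<lambda>z. z x)" if "x \<in> X" for x
    using distr_PiM_component[of X \<nu> x] prob that
      distr_cong[OF refl, of borel "\<nu> x" N "\<lambda>z. z x" "\<lambda>z. z x"]
    by (simp add: N_def)
  have "stochastic_payoffs X R e N \<mu>"
  proof (intro stochastic_payoffs.intro stochastic_payoffs_axioms.intro ordered_arms_axioms component)
    show "prob_space N"
      unfolding N_def using prob(1) by (rule prob_space_PiM)
    fix x assume x: "x \<in> X"
    have "AE y in \<nu> x. y \<in> {0..1}" "(\<integral>y. y \<partial>\<nu> x) = \<mu> x"
      using assms x by (auto simp: mab_instance_def)
    then show "AE z in N. z x \<in> {0..1}" "(\<integral>z. z x \<partial>N) = \<mu> x"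
      unfolding \<nu>[OF x] by (simp_all add: AE_distr_iff integral_distr component[OF x])
  next
    show "continuous_on X \<mu>"
      using assms lipschitz_on_continuous_on by (auto simp: mab_instance_def)
  qed
  then show ?thesis
    using \<nu> by (rule that)
qed

end

locale bandit_run = stochastic_payoffs X R e N \<mu> + mab_tape X Q "bandit_rule w" N "\<lambda>z. z"
  for X :: "'a::metric_space set" and R e N \<mu> Q w +
  assumes weight_le: "\<And>j. w j \<le> j" and weight_at_top: "filterlim w at_top sequentially"
begin

abbreviation "expected_payoff s \<equiv> \<integral>p. \<mu> (mab_pick (bandit_rule w) (\<lambda>z. z) s (fst p) (snd p)) \<partial>tape"

lemma mean_pick_01: "\<mu> (mab_pick (bandit_rule w) (\<lambda>z. z) s \<omega> \<kappa>) \<in> {0..1}"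
  unfolding mab_pick_def by (rule mean_01[OF bandit_rule_in_X])

lemma integrable_mean_pick:
  "integrable tape (\<lambda>p. \<mu> (mab_pick (bandit_rule w) (\<lambda>z. z) s (fst p) (snd p)))"
  using mean_pick_01 measurable_compose[OF measurable_pick measurable_mean]
  by (intro pair.integrable_const_bound[where B=1]) auto

lemma loss_le_1:
  assumes "x \<in> X" shows "\<mu> x - expected_payoff s \<le> 1"
proof -
  have "0 \<le> expected_payoff s"
    using mean_pick_01 by (intro Bochner_Integration.integral_nonneg) auto
  then show ?thesis
    using mean_01[OF assms] by simp
qed

lemma expected_payoff_committed:
  assumes "\<not> exploring w s"
  shows "expected_payoff s = seq.expectation (\<lambda>\<kappa>. \<mu> (commit (w (epoch s)) (batch_size w (epoch s))
    (1 / sqrt (real (w (epoch s)))) (samples (slot w (epoch s)) \<kappa>)))"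
  unfolding mab_pick_bandit_rule[OF assms]
  by (rule pair.integral_pair_snd[OF measurable_compose[OF measurable_commit_samples measurable_mean]])

lemma committed_loss:
  "\<exists>x\<in>X. (\<forall>y\<in>X. \<mu> y \<le> \<mu> x) \<and>
    (\<exists>s\<^sub>0. \<forall>s\<ge>s\<^sub>0. \<not> exploring w s \<longrightarrow> \<mu> x - expected_payoff s \<le> 1 / (real s)\<^sup>2)"
proof -
  obtain x m\<^sub>0 c\<^sub>0 where x: "x \<in> X" "\<forall>y\<in>X. \<mu> y \<le> \<mu> x" and "c\<^sub>0 > 0"
    and loss: "\<forall>m\<ge>m\<^sub>0. \<forall>n>0. \<forall>c\<in>{0..c\<^sub>0}. \<forall>\<tau>. (\<forall>i. inj_on (\<tau> i) {..<n}) \<longrightarrow>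
      \<mu> x - seq.expectation (\<lambda>\<kappa>. \<mu> (commit m n c (samples \<tau> \<kappa>))) \<le>
        2 * real m * exp (- 2 * real n * c\<^sup>2)"
    using commit_loss by blast
  have "(\<lambda>k. 1 / sqrt (real k)) \<longlonglongrightarrow> 0"
    by real_asymp
  then have "\<forall>\<^sub>F k in sequentially. 1 / sqrt (real k) < c\<^sub>0"
    using \<open>c\<^sub>0 > 0\<close> by (intro order_tendstoD)
  then have "\<forall>\<^sub>F k in sequentially. max 1 m\<^sub>0 \<le> k \<and> 1 / sqrt (real k) < c\<^sub>0"
    using eventually_ge_at_top[of "max 1 m\<^sub>0"] by eventually_elim simp
  then have "\<forall>\<^sub>F j in sequentially. max 1 m\<^sub>0 \<le> w j \<and> 1 / sqrt (real (w j)) < c\<^sub>0"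
    by (rule eventually_compose_filterlim[OF _ weight_at_top])
  then obtain j\<^sub>0 where j\<^sub>0: "\<And>j. j \<ge> j\<^sub>0 \<Longrightarrow> max 1 m\<^sub>0 \<le> w j \<and> 1 / sqrt (real (w j)) < c\<^sub>0"
    unfolding eventually_sequentially by blast
  have "\<mu> x - expected_payoff s \<le> 1 / (real s)\<^sup>2" if s: "s \<ge> epoch_start j\<^sub>0" "\<not> exploring w s" for s
  proof -
    let ?j = "epoch s"
    have "2 \<le> s"
      using s(2) by (simp add: exploring_def)
    then have "j\<^sub>0 \<le> ?j"
      using s(1) le_epoch_iff by simp
    then have w: "m\<^sub>0 \<le> w ?j" "w ?j > 0" "1 / sqrt (real (w ?j)) \<in> {0..c\<^sub>0}"
      using j\<^sub>0[of ?j] by auto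
    have "real (batch_size w ?j) * (1 / sqrt (real (w ?j)))\<^sup>2 = 2 ^ (?j + 2)"
      using w(2) by (simp add: batch_size_def power_divide)
    then have exponent: "- 2 * real (batch_size w ?j) * (1 / sqrt (real (w ?j)))\<^sup>2 = - (2 ^ (?j + 3))"
      by (simp add: power_add)
    have "\<mu> x - expected_payoff s \<le>
        2 * real (w ?j) * exp (- 2 * real (batch_size w ?j) * (1 / sqrt (real (w ?j)))\<^sup>2)"
      unfolding expected_payoff_committed[OF s(2)]
      using w by (intro loss[rule_format] inj_on_slot) (auto simp: batch_size_def)
    also have "\<dots> \<le> 1 / (real s)\<^sup>2"
      unfolding exponent
      using weight_le less_epoch_start_Suc_epoch \<open>2 \<le> s\<close> by (intro commit_error_le_inverse_square) auto
    finally show ?thesis .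
  qed
  with x show ?thesis by blast
qed

lemma mab_regret_le_exploration:
  assumes inst: "mab_instance X \<mu> \<nu>" and \<nu>: "\<And>x. x \<in> X \<Longrightarrow> \<nu> x = distr N borel (\<lambda>z. z x)"
  shows "\<exists>K\<ge>0. \<forall>t. mab_regret X Q (bandit_rule w) \<mu> \<nu> t \<le> K + real (\<Sum>j\<le>epoch t. w j * batch_size w j)"
proof -
  obtain x s\<^sub>0 where x: "x \<in> X" "\<And>y. y \<in> X \<Longrightarrow> \<mu> y \<le> \<mu> x"
    and s\<^sub>0: "\<And>s. s \<ge> s\<^sub>0 \<Longrightarrow> \<not> exploring w s \<Longrightarrow> \<mu> x - expected_payoff s \<le> 1 / (real s)\<^sup>2"
    using committed_loss by blast
  define b where "b s = \<mu> x - expected_payoff s" for s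
  have b_le_1: "b s \<le> 1" for s
    unfolding b_def by (rule loss_le_1[OF x(1)])
  define K where "K = 2 + real s\<^sub>0 + (\<Sum>s. 1 / (real s)\<^sup>2)"
  have "0 \<le> (\<Sum>s. 1 / (real s)\<^sup>2)"
    by (intro suminf_nonneg summable_inverse_square) simp
  then have "K \<ge> 0"
    by (simp add: K_def)
  moreover have "mab_regret X Q (bandit_rule w) \<mu> \<nu> t \<le> K + real (\<Sum>j\<le>epoch t. w j * batch_size w j)"
    for t
  proof -
    let ?E = "{s. s < t \<and> exploring w s}"
    have "mab_regret X Q (bandit_rule w) \<mu> \<nu> t = (\<Sum>s<t. b s)"
      using regret_eq_sum_losses[where \<mu>=\<mu>, OF x integrable_mean_pick, of t]
      by (simp add: mab_regret_eq[OF inst \<nu>] b_def)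
    also have "\<dots> \<le> (\<Sum>s<t. (if exploring w s then 1 else 0) + (if exploring w s then 0 else b s))"
      using b_le_1 by (intro sum_mono) auto
    also have "\<dots> = real (card ?E) + (\<Sum>s<t. if exploring w s then 0 else b s)"
      by (simp add: sum.distrib sum.If_cases Collect_conj_eq lessThan_def)
    also have "(\<Sum>s<t. if exploring w s then 0 else b s) \<le> real s\<^sub>0 + (\<Sum>s. 1 / (real s)\<^sup>2)"
      using b_le_1 s\<^sub>0 by (intro sum_le_initial_plus_suminf summable_inverse_square) (auto simp: b_def)
    also have "real (card ?E) \<le> real (2 + (\<Sum>j\<le>epoch t. w j * batch_size w j))"
      by (intro of_nat_mono card_exploring_le)
    finally show ?thesis
      by (simp add: K_def)
  qed
  ultimately show ?thesis by blast
qed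

end

lemma (in ordered_arms) bandit_rule_regret_le:
  assumes w: "\<And>j. w j \<le> j" "filterlim w at_top sequentially"
    and Q: "seed_law Q" and inst: "mab_instance X \<mu> \<nu>"
  shows "\<exists>K\<ge>0. \<forall>t. mab_regret X Q (bandit_rule w) \<mu> \<nu> t \<le> K + real (\<Sum>j\<le>epoch t. w j * batch_size w j)"
proof -
  obtain N where N: "stochastic_payoffs X R e N \<mu>"
    and \<nu>: "\<And>x. x \<in> X \<Longrightarrow> \<nu> x = distr N borel (\<lambda>z. z x)"
    by (rule mab_instance_payoff_process[OF inst]) (rule that)
  interpret N: stochastic_payoffs X R e N \<mu>
    by (rule N)
  interpret bandit_run X R e N \<mu> Q w
    using bandit_rule_algorithm[OF Q] w
      measurable_evaluation_pair_countable[OF countable_arms N.measurable_payoff]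
    by unfold_locales
  show ?thesis
    using mab_regret_le_exploration[OF inst \<nu>] .
qed

lemma at_top_of_superlogarithmic:
  fixes f :: "nat \<Rightarrow> real"
  assumes "filterlim (\<lambda>t. f t / ln (real t)) at_top sequentially"
  shows "filterlim f at_top sequentially"
proof -
  have "\<forall>\<^sub>F t in sequentially. f t / ln (real t) * ln (real t) = f t"
    using eventually_ge_at_top[of 2] by eventually_elim simp
  moreover have "filterlim (\<lambda>t. f t / ln (real t) * ln (real t)) at_top sequentially"
    by (intro filterlim_at_top_mult_at_top assms) real_asymp
  ultimately show ?thesis
    by (rule filterlim_cong[OF refl refl, THEN iffD1])
qed

lemma (in ordered_arms) bandit_rule_regret_bounded:
  fixes f :: "nat \<Rightarrow> real"
  assumes w: "\<And>j. w j \<le> j" "filterlim w at_top sequentially"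
    "\<And>j t. epoch_start j \<le> t \<Longrightarrow> (real (w j))\<^sup>2 * ln (real t) \<le> f t"
    and f: "\<And>t. t \<ge> 1 \<Longrightarrow> f t > 0" "filterlim f at_top sequentially"
    and Q: "seed_law Q" and inst: "mab_instance X \<mu> \<nu>"
  shows "\<exists>C. \<forall>t\<ge>1. mab_regret X Q (bandit_rule w) \<mu> \<nu> t \<le> C * f t"
proof -
  obtain \<eta> where \<eta>: "\<eta> > 0" "\<And>t. t \<ge> 1 \<Longrightarrow> \<eta> \<le> f t"
    using positive_at_top_lower_bound[of 1 f] f by blast
  obtain K where "K \<ge> 0"
    and K: "\<And>t. mab_regret X Q (bandit_rule w) \<mu> \<nu> t \<le> K + real (\<Sum>j\<le>epoch t. w j * batch_size w j)"
    using bandit_rule_regret_le[OF w(1,2) Q inst] by blast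
  have "mab_regret X Q (bandit_rule w) \<mu> \<nu> t \<le> (K / \<eta> + 16) * f t" if t: "t \<ge> 1" for t
  proof -
    have "real (\<Sum>j\<le>epoch t. w j * batch_size w j) \<le> 16 * f t"
    proof (cases "t = 1")
      case True
      then show ?thesis
        using w(1)[of 0] f(1)[OF t] by (simp add: epoch_def)
    next
      case False
      with t show ?thesis
        by (intro exploration_le w(3)) auto
    qed
    moreover have "K \<le> K / \<eta> * f t"
      using mult_left_mono[OF \<eta>(2)[OF t], of "K / \<eta>"] \<open>K \<ge> 0\<close> \<eta>(1) by simp
    ultimately show ?thesis
      using K[of t] by (simp add: distrib_right)
  qed
  then show ?thesis by blast
qed

theorem countable_imp_mab_tractable:
  fixes X :: "'a::metric_space set" and f :: "nat \<Rightarrow> real"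
  assumes X: "compact X" "X \<noteq> {}" "countable X"
    and f: "\<And>t. t \<ge> 1 \<Longrightarrow> f t > 0" "filterlim (\<lambda>t. f t / ln (real t)) at_top sequentially"
  shows "mab_tractable X f"
proof -
  obtain R where "ordered_arms X R (from_nat_into X)"
    using countable_ordered_arms[OF X] .
  then interpret ordered_arms X R "from_nat_into X" .
  obtain w where w: "\<And>j. w j \<le> j" "filterlim w at_top sequentially"
    "\<And>j t. epoch_start j \<le> t \<Longrightarrow> (real (w j))\<^sup>2 * ln (real t) \<le> f t"
    by (rule slowly_growing_weights[OF f]) (assumption, rule that)
  have Q: "seed_law (return borel 0)"
    by (rule seed_law_return)
  have "\<exists>C. \<forall>t\<ge>1. mab_regret X (return borel 0) (bandit_rule w) \<mu> \<nu> t \<le> C * f t"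
    if "mab_instance X \<mu> \<nu>" for \<mu> \<nu>
    using w f(1) at_top_of_superlogarithmic[OF f(2)] Q that by (rule bandit_rule_regret_bounded)
  with bandit_rule_algorithm[OF Q] show ?thesis
    unfolding mab_tractable_def by blast
qed


subsection \<open>Products of biased coins\<close>

lemma expectation_density_pmf:
  fixes f :: "'z \<Rightarrow> real"
  assumes "\<And>z. pmf p z = pmf q z * W z"
  shows "measure_pmf.expectation p f = measure_pmf.expectation q (\<lambda>z. W z * f z)"
proof -
  have "measure_pmf.expectation p' g = (\<integral>z. pmf p' z * g z \<partial>count_space UNIV)"
    for p' and g :: "'z \<Rightarrow> real"
    unfolding measure_pmf_eq_density[of p'] by (simp add: integral_density)
  then show ?thesis
    by (simp add: assms mult_ac)
qed

lemma integrable_measure_pmf_bounded: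
  fixes g :: "'z \<Rightarrow> real"
  assumes "\<And>x. \<bar>g x\<bar> \<le> B"
  shows "integrable (measure_pmf q) g"
  by (rule measure_pmf.integrable_const_bound[where B=B]) (use assms in auto)

lemma (in prob_space) expectation_abs_le_sqrt_expectation_square:
  fixes f :: "'a \<Rightarrow> real"
  assumes "integrable M f" "integrable M (\<lambda>x. (f x)\<^sup>2)"
  shows "expectation (\<lambda>x. \<bar>f x\<bar>) \<le> sqrt (expectation (\<lambda>x. (f x)\<^sup>2))"
proof (rule real_le_rsqrt)
  show "(expectation (\<lambda>x. \<bar>f x\<bar>))\<^sup>2 \<le> expectation (\<lambda>x. (f x)\<^sup>2)"
    using variance_positive[of "\<lambda>x. \<bar>f x\<bar>"] assms by (subst (asm) variance_eq) auto
qed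

lemma expectation_diff_le_chi_square:
  fixes W Z :: "'z \<Rightarrow> real"
  assumes density: "\<And>z. pmf p z = pmf q z * W z" and W: "\<And>z. 0 \<le> W z" "\<And>z. W z \<le> B"
    and Z: "\<And>z. Z z \<in> {0..1}"
  shows "\<bar>measure_pmf.expectation p Z - measure_pmf.expectation q Z\<bar> \<le>
    sqrt (measure_pmf.expectation q (\<lambda>z. (W z)\<^sup>2) - 1)"
proof -
  let ?E = "measure_pmf.expectation q"
  have int: "integrable q W" "integrable q (\<lambda>z. (W z)\<^sup>2)" "integrable q Z"
    "integrable q (\<lambda>z. W z * Z z)"
  proof -
    show "integrable q W"
      by (rule integrable_measure_pmf_bounded[where B=B]) (use W in auto)
    show "integrable q (\<lambda>z. (W z)\<^sup>2)"
      by (rule integrable_measure_pmf_bounded[where B="B\<^sup>2"]) (use power_mono[OF W(2) W(1)] in auto)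
    show "integrable q Z"
      by (rule integrable_measure_pmf_bounded[where B=1]) (use Z in auto)
    show "integrable q (\<lambda>z. W z * Z z)"
    proof (rule integrable_measure_pmf_bounded[where B="B * 1"])
      show "\<bar>W z * Z z\<bar> \<le> B * 1" for z
        using W[of z] Z[of z] mult_mono[of "W z" B "Z z" 1] by simp
    qed
  qed
  have EW: "?E W = 1"
    using expectation_density_pmf[OF density, of "\<lambda>_. 1"] by simp
  have "measure_pmf.expectation p Z - ?E Z = ?E (\<lambda>z. W z * Z z - Z z)"
    unfolding expectation_density_pmf[OF density] using int by simp
  also have "\<bar>\<dots>\<bar> \<le> ?E (\<lambda>z. \<bar>W z * Z z - Z z\<bar>)"
    by (rule integral_abs_bound)
  also have "\<dots> \<le> ?E (\<lambda>z. \<bar>W z - 1\<bar>)"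
  proof (rule integral_mono)
    fix z
    have "W z * Z z - Z z = (W z - 1) * Z z"
      by (simp add: algebra_simps)
    then show "\<bar>W z * Z z - Z z\<bar> \<le> \<bar>W z - 1\<bar>"
      using Z[of z] mult_left_mono[of "Z z" 1 "\<bar>W z - 1\<bar>"] by (simp add: abs_mult)
  qed (use int in auto)
  also have "\<dots> \<le> sqrt (?E (\<lambda>z. (W z - 1)\<^sup>2))"
    using int by (intro measure_pmf.expectation_abs_le_sqrt_expectation_square) (auto simp: power2_diff)
  also have "?E (\<lambda>z. (W z - 1)\<^sup>2) = ?E (\<lambda>z. (W z)\<^sup>2) - 1"
    using int EW by (simp add: power2_diff)
  finally show ?thesis .
qed

lemma expectation_square_density_le:
  fixes L :: "'z \<Rightarrow> real"
  assumes density: "\<And>z. pmf p z = pmf q z * (1 + L z)" and L: "\<And>z. \<bar>L z\<bar> \<le> \<eta>"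
  shows "measure_pmf.expectation q (\<lambda>z. (1 + L z)\<^sup>2) \<le> 1 + \<eta>\<^sup>2"
proof -
  have square: "(L z)\<^sup>2 \<le> \<eta>\<^sup>2" for z
    using power_mono[OF L[of z], of 2] by simp
  have int: "integrable q L" "integrable q (\<lambda>z. (L z)\<^sup>2)"
    using L square by (auto intro!: integrable_measure_pmf_bounded)
  have "measure_pmf.expectation q (\<lambda>z. 1 + L z) = 1"
    using expectation_density_pmf[OF density, of "\<lambda>_. 1"] by simp
  then have "measure_pmf.expectation q L = 0"
    using int by simp
  then have "measure_pmf.expectation q (\<lambda>z. (1 + L z)\<^sup>2) = 1 + measure_pmf.expectation q (\<lambda>z. (L z)\<^sup>2)"
    using int by (simp add: power2_sum)
  also have "measure_pmf.expectation q (\<lambda>z. (L z)\<^sup>2) \<le> measure_pmf.expectation q (\<lambda>_. \<eta>\<^sup>2)"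
    using int square by (intro integral_mono) auto
  finally show ?thesis by simp
qed

text \<open>The likelihood ratio of two product laws is a product, and so is its second moment.\<close>

lemma Pi_pmf_expectation_diff_le:
  fixes p q :: "'z pmf" and Z :: "('i \<Rightarrow> 'z) \<Rightarrow> real"
  assumes I: "finite I" and density: "\<And>z. pmf p z = pmf q z * (1 + L z)"
    and L: "\<And>z. \<bar>L z\<bar> \<le> \<eta>" "\<eta> \<le> 1" and Z: "\<And>x. Z x \<in> {0..1}"
  shows "\<bar>measure_pmf.expectation (Pi_pmf I d (\<lambda>_. p)) Z -
      measure_pmf.expectation (Pi_pmf I d (\<lambda>_. q)) Z\<bar>
    \<le> sqrt ((1 + \<eta>\<^sup>2) ^ card I - 1)"
proof -
  let ?p = "Pi_pmf I d (\<lambda>_. p)" and ?q = "Pi_pmf I d (\<lambda>_. q)"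
  define W where "W x = (\<Prod>i\<in>I. 1 + L (x i))" for x :: "'i \<Rightarrow> 'z"
  have ratio: "0 \<le> 1 + L z" "1 + L z \<le> 2" for z
    using L(1)[of z] L(2) by (auto simp: abs_le_iff)
  have "\<bar>measure_pmf.expectation ?p Z - measure_pmf.expectation ?q Z\<bar> \<le>
      sqrt (measure_pmf.expectation ?q (\<lambda>x. (W x)\<^sup>2) - 1)"
  proof (rule expectation_diff_le_chi_square)
    show "pmf ?p x = pmf ?q x * W x" for x
      using I by (cases "\<forall>i. i \<notin> I \<longrightarrow> x i = d") (auto simp: pmf_Pi density W_def prod.distrib)
    show "0 \<le> W x" for x
      unfolding W_def using ratio by (intro prod_nonneg) auto
    show "W x \<le> 2 ^ card I" for x
      using prod_mono[of I "\<lambda>i. 1 + L (x i)" "\<lambda>_. 2"] ratio by (simp add: W_def)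
  qed (rule Z)
  also have "measure_pmf.expectation ?q (\<lambda>x. (W x)\<^sup>2) =
      measure_pmf.expectation q (\<lambda>z. (1 + L z)\<^sup>2) ^ card I"
  proof -
    have "integrable q (\<lambda>z. (1 + L z)\<^sup>2)"
    proof (rule integrable_measure_pmf_bounded[where B="2\<^sup>2"])
      show "\<bar>(1 + L z)\<^sup>2\<bar> \<le> 2\<^sup>2" for z
        using power_mono[OF ratio(2) ratio(1), of z 2] by simp
    qed
    then show ?thesis
      unfolding W_def prod_power_distrib
      using I by (subst expectation_prod_Pi_pmf) auto
  qed
  also have "\<dots> \<le> (1 + \<eta>\<^sup>2) ^ card I"
    using expectation_square_density_le[OF density L(1)] by (intro power_mono) auto
  finally show ?thesis by simp
qed

lemma sets_PiM_pmf: "sets (\<Pi>\<^sub>M i\<in>I. measure_pmf p) = sets (\<Pi>\<^sub>M i\<in>I. count_space UNIV)"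
  by (rule sets_PiM_cong) simp_all

lemma PiM_pmf_eq_distr_Pi_pmf:
  assumes "finite I" "I \<noteq> {}"
  shows "(\<Pi>\<^sub>M i\<in>I. measure_pmf (p i)) =
      distr (measure_pmf (Pi_pmf I d p)) (\<Pi>\<^sub>M i\<in>I. count_space UNIV) (\<lambda>x. restrict x I)"
proof -
  have "distr (measure_pmf (Pi_pmf I d p)) (\<Pi>\<^sub>M i\<in>I. count_space UNIV) (\<lambda>x. \<lambda>i\<in>I. x i) =
      (\<Pi>\<^sub>M i\<in>I. distr (measure_pmf (Pi_pmf I d p)) (count_space UNIV) (\<lambda>x. x i))"
    by (rule iffD1[OF prob_space.indep_vars_iff_distr_eq_PiM'[OF measure_pmf.prob_space_axioms]
        indep_vars_Pi_pmf])
      (use assms in auto)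
  also have "\<dots> = (\<Pi>\<^sub>M i\<in>I. measure_pmf (p i))"
  proof (rule PiM_cong[OF refl])
    fix i assume i: "i \<in> I"
    have "distr (measure_pmf (Pi_pmf I d p)) (count_space UNIV) (\<lambda>x. x i) =
        measure_pmf (map_pmf (\<lambda>x. x i) (Pi_pmf I d p))"
      by (simp add: map_pmf_rep_eq)
    also have "\<dots> = measure_pmf (p i)"
      using i assms(1) by (simp add: Pi_pmf_component)
    finally show "distr (measure_pmf (Pi_pmf I d p)) (count_space UNIV) (\<lambda>x. x i) = measure_pmf (p i)" .
  qed
  finally show ?thesis by simp
qed

lemma integral_PiM_pmf_eq_expectation_Pi_pmf:
  fixes Z :: "('i \<Rightarrow> 'z) \<Rightarrow> real"
  assumes Z: "Z \<in> borel_measurable (\<Pi>\<^sub>M i\<in>UNIV. count_space UNIV)" and J: "finite J" "J \<noteq> {}"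
    and cong: "\<And>x y. (\<And>i. i \<in> J \<Longrightarrow> x i = y i) \<Longrightarrow> Z x = Z y"
  shows "(\<integral>x. Z x \<partial>(\<Pi>\<^sub>M i\<in>UNIV. measure_pmf p)) = measure_pmf.expectation (Pi_pmf J d (\<lambda>_. p)) Z"
proof -
  let ?C = "\<Pi>\<^sub>M i\<in>J. count_space (UNIV :: 'z set)" and ?P = "\<Pi>\<^sub>M i\<in>J. measure_pmf p"
  define Z' where "Z' x = Z (\<lambda>i. if i \<in> J then x i else d)" for x
  have "(\<lambda>x i. if i \<in> J then x i else d) \<in> ?C \<rightarrow>\<^sub>M (\<Pi>\<^sub>M i\<in>UNIV. count_space UNIV)"
  proof (rule measurable_PiM_single')
    show "(\<lambda>x. if i \<in> J then x i else d) \<in> ?C \<rightarrow>\<^sub>M count_space UNIV" for i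
      by (cases "i \<in> J") auto
  qed auto
  then have Z'_count: "Z' \<in> borel_measurable ?C"
    unfolding Z'_def using Z by (rule measurable_compose)
  then have Z'_pmf: "Z' \<in> borel_measurable ?P"
    by (subst measurable_cong_sets[OF sets_PiM_pmf refl])
  have Z_eq: "Z x = Z' (restrict x J)" for x
    unfolding Z'_def by (rule cong) simp
  interpret product_prob_space "\<lambda>_. measure_pmf p" "UNIV :: 'i set"
    by (intro product_prob_spaceI measure_pmf.prob_space_axioms)
  have "(\<integral>x. Z x \<partial>(\<Pi>\<^sub>M i\<in>UNIV. measure_pmf p)) =
      (\<integral>x. Z' x \<partial>distr (\<Pi>\<^sub>M i\<in>UNIV. measure_pmf p) ?P (\<lambda>x. restrict x J))"
    unfolding Z_eq by (rule integral_distr[OF measurable_restrict_subset Z'_pmf, symmetric]) simp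
  also have "\<dots> = (\<integral>x. Z' x \<partial>distr (measure_pmf (Pi_pmf J d (\<lambda>_. p))) ?C (\<lambda>x. restrict x J))"
    using distr_PiM_restrict_finite[of J] J PiM_pmf_eq_distr_Pi_pmf[OF J, of "\<lambda>_. p" d] by simp
  also have "\<dots> = measure_pmf.expectation (Pi_pmf J d (\<lambda>_. p)) Z"
    unfolding Z_eq by (rule integral_distr[OF _ Z'_count]) (simp add: space_PiM)
  finally show ?thesis .
qed

lemma pmf_bind_Pair:
  "pmf (bind_pmf p (\<lambda>x. map_pmf (Pair x) (q x))) (x, y) = pmf p x * pmf (q x) y"
proof -
  have "pmf (map_pmf (Pair x') (q x')) (x, y) = indicator {x} x' * pmf (q x) y" for x'
  proof (cases "x' = x")
    case True
    then show ?thesis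
      using pmf_map_inj'[of "Pair x" "q x" y] by (simp add: inj_def)
  next
    case False
    then show ?thesis
      by (subst pmf_map_outside) auto
  qed
  then show ?thesis
    by (simp add: pmf_bind measure_pmf_single)
qed

lemma expectation_bind_pmf:
  fixes u :: "'b \<Rightarrow> real"
  assumes "\<And>z. \<bar>u z\<bar> \<le> B"
  shows "measure_pmf.expectation (bind_pmf p q) u =
    measure_pmf.expectation p (\<lambda>x. measure_pmf.expectation (q x) u)"
proof -
  let ?M = "subprob_algebra (count_space (UNIV :: 'b set))"
  have kernel: "(\<lambda>x. measure_pmf (q x)) \<in> measure_pmf p \<rightarrow>\<^sub>M ?M"
    by (auto simp: space_subprob_algebra intro: measure_pmf.subprob_space_axioms)
  let ?D = "distr (measure_pmf p) ?M (\<lambda>x. measure_pmf (q x))"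
  have "measure_pmf.expectation (bind_pmf p q) u = integral\<^sup>L (join ?D) u"
    using bind_nonempty''[OF kernel] by (simp add: measure_pmf_bind)
  also have "\<dots> = (\<integral>M. (\<integral>z. u z \<partial>M) \<partial>?D)"
  proof (rule integral_join[where B=B and B'=1 and N="count_space UNIV"])
    show "finite_measure ?D"
      using measure_pmf.prob_space_distr[OF kernel] by (rule prob_space.finite_measure)
    show "AE M in ?D. emeasure M (space M) \<le> ennreal 1"
      by (rule AE_I2) (auto simp: space_subprob_algebra intro: subprob_space.emeasure_space_le_1)
  qed (use assms in auto)
  also have "\<dots> = measure_pmf.expectation p (\<lambda>x. measure_pmf.expectation (q x) u)"
    by (rule integral_distr[OF kernel]) (rule integral_measurable_subprob_algebra, simp)
  finally show ?thesis .
qed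

definition level :: "nat pmf" where
  "level = geometric_pmf (1 / 2)"

lemma pmf_level_pos: "pmf level k > 0"
  by (simp add: level_def)

text \<open>A payoff function \<open>1/2 \<plusminus> h K\<close> reveals no more than its level \<open>K\<close> and its sign.\<close>

definition coin :: "(nat \<Rightarrow> real) \<Rightarrow> (nat \<times> bool) pmf" where
  "coin \<theta> = bind_pmf level (\<lambda>K. map_pmf (Pair K) (bernoulli_pmf ((1 + \<theta> K) / 2)))"

definition signed_payoff :: "(nat \<Rightarrow> 'a \<Rightarrow> real) \<Rightarrow> nat \<times> bool \<Rightarrow> 'a \<Rightarrow> real" where
  "signed_payoff h z x = 1 / 2 + unit_sign (snd z) * h (fst z) x"

lemma pmf_coin:
  assumes "\<bar>\<theta> K\<bar> \<le> 1"
  shows "pmf (coin \<theta>) (K, s) = pmf level K * ((1 + unit_sign s * \<theta> K) / 2)"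
proof -
  have "pmf (bernoulli_pmf ((1 + \<theta> K) / 2)) s = (1 + unit_sign s * \<theta> K) / 2"
    using assms by (cases s) (auto simp: abs_le_iff field_simps)
  then show ?thesis
    by (simp add: coin_def pmf_bind_Pair)
qed

lemma expectation_coin:
  fixes u :: "nat \<times> bool \<Rightarrow> real"
  assumes \<theta>: "\<And>K. \<bar>\<theta> K\<bar> \<le> 1" and u: "\<And>z. \<bar>u z\<bar> \<le> B"
  shows "measure_pmf.expectation (coin \<theta>) u =
    measure_pmf.expectation level (\<lambda>K. (1 + \<theta> K) / 2 * u (K, True) + (1 - \<theta> K) / 2 * u (K, False))"
proof -
  have "measure_pmf.expectation (map_pmf (Pair K) (bernoulli_pmf ((1 + \<theta> K) / 2))) u =
      (1 + \<theta> K) / 2 * u (K, True) + (1 - \<theta> K) / 2 * u (K, False)" for K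
  proof -
    have "0 \<le> (1 + \<theta> K) / 2" "(1 + \<theta> K) / 2 \<le> 1" "1 - (1 + \<theta> K) / 2 = (1 - \<theta> K) / 2"
      using \<theta>[of K] by (auto simp: abs_le_iff field_simps)
    then show ?thesis
      by (simp only: integral_map_pmf integral_bernoulli_pmf) (simp add: mult.commute)
  qed
  then show ?thesis
    unfolding coin_def by (simp add: expectation_bind_pmf[OF u])
qed


subsection \<open>The adversary\<close>

lemma pmf_mult_le_expectation:
  fixes f :: "'z \<Rightarrow> real"
  assumes "integrable (measure_pmf p) f" "\<And>z. 0 \<le> f z"
  shows "pmf p z * f z \<le> measure_pmf.expectation p f"
proof -
  have "pmf p z * f z = measure_pmf.expectation p (\<lambda>w. indicator {z} w * f z)"
    by (simp add: measure_pmf_single)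
  also have "\<dots> \<le> measure_pmf.expectation p f"
  proof (rule integral_mono[OF _ assms(1)])
    show "integrable p (\<lambda>w. indicator {z} w * f z)"
      by (rule integrable_measure_pmf_bounded[where B="f z"]) (auto simp: indicator_def assms(2))
    show "indicator {z} w * f z \<le> f w" for w
      using assms(2) by (simp add: indicator_def)
  qed
  finally show ?thesis .
qed

locale lipschitz_coordinates =
  fixes X :: "'a::metric_space set" and h :: "nat \<Rightarrow> 'a \<Rightarrow> real" and r :: "nat \<Rightarrow> real"
  assumes r: "\<And>k. 0 < r k" "\<And>k. r k \<le> 1 / 2"
    and h_bound: "\<And>k x. \<bar>h k x\<bar> \<le> r k" and h_lipschitz: "\<And>k. 1-lipschitz_on X (h k)"
    and h_sign: "\<And>\<beta>. \<exists>x\<in>X. \<forall>k. h k x = unit_sign (\<beta> k) * r k"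
begin

lemma measurable_h: "h k \<in> borel_measurable (arms X)"
  using lipschitz_on_continuous_on[OF h_lipschitz] by (rule borel_measurable_continuous_on_restrict)

lemma signed_payoff_01: "signed_payoff h z x \<in> {0..1}"
  using h_bound[of "fst z" x] r(2)[of "fst z"]
  by (cases "snd z") (auto simp: signed_payoff_def abs_le_iff)

lemma integrable_signed_payoff: "integrable (measure_pmf p) (\<lambda>z. signed_payoff h z x)"
  by (rule integrable_measure_pmf_bounded[where B=1]) (use signed_payoff_01 in auto)

lemma signed_payoff_lipschitz: "1-lipschitz_on X (signed_payoff h z)"
proof (rule lipschitz_onI)
  fix x y assume "x \<in> X" "y \<in> X"
  then have "dist (h (fst z) x) (h (fst z) y) \<le> dist x y"
    using lipschitz_onD[OF h_lipschitz] by simp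
  then show "dist (signed_payoff h z x) (signed_payoff h z y) \<le> 1 * dist x y"
    by (cases "snd z") (auto simp: signed_payoff_def dist_real_def)
qed simp

lemma measurable_signed_payoff:
  "(\<lambda>(z, x). signed_payoff h z x) \<in> borel_measurable (count_space UNIV \<Otimes>\<^sub>M arms X)"
proof (rule measurable_pair_measure_countable1)
  show "(\<lambda>x. case (z, x) of (z, x) \<Rightarrow> signed_payoff h z x) \<in> borel_measurable (arms X)" for z
    unfolding signed_payoff_def using measurable_h by auto
qed simp

definition mean :: "(nat \<Rightarrow> real) \<Rightarrow> 'a \<Rightarrow> real" where
  "mean \<theta> x = measure_pmf.expectation (coin \<theta>) (\<lambda>z. signed_payoff h z x)"

lemma mean_01: "mean \<theta> x \<in> {0..1}"
  using signed_payoff_01 integrable_signed_payoff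
  by (auto simp: mean_def intro!: Bochner_Integration.integral_nonneg measure_pmf.integral_le_const)

lemma mean_lipschitz: "1-lipschitz_on X (mean \<theta>)"
proof (rule lipschitz_onI)
  fix x y assume xy: "x \<in> X" "y \<in> X"
  have "\<bar>mean \<theta> x - mean \<theta> y\<bar> =
      \<bar>measure_pmf.expectation (coin \<theta>) (\<lambda>z. signed_payoff h z x - signed_payoff h z y)\<bar>"
    using integrable_signed_payoff by (simp add: mean_def)
  also have "\<dots> \<le> measure_pmf.expectation (coin \<theta>) (\<lambda>z. \<bar>signed_payoff h z x - signed_payoff h z y\<bar>)"
    by (rule integral_abs_bound)
  also have "\<dots> \<le> measure_pmf.expectation (coin \<theta>) (\<lambda>_. dist x y)"
    using lipschitz_onD[OF signed_payoff_lipschitz xy] integrable_signed_payoff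
    by (intro integral_mono) (auto simp: dist_real_def)
  finally show "dist (mean \<theta> x) (mean \<theta> y) \<le> 1 * dist x y"
    by (simp add: dist_real_def)
qed simp

lemma measurable_mean: "mean \<theta> \<in> borel_measurable (arms X)"
  using lipschitz_on_continuous_on[OF mean_lipschitz] by (rule borel_measurable_continuous_on_restrict)

lemma integrable_bias_h:
  assumes "\<And>K. \<bar>\<theta> K\<bar> \<le> 1"
  shows "integrable level (\<lambda>K. \<theta> K * h K x)"
proof (rule integrable_measure_pmf_bounded[where B=1])
  show "\<bar>\<theta> K * h K x\<bar> \<le> 1" for K
    using assms[of K] h_bound[of K x] r(2)[of K] mult_mono[of "\<bar>\<theta> K\<bar>" 1 "\<bar>h K x\<bar>" 1]
    by (simp add: abs_mult)
qed

lemma mean_eq: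
  assumes "\<And>K. \<bar>\<theta> K\<bar> \<le> 1"
  shows "mean \<theta> x = 1 / 2 + measure_pmf.expectation level (\<lambda>K. \<theta> K * h K x)"
proof -
  have "\<bar>signed_payoff h z x\<bar> \<le> 1" for z
    using signed_payoff_01[of z x] by simp
  from expectation_coin[OF assms this]
  have "mean \<theta> x = measure_pmf.expectation level
      (\<lambda>K. (1 + \<theta> K) / 2 * signed_payoff h (K, True) x + (1 - \<theta> K) / 2 * signed_payoff h (K, False) x)"
    by (simp only: mean_def)
  also have "\<dots> = measure_pmf.expectation level (\<lambda>K. 1 / 2 + \<theta> K * h K x)"
    by (intro arg_cong[where f="measure_pmf.expectation level"] ext)
      (simp add: signed_payoff_def field_simps)
  finally show ?thesis
    using integrable_bias_h[OF assms] by simp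
qed

definition hit :: "nat \<Rightarrow> bool \<Rightarrow> 'a \<Rightarrow> real" where
  "hit k b x = indicator {0<..} (unit_sign b * h k x)"

lemma measurable_hit: "hit k b \<in> borel_measurable (arms X)"
  unfolding hit_def using measurable_h by (intro borel_measurable_indicator') auto

lemma hit_bounds: "0 \<le> hit k b x" "hit k b x \<le> 1"
  by (auto simp: hit_def indicator_def)

lemma hit_True_add_hit_False_le: "hit k True x + hit k False x \<le> 1"
  by (auto simp: hit_def indicator_def)

lemma mean_gap:
  assumes m: "\<And>K. 0 \<le> m K" "\<And>K. m K \<le> 1" and y: "\<And>k. h k y = unit_sign (\<beta> k) * r k"
  defines "\<theta> \<equiv> \<lambda>K. unit_sign (\<beta> K) * m K"
  shows "mean \<theta> x \<le> mean \<theta> y" "pmf level k * (m k * r k) * (1 - hit k (\<beta> k) x) \<le> mean \<theta> y - mean \<theta> x"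
proof -
  define u where "u K = m K * (r K - unit_sign (\<beta> K) * h K x)" for K
  have \<theta>: "\<bar>\<theta> K\<bar> \<le> 1" for K
    using m[of K] by (simp add: \<theta>_def abs_mult)
  have u_eq: "u K = \<theta> K * h K y - \<theta> K * h K x" for K
    by (cases "\<beta> K") (simp_all add: u_def \<theta>_def y algebra_simps)
  have int: "integrable level u"
    unfolding u_eq using integrable_bias_h[OF \<theta>] by simp
  have mean_diff: "mean \<theta> y - mean \<theta> x = measure_pmf.expectation level u"
    unfolding u_eq using integrable_bias_h[OF \<theta>] by (simp add: mean_eq[OF \<theta>])
  have "unit_sign (\<beta> K) * h K x \<le> r K" for K
    using h_bound[of K x] by (cases "\<beta> K") auto
  then have u_nonneg: "0 \<le> u K" for K
    using m(1)[of K] by (simp add: u_def)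
  then have "0 \<le> measure_pmf.expectation level u"
    by (intro Bochner_Integration.integral_nonneg)
  then show "mean \<theta> x \<le> mean \<theta> y"
    using mean_diff by simp
  have "m k * r k * (1 - hit k (\<beta> k) x) \<le> u k"
  proof (cases "0 < unit_sign (\<beta> k) * h k x")
    case True
    then show ?thesis
      using u_nonneg[of k] by (simp add: hit_def)
  next
    case False
    then have "m k * r k \<le> u k"
      unfolding u_def using m(1)[of k] by (intro mult_left_mono) auto
    with False show ?thesis
      by (simp add: hit_def)
  qed
  then have "pmf level k * (m k * r k * (1 - hit k (\<beta> k) x)) \<le> pmf level k * u k"
    by (rule mult_left_mono) simp
  also have "\<dots> \<le> mean \<theta> y - mean \<theta> x"
    unfolding mean_diff using int u_nonneg by (rule pmf_mult_le_expectation)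
  finally show "pmf level k * (m k * r k) * (1 - hit k (\<beta> k) x) \<le> mean \<theta> y - mean \<theta> x"
    by (simp add: mult.assoc)
qed

end

locale adversary = lipschitz_coordinates X h r + Q: prob_space Q
  for X :: "'a::metric_space set" and h :: "nat \<Rightarrow> 'a \<Rightarrow> real" and r :: "nat \<Rightarrow> real"
    and Q :: "real measure" +
  fixes pick :: "nat \<Rightarrow> real \<Rightarrow> (nat \<Rightarrow> nat \<times> bool) \<Rightarrow> 'a" and T :: "nat \<Rightarrow> nat"
  assumes measurable_pick:
      "\<And>s. (\<lambda>p. pick s (fst p) (snd p)) \<in> Q \<Otimes>\<^sub>M (\<Pi>\<^sub>M i\<in>UNIV. count_space UNIV) \<rightarrow>\<^sub>M arms X"
    and pick_cong: "\<And>s \<omega> \<kappa> \<kappa>'. (\<And>i. i < s \<Longrightarrow> \<kappa> i = \<kappa>' i) \<Longrightarrow> pick s \<omega> \<kappa> = pick s \<omega> \<kappa>'"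
    and T: "\<And>k. T k \<ge> 1" "mono T"
begin

abbreviation rounds :: "(nat \<Rightarrow> real) \<Rightarrow> (nat \<Rightarrow> nat \<times> bool) measure" where
  "rounds \<theta> \<equiv> \<Pi>\<^sub>M i\<in>(UNIV :: nat set). measure_pmf (coin \<theta>)"

abbreviation law :: "(nat \<Rightarrow> real) \<Rightarrow> (real \<times> (nat \<Rightarrow> nat \<times> bool)) measure" where
  "law \<theta> \<equiv> Q \<Otimes>\<^sub>M rounds \<theta>"

abbreviation choice :: "nat \<Rightarrow> real \<times> (nat \<Rightarrow> nat \<times> bool) \<Rightarrow> 'a" where
  "choice s p \<equiv> pick s (fst p) (snd p)"

lemma sets_law: "sets (law \<theta>) = sets (Q \<Otimes>\<^sub>M (\<Pi>\<^sub>M i\<in>UNIV. count_space UNIV))"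
  by (intro sets_pair_measure_cong sets_PiM_pmf refl)

lemma measurable_choice: "choice s \<in> law \<theta> \<rightarrow>\<^sub>M arms X"
  using measurable_pick by (subst measurable_cong_sets[OF sets_law refl])

lemma pair_prob_space_law: "pair_prob_space Q (rounds \<theta>)"
proof -
  interpret prob_space "rounds \<theta>"
    by (intro prob_space_PiM measure_pmf.prob_space_axioms)
  show ?thesis by unfold_locales
qed

lemma integrable_choice:
  fixes f :: "'a \<Rightarrow> real"
  assumes "f \<in> borel_measurable (arms X)" "\<And>x. f x \<in> {0..1}"
  shows "integrable (law \<theta>) (\<lambda>p. f (choice s p))"
proof -
  interpret pair_prob_space Q "rounds \<theta>"
    by (rule pair_prob_space_law)
  show ?thesis
    using assms
    by (intro integrable_const_bound[where B=1] measurable_compose[OF measurable_choice]) auto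
qed

lemma integrable_hit: "integrable (law \<theta>) (\<lambda>p. hit k b (choice s p))"
  using hit_bounds by (intro integrable_choice measurable_hit) simp

definition hits :: "nat \<Rightarrow> bool \<Rightarrow> (nat \<Rightarrow> real) \<Rightarrow> real" where
  "hits k b \<theta> = (\<Sum>s<T k. \<integral>p. hit k b (choice s p) \<partial>law \<theta>)"

lemma hits_add_le: "hits k True \<theta> + hits k False \<theta> \<le> T k"
proof -
  interpret pair_prob_space Q "rounds \<theta>"
    by (rule pair_prob_space_law)
  have "(\<integral>p. hit k True (choice s p) \<partial>law \<theta>) + (\<integral>p. hit k False (choice s p) \<partial>law \<theta>) \<le> 1" for s
  proof -
    have "(\<integral>p. hit k True (choice s p) + hit k False (choice s p) \<partial>law \<theta>) \<le> (\<integral>p. 1 \<partial>law \<theta>)"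
      by (intro integral_mono Bochner_Integration.integrable_add integrable_hit
          integrable_const hit_True_add_hit_False_le)
    then show ?thesis
      using integrable_hit by (simp add: prob_space)
  qed
  then have "(\<Sum>s<T k. (\<integral>p. hit k True (choice s p) \<partial>law \<theta>) + (\<integral>p. hit k False (choice s p) \<partial>law \<theta>)) \<le>
      (\<Sum>s<T k. 1)"
    by (intro sum_mono)
  then show ?thesis
    by (simp add: hits_def sum.distrib)
qed

definition bias :: "nat \<Rightarrow> real" where
  "bias k = 1 / (6 * sqrt (real (T k)))"

lemma bias_pos: "0 < bias k" and bias_le: "bias k \<le> 1 / 6"
  using T(1)[of k] by (auto simp: bias_def)

lemma bias_antimono: "j \<le> k \<Longrightarrow> bias k \<le> bias j"
  using T(1)[of j] monoD[OF T(2), of j k] by (auto simp: bias_def intro!: divide_left_mono)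

lemma chi_square_small: "sqrt ((1 + (bias k)\<^sup>2) ^ T k - 1) \<le> 1 / 4"
proof -
  have T_bias: "real (T k) * (bias k)\<^sup>2 = 1 / 36"
    using T(1)[of k] by (simp add: bias_def power_divide power_mult_distrib)
  have "(1 + (bias k)\<^sup>2) ^ T k \<le> exp ((bias k)\<^sup>2) ^ T k"
    using exp_ge_add_one_self[of "(bias k)\<^sup>2"] by (intro power_mono) auto
  also have "\<dots> = exp (1 / 36)"
    by (simp only: exp_of_nat_mult[symmetric] T_bias)
  also have "\<dots> \<le> 1 + 1 / 36 + (1 / 36)\<^sup>2"
    by (rule exp_bound) auto
  also have "\<dots> \<le> 1 + (1 / 4)\<^sup>2"
    by (simp add: power2_eq_square)
  finally have "(1 + (bias k)\<^sup>2) ^ T k - 1 \<le> (1 / 4)\<^sup>2" by simp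
  then show ?thesis
    by (intro real_le_lsqrt) auto
qed

text \<open>
  At level \<open>k\<close> the adversary runs the algorithm for \<open>T k\<close> rounds against the instance whose signs
  are unbiased from level \<open>k\<close> on, and then favours the sign that the algorithm hits at most half of
  the time.
\<close>

primrec truncated_biases :: "nat \<Rightarrow> nat \<Rightarrow> real" where
  "truncated_biases 0 = (\<lambda>_. 0)"
| "truncated_biases (Suc k) =
     (truncated_biases k)(k := unit_sign (hits k True (truncated_biases k) \<le> T k / 2) * bias k)"

definition favoured :: "nat \<Rightarrow> bool" where
  "favoured k \<longleftrightarrow> hits k True (truncated_biases k) \<le> T k / 2"

definition biases :: "nat \<Rightarrow> real" where
  "biases k = unit_sign (favoured k) * bias k"

lemma truncated_biases_eq: "truncated_biases k j = (if j < k then biases j else 0)"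
  by (induction k arbitrary: j) (auto simp: biases_def favoured_def less_Suc_eq)

lemma abs_biases: "\<bar>biases k\<bar> = bias k" and abs_biases_le: "\<bar>biases k\<bar> \<le> 1"
  using bias_pos[of k] bias_le[of k] by (auto simp: biases_def abs_mult)

lemma hits_truncated_le: "hits k (favoured k) (truncated_biases k) \<le> T k / 2"
proof (cases "favoured k")
  case False
  then have "hits k True (truncated_biases k) > T k / 2"
    by (simp add: favoured_def)
  with hits_add_le[of k "truncated_biases k"] False show ?thesis by simp
qed (simp add: favoured_def)

lemma pmf_coin_biases:
  "pmf (coin biases) z = pmf (coin (truncated_biases k)) z *
    (1 + (if fst z < k then 0 else unit_sign (snd z) * biases (fst z)))"
proof (cases z)
  case (Pair K s)
  have "\<bar>truncated_biases k K\<bar> \<le> 1"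
    using abs_biases_le[of K] by (simp add: truncated_biases_eq)
  then show ?thesis
    using abs_biases_le[of K] by (simp add: Pair pmf_coin truncated_biases_eq)
qed

lemma rounds_expectation_close:
  fixes Z :: "(nat \<Rightarrow> nat \<times> bool) \<Rightarrow> real"
  assumes Z: "Z \<in> borel_measurable (\<Pi>\<^sub>M i\<in>UNIV. count_space UNIV)" "\<And>\<kappa>. Z \<kappa> \<in> {0..1}"
    and cong: "\<And>\<kappa> \<kappa>'. (\<And>i. i < T k \<Longrightarrow> \<kappa> i = \<kappa>' i) \<Longrightarrow> Z \<kappa> = Z \<kappa>'"
  shows "(\<integral>\<kappa>. Z \<kappa> \<partial>rounds biases) \<le> (\<integral>\<kappa>. Z \<kappa> \<partial>rounds (truncated_biases k)) + 1 / 4"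
proof -
  let ?E = "\<lambda>\<theta>. measure_pmf.expectation (Pi_pmf {..<T k} undefined (\<lambda>_. coin \<theta>)) Z"
  have "(\<integral>\<kappa>. Z \<kappa> \<partial>rounds \<theta>) = ?E \<theta>" for \<theta>
  proof (rule integral_PiM_pmf_eq_expectation_Pi_pmf[OF Z(1)])
    show "{..<T k} \<noteq> {}"
      using T(1)[of k] by (auto simp: lessThan_empty_iff)
    show "Z \<kappa> = Z \<kappa>'" if "\<And>i. i \<in> {..<T k} \<Longrightarrow> \<kappa> i = \<kappa>' i" for \<kappa> \<kappa>'
      by (rule cong) (simp add: that)
  qed simp
  moreover have "\<bar>?E biases - ?E (truncated_biases k)\<bar> \<le> sqrt ((1 + (bias k)\<^sup>2) ^ card {..<T k} - 1)"
    using bias_antimono bias_pos[of k] bias_le[of k] Z(2)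
    by (intro Pi_pmf_expectation_diff_le[OF _ pmf_coin_biases]) (auto simp: abs_mult abs_biases)
  ultimately show ?thesis
    using chi_square_small[of k] by (simp add: abs_le_iff)
qed

lemma hit_probability_close:
  assumes "s < T k"
  shows "(\<integral>p. hit k b (choice s p) \<partial>law biases) \<le>
      (\<integral>p. hit k b (choice s p) \<partial>law (truncated_biases k)) + 1 / 4"
proof -
  interpret B: pair_prob_space Q "rounds biases"
    by (rule pair_prob_space_law)
  interpret C: pair_prob_space Q "rounds (truncated_biases k)"
    by (rule pair_prob_space_law)
  have inner: "(\<integral>\<kappa>. hit k b (pick s \<omega> \<kappa>) \<partial>rounds biases) \<le>
      (\<integral>\<kappa>. hit k b (pick s \<omega> \<kappa>) \<partial>rounds (truncated_biases k)) + 1 / 4" if \<omega>: "\<omega> \<in> space Q" for \<omega>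
  proof (rule rounds_expectation_close)
    have "(\<lambda>\<kappa>. pick s \<omega> \<kappa>) \<in> (\<Pi>\<^sub>M i\<in>UNIV. count_space UNIV) \<rightarrow>\<^sub>M arms X"
      using measurable_compose[OF measurable_Pair1'[OF \<omega>] measurable_pick] by simp
    then show "(\<lambda>\<kappa>. hit k b (pick s \<omega> \<kappa>)) \<in> borel_measurable (\<Pi>\<^sub>M i\<in>UNIV. count_space UNIV)"
      by (rule measurable_compose[OF _ measurable_hit])
    show "hit k b (pick s \<omega> \<kappa>) = hit k b (pick s \<omega> \<kappa>')" if "\<And>i. i < T k \<Longrightarrow> \<kappa> i = \<kappa>' i" for \<kappa> \<kappa>'
      using that assms pick_cong[of s \<kappa> \<kappa>' \<omega>] by simp
  qed (use hit_bounds in simp)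
  have "(\<integral>p. hit k b (choice s p) \<partial>law biases) = (\<integral>\<omega>. (\<integral>\<kappa>. hit k b (pick s \<omega> \<kappa>) \<partial>rounds biases) \<partial>Q)"
    using B.integral_fst'[OF integrable_hit] by simp
  also have "\<dots> \<le> (\<integral>\<omega>. (\<integral>\<kappa>. hit k b (pick s \<omega> \<kappa>) \<partial>rounds (truncated_biases k)) + 1 / 4 \<partial>Q)"
    using inner B.integrable_fst'[OF integrable_hit] C.integrable_fst'[OF integrable_hit]
    by (intro integral_mono Bochner_Integration.integrable_add) auto
  also have "\<dots> = (\<integral>p. hit k b (choice s p) \<partial>law (truncated_biases k)) + 1 / 4"
    using C.integrable_fst'[OF integrable_hit] C.integral_fst'[OF integrable_hit]
    by (simp add: Q.prob_space)
  finally show ?thesis .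
qed

lemma hits_biases_le: "hits k (favoured k) biases \<le> 3 / 4 * T k"
proof -
  have "hits k (favoured k) biases \<le>
      (\<Sum>s<T k. (\<integral>p. hit k (favoured k) (choice s p) \<partial>law (truncated_biases k)) + 1 / 4)"
    unfolding hits_def by (intro sum_mono hit_probability_close) simp
  also have "\<dots> = hits k (favoured k) (truncated_biases k) + T k / 4"
    by (simp add: hits_def sum.distrib)
  finally show ?thesis
    using hits_truncated_le[of k] by simp
qed

theorem regret_lower_bound:
  "pmf level k * r k * sqrt (T k) / 24 \<le>
    real (T k) * (SUP x\<in>X. mean biases x) - (\<integral>p. (\<Sum>s<T k. mean biases (choice s p)) \<partial>law biases)"
proof -
  interpret pair_prob_space Q "rounds biases"
    by (rule pair_prob_space_law)
  obtain y where y: "y \<in> X" "\<And>k. h k y = unit_sign (favoured k) * r k"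
    using h_sign[of favoured] by blast
  have bias: "0 \<le> bias K" "bias K \<le> 1" for K
    using bias_pos[of K] bias_le[of K] by auto
  have "(\<lambda>K. unit_sign (favoured K) * bias K) = biases"
    by (simp add: biases_def fun_eq_iff)
  note gap = mean_gap[where m=bias, OF bias y(2), unfolded this]
  define c where "c = pmf level k * (bias k * r k)"
  let ?b = "favoured k" and ?E = "\<lambda>s. \<integral>p. mean biases (choice s p) \<partial>law biases"
  have c_nonneg: "0 \<le> c"
    using bias_pos[of k] r(1)[of k] by (simp add: c_def)
  have round: "c * (1 - (\<integral>p. hit k ?b (choice s p) \<partial>law biases)) \<le> mean biases y - ?E s" for s
  proof -
    have "(\<integral>p. c * (1 - hit k ?b (choice s p)) \<partial>law biases) \<le>
        (\<integral>p. mean biases y - mean biases (choice s p) \<partial>law biases)"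
      using gap(2)[of k] integrable_hit integrable_choice[OF measurable_mean mean_01]
      by (intro integral_mono) (auto simp: c_def)
    then show ?thesis
      using integrable_hit[of biases k ?b s] integrable_choice[OF measurable_mean mean_01]
      by (simp add: prob_space)
  qed
  have "bias k * real (T k) = sqrt (T k) / 6"
    using T(1)[of k] by (simp add: bias_def field_simps)
  then have "pmf level k * r k * sqrt (T k) / 24 = c * (real (T k) / 4)"
    by (simp add: c_def algebra_simps)
  also have "\<dots> \<le> c * (real (T k) - hits k ?b biases)"
    using hits_biases_le[of k] c_nonneg by (intro mult_left_mono) auto
  also have "\<dots> = (\<Sum>s<T k. c * (1 - (\<integral>p. hit k ?b (choice s p) \<partial>law biases)))"
    by (simp add: hits_def sum_subtractf right_diff_distrib sum_distrib_left mult.commute)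
  also have "\<dots> \<le> (\<Sum>s<T k. mean biases y - ?E s)"
    by (intro sum_mono round)
  also have "\<dots> = real (T k) * (SUP x\<in>X. mean biases x) -
      (\<integral>p. (\<Sum>s<T k. mean biases (choice s p)) \<partial>law biases)"
    using y(1) gap(1) integrable_choice[OF measurable_mean mean_01]
    by (intro regret_eq_sum_losses[symmetric, where \<mu>="mean biases"]) auto
  finally show ?thesis .
qed

end

lemma sparse_times:
  fixes g q :: "nat \<Rightarrow> real"
  assumes g: "(\<lambda>t. g t / sqrt (real t)) \<longlonglongrightarrow> 0" and q: "\<And>k. q k > 0"
  obtains T :: "nat \<Rightarrow> nat" where "\<And>k. T k \<ge> 1" "mono T"
    "\<And>k. \<bar>g (T k)\<bar> * real (Suc k) \<le> q k * sqrt (T k)"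
proof -
  have "\<exists>N. \<forall>t\<ge>N. \<bar>g t / sqrt (real t)\<bar> < q k / real (Suc k)" for k
    using LIMSEQ_D[OF g, of "q k / real (Suc k)"] q[of k] by (simp del: of_nat_Suc)
  then obtain N where N: "\<And>k t. t \<ge> N k \<Longrightarrow> \<bar>g t / sqrt (real t)\<bar> < q k / real (Suc k)"
    by metis
  define T where "T k = Suc (\<Sum>j\<le>k. N j)" for k
  have "\<bar>g (T k)\<bar> * real (Suc k) \<le> q k * sqrt (T k)" for k
  proof -
    have "N k \<le> T k"
      using member_le_sum[of k "{..k}" N] by (simp add: T_def)
    moreover have "T k \<ge> 1"
      by (simp add: T_def)
    ultimately show ?thesis
      using N[of k "T k"] by (simp add: field_simps abs_divide del: of_nat_Suc)
  qed
  moreover have "T k \<ge> 1" "mono T" for k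
    by (simp_all add: T_def mono_iff_le_Suc)
  ultimately show ?thesis
    using that by blast
qed

lemma not_bounded_along_sparse_times:
  fixes g R q :: "nat \<Rightarrow> real" and T :: "nat \<Rightarrow> nat"
  assumes T: "\<And>k. T k \<ge> 1" "\<And>k. \<bar>g (T k)\<bar> * real (Suc k) \<le> q k * sqrt (T k)" and q: "\<And>k. q k > 0"
    and R: "\<And>k. q k * sqrt (T k) / 24 \<le> R (T k)"
  shows "\<not> (\<forall>t\<ge>1. R t \<le> C * g t)"
proof
  assume bounded: "\<forall>t\<ge>1. R t \<le> C * g t"
  obtain n where "24 * \<bar>C\<bar> < real n"
    using reals_Archimedean2 by blast
  then obtain k :: nat where k: "24 * \<bar>C\<bar> < real (Suc k)"
    by (metis lessI less_trans of_nat_less_iff)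
  let ?s = "q k * sqrt (T k)"
  have s_pos: "?s > 0"
    using q[of k] T(1)[of k] by simp
  have "?s / 24 \<le> C * g (T k)"
    using R[of k] bounded T(1)[of k] order_trans by blast
  also have "\<dots> \<le> \<bar>C\<bar> * \<bar>g (T k)\<bar>"
    by (metis abs_ge_self abs_mult)
  finally have "?s / 24 * real (Suc k) \<le> \<bar>C\<bar> * \<bar>g (T k)\<bar> * real (Suc k)"
    by (rule mult_right_mono) simp
  also have "\<dots> \<le> \<bar>C\<bar> * ?s"
    using mult_left_mono[OF T(2)[of k], of "\<bar>C\<bar>"] by (simp add: mult.assoc del: of_nat_Suc)
  finally have "?s * real (Suc k) \<le> ?s * (24 * \<bar>C\<bar>)"
    by (simp add: mult_ac del: of_nat_Suc)
  then have "real (Suc k) \<le> 24 * \<bar>C\<bar>"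
    using s_pos mult_le_cancel_left_pos by blast
  with k show False by simp
qed

lemma uncountable_sparse_coordinates:
  fixes X :: "'a::metric_space set" and g :: "nat \<Rightarrow> real"
  assumes X: "compact X" "uncountable X" and g: "(\<lambda>t. g t / sqrt (real t)) \<longlonglongrightarrow> 0"
  obtains h r and T :: "nat \<Rightarrow> nat" where "lipschitz_coordinates X h r" "\<And>k. T k \<ge> 1" "mono T"
    "\<And>k. \<bar>g (T k)\<bar> * real (Suc k) \<le> pmf level k * r k * sqrt (T k)" "\<And>k. pmf level k * r k > 0"
proof -
  obtain h :: "nat \<Rightarrow> 'a \<Rightarrow> real" and r where hr: "\<And>k. 0 < r k" "\<And>k. r k \<le> 1 / 2" "\<And>k x. \<bar>h k x\<bar> \<le> r k"
    "\<And>k. 1-lipschitz_on UNIV (h k)" "\<And>\<beta>. \<exists>x\<in>X. \<forall>k. h k x = unit_sign (\<beta> k) * r k"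
    by (rule uncountable_compact_lipschitz_coordinates[OF X]) (rule that)
  have coords: "lipschitz_coordinates X h r"
    using hr lipschitz_on_subset[OF hr(4)] by unfold_locales auto
  have pos: "pmf level k * r k > 0" for k
    using hr(1)[of k] pmf_level_pos[of k] by simp
  obtain T where "\<And>k. T k \<ge> 1" "mono T" "\<And>k. \<bar>g (T k)\<bar> * real (Suc k) \<le> pmf level k * r k * sqrt (T k)"
    by (rule sparse_times[OF g pos]) (rule that)
  with coords show ?thesis
    using pos by (rule that)
qed


subsection \<open>Uncountable spaces: the bandit problem\<close>

context lipschitz_coordinates
begin

lemma mab_tape_signed_payoff:
  assumes "mab_algorithm X Q a"
  shows "mab_tape X Q a (measure_pmf p) (signed_payoff h)"
  using measurable_signed_payoff assms
  by (intro mab_tape.intro mab_tape_axioms.intro measure_pmf.prob_space_axioms)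
    (auto cong: measurable_cong_sets sets_pair_measure_cong)

definition reward_law :: "(nat \<Rightarrow> real) \<Rightarrow> 'a \<Rightarrow> real measure" where
  "reward_law \<theta> x = distr (measure_pmf (coin \<theta>)) borel (\<lambda>z. signed_payoff h z x)"

lemma mab_instance_reward_law: "mab_instance X (mean \<theta>) (reward_law \<theta>)"
  unfolding mab_instance_def
proof (intro conjI ballI)
  show "mean \<theta> ` X \<subseteq> {0..1}"
    using mean_01 by auto
  show "1-lipschitz_on X (mean \<theta>)"
    by (rule mean_lipschitz)
  show "reward_law \<theta> \<in> arms X \<rightarrow>\<^sub>M prob_algebra borel"
    unfolding reward_law_def
  proof (rule measurable_distr_prob_space2)
    show "(\<lambda>x. measure_pmf (coin \<theta>)) \<in> arms X \<rightarrow>\<^sub>M prob_algebra (count_space UNIV)"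
      by (rule measurable_const) (simp add: space_prob_algebra measure_pmf.prob_space_axioms)
    show "(\<lambda>(x, z). signed_payoff h z x) \<in> arms X \<Otimes>\<^sub>M count_space UNIV \<rightarrow>\<^sub>M borel"
      using measurable_compose[OF measurable_pair_swap' measurable_signed_payoff]
      by (simp add: case_prod_beta')
  qed
  fix x
  show "AE y in reward_law \<theta> x. y \<in> {0..1}"
    unfolding reward_law_def using signed_payoff_01 by (subst AE_distr_iff) auto
  show "(\<integral>y. y \<partial>reward_law \<theta> x) = mean \<theta> x"
    unfolding reward_law_def mean_def by (subst integral_distr) auto
qed

end

theorem uncountable_imp_not_mab_tractable:
  fixes X :: "'a::metric_space set" and g :: "nat \<Rightarrow> real"
  assumes X: "compact X" "uncountable X" and g: "(\<lambda>t. g t / sqrt (real t)) \<longlonglongrightarrow> 0"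
  shows "\<not> mab_tractable X g"
proof
  assume "mab_tractable X g"
  then obtain Q a where alg: "mab_algorithm X Q a"
    and tractable: "\<And>\<mu> \<nu>. mab_instance X \<mu> \<nu> \<Longrightarrow> \<exists>C. \<forall>t\<ge>1. mab_regret X Q a \<mu> \<nu> t \<le> C * g t"
    unfolding mab_tractable_def by metis
  obtain h r T where coords: "lipschitz_coordinates X h r" and T: "\<And>k. T k \<ge> 1" "mono T"
    and sparse: "\<And>k. \<bar>g (T k)\<bar> * real (Suc k) \<le> pmf level k * r k * sqrt (T k)"
      "\<And>k. pmf level k * r k > 0"
    by (rule uncountable_sparse_coordinates[OF X g]) (rule that)
  interpret lipschitz_coordinates X h r
    by (rule coords)
  interpret adversary X h r Q "mab_pick a (signed_payoff h)" T
  proof (intro adversary.intro adversary_axioms.intro coords T)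
    show "prob_space Q"
      using alg by (simp add: mab_algorithm_def seed_law_def)
    show "mab_pick a (signed_payoff h) s \<omega> \<kappa> = mab_pick a (signed_payoff h) s \<omega> \<kappa>'"
      if "\<And>i. i < s \<Longrightarrow> \<kappa> i = \<kappa>' i" for s \<omega> and \<kappa> \<kappa>' :: "nat \<Rightarrow> nat \<times> bool"
      using that by (rule mab_pick_cong)
    fix s
    have "sets (Q \<Otimes>\<^sub>M (\<Pi>\<^sub>M i\<in>(UNIV :: nat set). measure_pmf (coin (\<lambda>_. 0)))) =
        sets (Q \<Otimes>\<^sub>M (\<Pi>\<^sub>M i\<in>(UNIV :: nat set). count_space UNIV))"
      by (intro sets_pair_measure_cong sets_PiM_pmf refl)
    with mab_tape.measurable_pick[OF mab_tape_signed_payoff[OF alg, of "coin (\<lambda>_. 0)"], of s]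
    show "(\<lambda>p. mab_pick a (signed_payoff h) s (fst p) (snd p)) \<in>
        Q \<Otimes>\<^sub>M (\<Pi>\<^sub>M i\<in>UNIV. count_space UNIV) \<rightarrow>\<^sub>M arms X"
      by (subst (asm) measurable_cong_sets[OF _ refl])
  qed
  have "pmf level k * r k * sqrt (T k) / 24 \<le>
      mab_regret X Q a (mean biases) (reward_law biases) (T k)" for k
    using regret_lower_bound[of k]
      mab_tape.mab_regret_eq[OF mab_tape_signed_payoff[OF alg] mab_instance_reward_law reward_law_def]
    by simp
  then show False
    using tractable[OF mab_instance_reward_law] not_bounded_along_sparse_times[OF T(1) sparse] by blast
qed


subsection \<open>Uncountable spaces: experts with full feedback\<close>

lemma (in prob_space) distr_PiM_map:
  assumes "f \<in> M \<rightarrow>\<^sub>M L"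
  shows "distr (\<Pi>\<^sub>M i\<in>(UNIV :: 'i set). M) (\<Pi>\<^sub>M i\<in>UNIV. L) (\<lambda>\<kappa> i. f (\<kappa> i)) = (\<Pi>\<^sub>M i\<in>UNIV. distr M L f)"
proof -
  interpret seq: prob_space "\<Pi>\<^sub>M i\<in>(UNIV :: 'i set). M"
    by (rule prob_space_PiM) (rule prob_space_axioms)
  have component: "(\<lambda>\<kappa>. \<kappa> i) \<in> (\<Pi>\<^sub>M i\<in>(UNIV :: 'i set). M) \<rightarrow>\<^sub>M M" for i :: 'i
    using measurable_component_singleton[of i UNIV "\<lambda>_. M"] by simp
  have "distr (\<Pi>\<^sub>M i\<in>(UNIV :: 'i set). M) L (\<lambda>\<kappa>. f (\<kappa> i)) = distr M L f" for i :: 'i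
    using distr_distr[OF assms component, of i] distr_PiM_component[of UNIV "\<lambda>_. M" i] prob_space_axioms
    by (simp add: comp_def)
  moreover have "seq.indep_vars (\<lambda>_. L) (\<lambda>i \<kappa>. f (\<kappa> i)) UNIV"
    using seq.indep_vars_compose2[OF indep_vars_PiM_coordinates[OF inj_on_id[of UNIV]],
        where Y="\<lambda>_. f"] assms
    by simp
  ultimately show ?thesis
    using seq.indep_vars_iff_distr_eq_PiM'[of UNIV "\<lambda>i \<kappa>. f (\<kappa> i)" "\<lambda>_. L"]
      measurable_compose[OF component assms]
    by (simp add: restrict_def)
qed

lemma measurable_pair_PiM_map:
  assumes "f \<in> M \<rightarrow>\<^sub>M L"
  shows "(\<lambda>p. (fst p, \<lambda>i. f (snd p i))) \<in> Q \<Otimes>\<^sub>M (\<Pi>\<^sub>M i\<in>UNIV. M) \<rightarrow>\<^sub>M Q \<Otimes>\<^sub>M (\<Pi>\<^sub>M i\<in>UNIV. distr M L f)"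
proof (intro measurable_Pair measurable_fst measurable_compose[OF measurable_snd]
    measurable_PiM_single')
  show "(\<lambda>\<kappa>. f (\<kappa> i)) \<in> (\<Pi>\<^sub>M i\<in>UNIV. M) \<rightarrow>\<^sub>M distr M L f" for i
    using measurable_compose[OF measurable_component_singleton[of i UNIV "\<lambda>_. M"] assms] by simp
qed (use measurable_space[OF assms] in \<open>auto simp: space_PiM PiE_iff\<close>)

lemma distr_pair_PiM_map:
  assumes M: "prob_space M" and f: "f \<in> M \<rightarrow>\<^sub>M L"
  shows "Q \<Otimes>\<^sub>M (\<Pi>\<^sub>M i\<in>UNIV. distr M L f) =
    distr (Q \<Otimes>\<^sub>M (\<Pi>\<^sub>M i\<in>UNIV. M)) (Q \<Otimes>\<^sub>M (\<Pi>\<^sub>M i\<in>UNIV. distr M L f)) (\<lambda>p. (fst p, \<lambda>i. f (snd p i)))"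
proof -
  interpret M: prob_space M
    by (rule M)
  let ?P = "\<Pi>\<^sub>M i\<in>UNIV. distr M L f"
  interpret seq: prob_space ?P
    by (intro prob_space_PiM M.prob_space_distr f)
  have map: "(\<lambda>\<kappa> i. f (\<kappa> i)) \<in> (\<Pi>\<^sub>M i\<in>UNIV. M) \<rightarrow>\<^sub>M ?P"
    by (rule measurable_PiM_single')
      (use measurable_compose[OF measurable_component_singleton[of _ UNIV "\<lambda>_. M"] f]
        measurable_space[OF f]
        in \<open>auto simp: space_PiM PiE_iff\<close>)
  have seq: "distr (\<Pi>\<^sub>M i\<in>UNIV. M) ?P (\<lambda>\<kappa> i. f (\<kappa> i)) = ?P"
    using M.distr_PiM_map[OF f] by (simp cong: distr_cong sets_PiM_cong)
  have "distr Q Q (\<lambda>x. x) \<Otimes>\<^sub>M distr (\<Pi>\<^sub>M i\<in>UNIV. M) ?P (\<lambda>\<kappa> i. f (\<kappa> i)) =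
      distr (Q \<Otimes>\<^sub>M (\<Pi>\<^sub>M i\<in>UNIV. M)) (Q \<Otimes>\<^sub>M ?P) (\<lambda>(x, y). (x, \<lambda>i. f (y i)))"
    by (rule pair_measure_distr) (use map seq.sigma_finite_measure_axioms in \<open>simp_all add: seq\<close>)
  then show ?thesis
    by (simp add: seq distr_id case_prod_beta')
qed

text \<open>An inequality suffices, as the integral of a function that is not measurable is 0.\<close>

lemma integral_completion_distr_le:
  fixes u :: "'b \<Rightarrow> real"
  assumes f: "f \<in> M \<rightarrow>\<^sub>M N" and N: "N = distr M N f" and u: "(\<lambda>x. u (f x)) \<in> borel_measurable M"
    "\<And>y. 0 \<le> u y"
  shows "(\<integral>y. u y \<partial>completion N) \<le> (\<integral>x. u (f x) \<partial>M)"
proof (cases "u \<in> borel_measurable (completion N)")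
  case True
  from completion_ex_borel_measurable_real[OF this]
  obtain v where v: "v \<in> borel_measurable N" "AE y in N. u y = v y" by blast
  have "(\<integral>y. u y \<partial>completion N) = (\<integral>y. v y \<partial>completion N)"
    using True v by (intro integral_cong_AE) (auto intro: AE_completion measurable_completion)
  also have "\<dots> = (\<integral>y. v y \<partial>N)"
    using v(1) by (rule integral_completion)
  also have "\<dots> = (\<integral>y. v y \<partial>distr M N f)"
    using N by simp
  also have "\<dots> = (\<integral>x. v (f x) \<partial>M)"
    by (rule integral_distr[OF f v(1)])
  also have "\<dots> = (\<integral>x. u (f x) \<partial>M)"
  proof (rule integral_cong_AE)
    have "AE y in distr M N f. u y = v y"
      using v(2) by (simp only: N[symmetric])
    from AE_distrD[OF f this] show "AE x in M. v (f x) = u (f x)" by auto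
  qed (use u(1) measurable_compose[OF f v(1)] in auto)
  finally show ?thesis by simp
next
  case False
  then have "\<not> integrable (completion N) u"
    using borel_measurable_integrable by blast
  then have "(\<integral>y. u y \<partial>completion N) = 0"
    by (rule not_integrable_integral_eq)
  also have "0 \<le> (\<integral>x. u (f x) \<partial>M)"
    using u(2) by (intro Bochner_Integration.integral_nonneg) auto
  finally show ?thesis .
qed

abbreviation full_count :: "'a full_rule \<Rightarrow> real \<Rightarrow> (nat \<Rightarrow> 'a \<Rightarrow> real) \<Rightarrow> nat \<Rightarrow> nat" where
  "full_count a \<omega> \<phi> i \<equiv> fst (full_run a \<omega> \<phi> i)"

abbreviation full_history :: "'a full_rule \<Rightarrow> real \<Rightarrow> (nat \<Rightarrow> 'a \<Rightarrow> real) \<Rightarrow> nat \<Rightarrow> nat \<Rightarrow> real" where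
  "full_history a \<omega> \<phi> i \<equiv> snd (full_run a \<omega> \<phi> i)"

abbreviation full_action :: "'a full_rule \<Rightarrow> real \<Rightarrow> (nat \<Rightarrow> 'a \<Rightarrow> real) \<Rightarrow> nat \<Rightarrow> bool \<times> 'a" where
  "full_action a \<omega> \<phi> i \<equiv> a i \<omega> (full_history a \<omega> \<phi> i)"

definition start_step :: "'a full_rule \<Rightarrow> nat \<Rightarrow> real \<Rightarrow> (nat \<Rightarrow> 'a \<Rightarrow> real) \<Rightarrow> nat" where
  "start_step a t \<omega> \<phi> = (LEAST i. full_count a \<omega> \<phi> (Suc i) = Suc t)"

lemma full_count_Suc:
  "full_count a \<omega> \<phi> (Suc i) = full_count a \<omega> \<phi> i + of_bool (fst (full_action a \<omega> \<phi> i))"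
  by (simp add: Let_def split: prod.split)

lemma full_history_Suc:
  "full_history a \<omega> \<phi> (Suc i) =
    (full_history a \<omega> \<phi> i)(i := \<phi> (full_count a \<omega> \<phi> (Suc i) - 1) (snd (full_action a \<omega> \<phi> i)))"
  by (simp add: Let_def split: prod.split)

declare full_run.simps(2) [simp del]

lemma full_pick_start_step: "full_pick a t \<omega> \<phi> = snd (full_action a \<omega> \<phi> (start_step a t \<omega> \<phi>))"
  by (simp add: full_pick_def start_step_def Let_def)

lemma full_count_mono: "i \<le> j \<Longrightarrow> full_count a \<omega> \<phi> i \<le> full_count a \<omega> \<phi> j"
  by (induction rule: dec_induct) (auto simp: full_count_Suc)

lemma start_step_eqI:
  assumes "full_count a \<omega> \<phi> i = t" "full_count a \<omega> \<phi> (Suc i) = Suc t"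
  shows "start_step a t \<omega> \<phi> = i"
  unfolding start_step_def
proof (rule Least_equality)
  fix j assume j: "full_count a \<omega> \<phi> (Suc j) = Suc t"
  show "i \<le> j"
  proof (rule ccontr)
    assume "\<not> i \<le> j"
    then have "full_count a \<omega> \<phi> (Suc j) \<le> full_count a \<omega> \<phi> i"
      by (intro full_count_mono) simp
    with assms(1) j show False by simp
  qed
qed (rule assms(2))

lemma full_history_extensional: "full_history a \<omega> \<phi> i \<in> extensional {..<i}"
  by (induction i) (auto simp: full_history_Suc extensional_def)

lemma restrict_full_history:
  "restrict (\<lambda>j. full_history a \<omega> \<phi> (Suc j) j) {..<i} = full_history a \<omega> \<phi> i"
proof -
  have "full_history a \<omega> \<phi> i j = full_history a \<omega> \<phi> (Suc j) j" if "Suc j \<le> i" for j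
    using that by (induction rule: dec_induct) (auto simp: full_history_Suc)
  then show ?thesis
    using full_history_extensional[of a \<omega> \<phi> i]
    by (auto simp: fun_eq_iff restrict_def extensional_def Suc_le_eq)
qed

locale full_rule =
  fixes X :: "'a::metric_space set" and Q :: "real measure" and a :: "'a full_rule"
  assumes full_algorithm: "full_algorithm X Q a"
begin

lemma prob_space_seed: "prob_space Q"
  using full_algorithm by (simp add: full_algorithm_def seed_law_def)

lemma space_seed: "space Q = UNIV"
  using full_algorithm sets_eq_imp_space_eq[of Q borel] by (simp add: full_algorithm_def seed_law_def)

lemma measurable_rule:
  "(\<lambda>(\<omega>, v). a i \<omega> v) \<in> Q \<Otimes>\<^sub>M (\<Pi>\<^sub>M j\<in>{..<i}. borel) \<rightarrow>\<^sub>M count_space UNIV \<Otimes>\<^sub>M arms X"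
  using full_algorithm by (simp add: full_algorithm_def)

lemma full_action_in_X: "snd (full_action a \<omega> \<phi> i) \<in> X"
  using measurable_space[OF measurable_rule, of "(\<omega>, full_history a \<omega> \<phi> i)" i]
    full_history_extensional[of a \<omega> \<phi> i]
  by (auto simp: space_pair_measure space_PiM PiE_iff space_seed space_restrict_space)

lemma full_pick_in_X: "full_pick a t \<omega> \<phi> \<in> X"
  unfolding full_pick_start_step by (rule full_action_in_X)

lemma full_count_pos: "0 < full_count a \<omega> \<phi> (Suc i)"
proof -
  have "fst (a 0 \<omega> (restrict (\<lambda>_. undefined) {..<0}))"
    using full_algorithm unfolding full_algorithm_def by blast
  then have "0 < full_count a \<omega> \<phi> (Suc 0)"
    by (simp add: full_count_Suc restrict_def)
  also have "\<dots> \<le> full_count a \<omega> \<phi> (Suc i)"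
    by (rule full_count_mono) simp
  finally show ?thesis .
qed

lemma full_count_unbounded: "\<exists>i. n \<le> full_count a \<omega> \<phi> i"
proof (induction n)
  case (Suc n)
  then obtain i where i: "n \<le> full_count a \<omega> \<phi> i" by blast
  have "\<exists>\<^sub>\<infinity>j. fst (a j \<omega> (restrict (\<lambda>j. full_history a \<omega> \<phi> (Suc j) j) {..<j}))"
    using full_algorithm unfolding full_algorithm_def by blast
  then obtain j where j: "j \<ge> i" "fst (full_action a \<omega> \<phi> j)"
    unfolding restrict_full_history INFM_nat_le by blast
  have "n \<le> full_count a \<omega> \<phi> j"
    using i full_count_mono[OF j(1)] by (rule order_trans)
  with j(2) have "Suc n \<le> full_count a \<omega> \<phi> (Suc j)"
    by (simp add: full_count_Suc)
  then show ?case by blast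
qed simp

lemma full_count_start_step:
  "full_count a \<omega> \<phi> (start_step a t \<omega> \<phi>) = t" "full_count a \<omega> \<phi> (Suc (start_step a t \<omega> \<phi>)) = Suc t"
proof -
  obtain n where n: "Suc t \<le> full_count a \<omega> \<phi> n" "\<And>m. m < n \<Longrightarrow> \<not> Suc t \<le> full_count a \<omega> \<phi> m"
    using full_count_unbounded[of "Suc t" \<omega> \<phi>] exists_least_iff[of "\<lambda>n. Suc t \<le> full_count a \<omega> \<phi> n"]
    by blast
  then obtain i where "n = Suc i"
    by (cases n) auto
  then have "full_count a \<omega> \<phi> i = t" "full_count a \<omega> \<phi> (Suc i) = Suc t"
    using n(1) n(2)[of i] by (auto simp: full_count_Suc of_bool_def split: if_splits)
  then show "full_count a \<omega> \<phi> (start_step a t \<omega> \<phi>) = t"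
    "full_count a \<omega> \<phi> (Suc (start_step a t \<omega> \<phi>)) = Suc t"
    using start_step_eqI by metis+
qed

lemma full_run_cong:
  assumes "\<And>s. s < t \<Longrightarrow> \<phi> s = \<phi>' s" "full_count a \<omega> \<phi> i \<le> t"
  shows "full_run a \<omega> \<phi>' i = full_run a \<omega> \<phi> i"
  using assms(2)
proof (induction i)
  case (Suc i)
  have IH: "full_run a \<omega> \<phi>' i = full_run a \<omega> \<phi> i"
    using Suc full_count_mono[of i "Suc i" a \<omega> \<phi>] by simp
  then have count: "full_count a \<omega> \<phi>' (Suc i) = full_count a \<omega> \<phi> (Suc i)"
    by (simp add: full_count_Suc)
  have "\<phi> (full_count a \<omega> \<phi> (Suc i) - 1) = \<phi>' (full_count a \<omega> \<phi> (Suc i) - 1)"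
    using full_count_pos[of \<omega> \<phi> i] Suc.prems by (intro assms(1)) simp
  then have "full_history a \<omega> \<phi>' (Suc i) = full_history a \<omega> \<phi> (Suc i)"
    by (simp add: full_history_Suc count IH)
  with count show ?case
    by (simp add: prod_eq_iff)
qed simp

lemma full_pick_cong:
  assumes "\<And>s. s < t \<Longrightarrow> \<phi> s = \<phi>' s"
  shows "full_pick a t \<omega> \<phi> = full_pick a t \<omega> \<phi>'"
proof -
  let ?i = "start_step a t \<omega> \<phi>"
  have run: "full_run a \<omega> \<phi>' ?i = full_run a \<omega> \<phi> ?i"
  proof (rule full_run_cong)
    show "full_count a \<omega> \<phi> ?i \<le> t"
      using full_count_start_step(1) by (rule eq_imp_le)
  qed (rule assms)
  then have "start_step a t \<omega> \<phi>' = ?i"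
    using full_count_start_step[of \<omega> \<phi> t] by (intro start_step_eqI) (simp_all add: full_count_Suc)
  with run show ?thesis
    by (simp add: full_pick_start_step)
qed

context
  fixes F :: "'z::countable \<Rightarrow> 'a \<Rightarrow> real"
  assumes F: "(\<lambda>(z, x). F z x) \<in> borel_measurable (count_space UNIV \<Otimes>\<^sub>M arms X)"
begin

abbreviation payoff_seq :: "real \<times> (nat \<Rightarrow> 'z) \<Rightarrow> nat \<Rightarrow> 'a \<Rightarrow> real" where
  "payoff_seq p \<equiv> \<lambda>s. restrict (F (snd p s)) X"

abbreviation index_space :: "(real \<times> (nat \<Rightarrow> 'z)) measure" where
  "index_space \<equiv> Q \<Otimes>\<^sub>M (\<Pi>\<^sub>M i\<in>(UNIV :: nat set). count_space (UNIV :: 'z set))"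

lemma measurable_full_action:
  assumes "(\<lambda>p. full_history a (fst p) (payoff_seq p) i) \<in> index_space \<rightarrow>\<^sub>M (\<Pi>\<^sub>M j\<in>{..<i}. borel)"
  shows "(\<lambda>p. full_action a (fst p) (payoff_seq p) i) \<in> index_space \<rightarrow>\<^sub>M count_space UNIV \<Otimes>\<^sub>M arms X"
  using measurable_compose[OF measurable_Pair[OF measurable_fst assms] measurable_rule] by simp

lemma measurable_full_run:
  "(\<lambda>p. full_count a (fst p) (payoff_seq p) i) \<in> index_space \<rightarrow>\<^sub>M count_space UNIV \<and>
   (\<lambda>p. full_history a (fst p) (payoff_seq p) i) \<in> index_space \<rightarrow>\<^sub>M (\<Pi>\<^sub>M j\<in>{..<i}. borel)"
proof (induction i)
  case 0
  then show ?case
    by (auto intro!: measurable_const simp: space_PiM)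
next
  case (Suc i)
  let ?count = "\<lambda>i p. full_count a (fst p) (payoff_seq p) i"
  let ?action = "\<lambda>p. full_action a (fst p) (payoff_seq p) i"
  have action: "?action \<in> index_space \<rightarrow>\<^sub>M count_space UNIV \<Otimes>\<^sub>M arms X"
    by (rule measurable_full_action[OF conjunct2[OF Suc]])
  have "(\<lambda>p. (\<lambda>(k, b). k + of_bool b) (?count i p, fst (?action p))) \<in>
      index_space \<rightarrow>\<^sub>M count_space (UNIV :: nat set)"
    by (rule measurable_compose[OF
        measurable_Pair[OF conjunct1[OF Suc] measurable_compose[OF action measurable_fst]]])
      (simp add: pair_measure_countable)
  then have count: "?count (Suc i) \<in> index_space \<rightarrow>\<^sub>M count_space UNIV"
    by (simp add: full_count_Suc)
  have "(\<lambda>p. snd p (?count (Suc i) p - 1)) \<in> index_space \<rightarrow>\<^sub>M count_space UNIV"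
  proof (rule measurable_compose_countable[where f="\<lambda>n p. snd p (n - 1)", OF _ count])
    show "(\<lambda>p. snd p (n - 1)) \<in> index_space \<rightarrow>\<^sub>M count_space UNIV" for n :: nat
      using measurable_compose[OF measurable_snd[of Q]
          measurable_component_singleton[of "n - 1" UNIV "\<lambda>_. count_space (UNIV :: 'z set)"]] by simp
  qed
  from measurable_compose[OF measurable_Pair[OF this measurable_compose[OF action measurable_snd]] F]
  have "(\<lambda>p. payoff_seq p (?count (Suc i) p - 1) (snd (?action p))) \<in> borel_measurable index_space"
    by (simp add: full_action_in_X)
  then have "(\<lambda>p. full_history a (fst p) (payoff_seq p) (Suc i)) \<in>
      index_space \<rightarrow>\<^sub>M (\<Pi>\<^sub>M j\<in>{..<Suc i}. borel)"
    unfolding full_history_Suc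
    by (intro measurable_fun_upd[where J="{..<i}", OF _ conjunct2[OF Suc]]) auto
  with count show ?case by blast
qed

lemma measurable_full_pick:
  "(\<lambda>p. full_pick a t (fst p) (payoff_seq p)) \<in> index_space \<rightarrow>\<^sub>M arms X"
  unfolding full_pick_start_step
proof (rule measurable_compose_countable)
  show "(\<lambda>p. snd (full_action a (fst p) (payoff_seq p) i)) \<in> index_space \<rightarrow>\<^sub>M arms X" for i
    using measurable_full_run
    by (intro measurable_compose[OF measurable_full_action measurable_snd]) blast
  show "(\<lambda>p. start_step a t (fst p) (payoff_seq p)) \<in> index_space \<rightarrow>\<^sub>M count_space UNIV"
    unfolding start_step_def
  proof (rule measurable_Least)
    show "Measurable.pred index_space (\<lambda>p. full_count a (fst p) (payoff_seq p) (Suc i) = Suc t)" for i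
      using measurable_compose[OF conjunct1[OF measurable_full_run[of "Suc i"]],
          of "\<lambda>n. n = Suc t" "count_space UNIV"]
      by simp
  qed
qed

end

end

context lipschitz_coordinates
begin

definition payoff :: "nat \<times> bool \<Rightarrow> 'a \<Rightarrow> real" where
  "payoff z = restrict (signed_payoff h z) X"

definition payoff_law :: "(nat \<Rightarrow> real) \<Rightarrow> ('a \<Rightarrow> real) measure" where
  "payoff_law \<theta> = distr (measure_pmf (coin \<theta>)) (payoff_borel X) payoff"

lemma measurable_payoff: "payoff \<in> measure_pmf p \<rightarrow>\<^sub>M payoff_borel X"
  using signed_payoff_01 by (auto simp: payoff_def space_payoff_borel)

lemma prob_space_payoff_law: "prob_space (payoff_law \<theta>)"
  unfolding payoff_law_def by (rule measure_pmf.prob_space_distr[OF measurable_payoff])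

lemma sets_payoff_law: "sets (payoff_law \<theta>) = sets (payoff_borel X)"
  by (simp add: payoff_law_def)

lemma expert_mean_payoff_law: "x \<in> X \<Longrightarrow> expert_mean (payoff_law \<theta>) x = mean \<theta> x"
  unfolding expert_mean_def payoff_law_def mean_def
  by (subst integral_distr[OF measurable_payoff measurable_payoff_eval]) (simp_all add: payoff_def)

lemma AE_payoff_law_lipschitz: "AE f in payoff_law \<theta>. 1-lipschitz_on X f"
proof -
  have "{f \<in> space (payoff_borel X). 1-lipschitz_on X f} \<in> sets (payoff_borel X)"
    using closedin_payoff_borel[OF closedin_lipschitz[of X]]
    by (simp add: space_payoff_borel payoff_topology_def)
  moreover have "1-lipschitz_on X (payoff z)" for z
    using signed_payoff_lipschitz[of z] by (auto simp: payoff_def lipschitz_on_def)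
  ultimately show ?thesis
    unfolding payoff_law_def by (subst AE_distr_iff[OF measurable_payoff]) auto
qed

lemma expert_instance_payoff_law:
  assumes "compact X"
  shows "expert_instance X (payoff_law \<theta>)"
  unfolding expert_instance_def
proof (intro conjI prob_space_payoff_law sets_payoff_law)
  show "measurable_evaluation X (payoff_law \<theta>)"
    using assms prob_space_payoff_law sets_payoff_law AE_payoff_law_lipschitz
    by (rule measurable_evaluation_lipschitz)
  show "1-lipschitz_on X (expert_mean (payoff_law \<theta>))"
    using mean_lipschitz[of \<theta>] by (auto simp: lipschitz_on_def expert_mean_payoff_law)
qed

lemma uniformly_lipschitz_payoff_law: "uniformly_lipschitz X (payoff_law \<theta>)"
  using prob_space_payoff_law sets_payoff_law AE_payoff_law_lipschitz by (rule uniformly_lipschitz_AE)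

end

locale full_adversary = full_rule X Q a +
    adversary X h r Q "\<lambda>s \<omega> \<kappa>. full_pick a s \<omega> (\<lambda>t. lipschitz_coordinates.payoff X h (\<kappa> t))" T
  for X :: "'a::metric_space set" and Q a h r T
begin

lemma expert_regret_lower_bound:
  "pmf level k * r k * sqrt (T k) / 24 \<le> expert_regret X Q (full_pick a) (payoff_law biases) (T k)"
proof -
  let ?N = "Q \<Otimes>\<^sub>M (\<Pi>\<^sub>M t\<in>(UNIV :: nat set). payoff_law biases)"
  let ?f = "\<lambda>p. (fst p, \<lambda>t. payoff (snd p t))"
  define u where "u p = (\<Sum>s<T k. expert_mean (payoff_law biases) (full_pick a s (fst p) (snd p)))" for p
  have u_eq: "u p = (\<Sum>s<T k. mean biases (full_pick a s (fst p) (snd p)))" for p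
    by (simp add: u_def expert_mean_payoff_law full_pick_in_X)
  have "(\<integral>p. u p \<partial>completion ?N) \<le> (\<integral>p. u (?f p) \<partial>law biases)"
  proof (rule integral_completion_distr_le)
    show "?f \<in> law biases \<rightarrow>\<^sub>M ?N"
      unfolding payoff_law_def by (rule measurable_pair_PiM_map[OF measurable_payoff])
    show "?N = distr (law biases) ?N ?f"
      unfolding payoff_law_def
      by (rule distr_pair_PiM_map[OF measure_pmf.prob_space_axioms measurable_payoff])
    show "(\<lambda>p. u (?f p)) \<in> borel_measurable (law biases)"
      unfolding u_eq fst_conv snd_conv
      by (intro borel_measurable_sum measurable_compose[OF measurable_choice measurable_mean])
    show "0 \<le> u p" for p
      unfolding u_eq using mean_01 by (intro sum_nonneg) auto
  qed
  moreover have "(SUP x\<in>X. expert_mean (payoff_law biases) x) = (SUP x\<in>X. mean biases x)"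
    using expert_mean_payoff_law by (intro SUP_cong) auto
  ultimately show ?thesis
    using regret_lower_bound[of k]
    by (simp add: expert_regret_def expert_space_def case_prod_beta' u_eq flip: u_def)
qed

end

theorem uncountable_imp_not_full_tractable_uniform:
  fixes X :: "'a::metric_space set" and g :: "nat \<Rightarrow> real"
  assumes X: "compact X" "uncountable X" and g: "(\<lambda>t. g t / sqrt (real t)) \<longlonglongrightarrow> 0"
  shows "\<not> full_tractable_uniform X g"
proof
  assume "full_tractable_uniform X g"
  then obtain Q a where alg: "full_algorithm X Q a"
    and tractable: "\<And>P. expert_instance X P \<Longrightarrow> uniformly_lipschitz X P \<Longrightarrow>
      \<exists>C. \<forall>t\<ge>1. expert_regret X Q (full_pick a) P t \<le> C * g t"
    unfolding full_tractable_uniform_def by metis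
  interpret full_rule X Q a
    using alg by (rule full_rule.intro)
  obtain h r T where coords: "lipschitz_coordinates X h r" and T: "\<And>k. T k \<ge> 1" "mono T"
    and sparse: "\<And>k. \<bar>g (T k)\<bar> * real (Suc k) \<le> pmf level k * r k * sqrt (T k)"
      "\<And>k. pmf level k * r k > 0"
    by (rule uncountable_sparse_coordinates[OF X g]) (rule that)
  interpret lipschitz_coordinates X h r
    by (rule coords)
  interpret full_adversary X Q a h r T
  proof (intro full_adversary.intro full_rule_axioms adversary.intro adversary_axioms.intro coords T
      prob_space_seed)
    show "(\<lambda>p. full_pick a s (fst p) (\<lambda>t. payoff (snd p t))) \<in>
        Q \<Otimes>\<^sub>M (\<Pi>\<^sub>M i\<in>UNIV. count_space UNIV) \<rightarrow>\<^sub>M arms X" for s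
      unfolding payoff_def by (rule measurable_full_pick[OF measurable_signed_payoff])
    show "full_pick a s \<omega> (\<lambda>t. payoff (\<kappa> t)) = full_pick a s \<omega> (\<lambda>t. payoff (\<kappa>' t))"
      if "\<And>i. i < s \<Longrightarrow> \<kappa> i = \<kappa>' i" for s \<omega> \<kappa> \<kappa>'
      using that by (intro full_pick_cong) simp
  qed
  show False
    using tractable[OF expert_instance_payoff_law[OF X(1)] uniformly_lipschitz_payoff_law]
      not_bounded_along_sparse_times[OF T(1) sparse expert_regret_lower_bound] by blast
qed


subsection \<open>The dichotomies\<close>

definition paired :: "nat \<Rightarrow> (nat \<Rightarrow> real) \<Rightarrow> nat \<Rightarrow> real \<times> real" where
  "paired t v = restrict (\<lambda>s. (v (2 * s), v (2 * s + 1))) {..<t}"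

definition full_of_double :: "'a double_rule \<Rightarrow> 'a full_rule" where
  "full_of_double a i \<omega> v =
      (even i, (if even i then fst else snd) (a (i div 2) \<omega> (paired (i div 2) v)))"

lemma full_of_double_sel:
  "fst (full_of_double a i \<omega> v) = even i"
  "snd (full_of_double a i \<omega> v) = (if even i then fst else snd) (a (i div 2) \<omega> (paired (i div 2) v))"
  by (simp_all add: full_of_double_def)

lemma measurable_full_of_double:
  assumes "double_algorithm X Q a"
  shows "(\<lambda>(\<omega>, v). full_of_double a i \<omega> v) \<in>
      Q \<Otimes>\<^sub>M (\<Pi>\<^sub>M j\<in>{..<i}. borel) \<rightarrow>\<^sub>M count_space UNIV \<Otimes>\<^sub>M arms X"
proof -
  let ?M = "Q \<Otimes>\<^sub>M (\<Pi>\<^sub>M j\<in>{..<i}. (borel :: real measure))"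
  have component: "(\<lambda>p. snd p j) \<in> borel_measurable ?M" if "j < i" for j
    using measurable_compose[OF measurable_snd
        measurable_component_singleton[of j "{..<i}" "\<lambda>_. borel"]] that
    by simp
  have "(\<lambda>p. (fst p, paired (i div 2) (snd p))) \<in> ?M \<rightarrow>\<^sub>M Q \<Otimes>\<^sub>M (\<Pi>\<^sub>M s\<in>{..<i div 2}. borel \<Otimes>\<^sub>M borel)"
    unfolding paired_def by (intro measurable_Pair measurable_fst measurable_restrict component) auto
  moreover have "(\<lambda>(\<omega>, v). a (i div 2) \<omega> v) \<in>
      Q \<Otimes>\<^sub>M (\<Pi>\<^sub>M s\<in>{..<i div 2}. borel \<Otimes>\<^sub>M borel) \<rightarrow>\<^sub>M arms X \<Otimes>\<^sub>M arms X"
    using assms by (simp add: double_algorithm_def)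
  ultimately have "(\<lambda>p. a (i div 2) (fst p) (paired (i div 2) (snd p))) \<in> ?M \<rightarrow>\<^sub>M arms X \<Otimes>\<^sub>M arms X"
    using measurable_compose by fastforce
  then have "(\<lambda>p. (if even i then fst else snd) (a (i div 2) (fst p) (paired (i div 2) (snd p)))) \<in>
      ?M \<rightarrow>\<^sub>M arms X"
    by (cases "even i")
      (simp_all add: measurable_compose[OF _ measurable_fst] measurable_compose[OF _ measurable_snd])
  then show ?thesis
    unfolding full_of_double_def case_prod_beta' by (intro measurable_Pair measurable_const) simp_all
qed

lemma full_of_double_algorithm:
  assumes "double_algorithm X Q a"
  shows "full_algorithm X Q (full_of_double a)"
  unfolding full_algorithm_def
proof (intro conjI allI measurable_full_of_double[OF assms])
  show "seed_law Q"
    using assms by (simp add: double_algorithm_def)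
  show "fst (full_of_double a 0 \<omega> (restrict v {..<0}))" for \<omega> v
    by (simp add: full_of_double_sel)
  have "\<exists>i\<ge>m. fst (full_of_double a i \<omega> (restrict v {..<i}))" for \<omega> v m
    by (rule exI[of _ "2 * m"]) (simp add: full_of_double_sel)
  then show "\<exists>\<^sub>\<infinity>i. fst (full_of_double a i \<omega> (restrict v {..<i}))" for \<omega> v
    by (simp add: INFM_nat_le)
qed

lemma full_of_double_run:
  "full_count (full_of_double a) \<omega> \<phi> (2 * t) = t \<and>
   paired t (full_history (full_of_double a) \<omega> \<phi> (2 * t)) = double_run a \<omega> \<phi> t"
proof (induction t)
  case 0
  show ?case by (simp add: paired_def restrict_def)
next
  case (Suc t)
  let ?count = "full_count (full_of_double a) \<omega> \<phi>" and ?history = "full_history (full_of_double a) \<omega> \<phi>"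
  let ?x = "fst (a t \<omega> (double_run a \<omega> \<phi> t))" and ?y = "snd (a t \<omega> (double_run a \<omega> \<phi> t))"
  have paired_upd: "paired t ((?history (2 * t))(2 * t := c)) = paired t (?history (2 * t))" for c
    by (auto simp: paired_def restrict_def)
  have first: "?count (Suc (2 * t)) = Suc t"
    "?history (Suc (2 * t)) = (?history (2 * t))(2 * t := \<phi> t ?x)"
    using Suc by (simp_all add: full_count_Suc full_history_Suc full_of_double_sel)
  then have second: "?count (Suc (Suc (2 * t))) = Suc t"
    "?history (Suc (Suc (2 * t))) = (?history (2 * t))(2 * t := \<phi> t ?x, Suc (2 * t) := \<phi> t ?y)"
    using Suc by (simp_all add: full_count_Suc[of _ _ _ "Suc (2 * t)"]
        full_history_Suc[of _ _ _ "Suc (2 * t)"]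
        paired_upd full_of_double_sel)
  have "paired (Suc t) (?history (Suc (Suc (2 * t)))) =
      (paired t (?history (2 * t)))(t := (\<phi> t ?x, \<phi> t ?y))"
    unfolding second by (auto simp: paired_def restrict_def fun_eq_iff)
  with second(1) Suc show ?case
    by (simp add: Let_def case_prod_beta)
qed

lemma full_pick_full_of_double: "full_pick (full_of_double a) = double_pick a"
proof (intro ext)
  fix t \<omega> \<phi>
  have count: "full_count (full_of_double a) \<omega> \<phi> (2 * t) = t"
    using full_of_double_run by blast
  then have "start_step (full_of_double a) t \<omega> \<phi> = 2 * t"
    by (intro start_step_eqI) (simp_all add: full_count_Suc full_of_double_sel)
  then show "full_pick (full_of_double a) t \<omega> \<phi> = double_pick a t \<omega> \<phi>"
    using full_of_double_run[of a \<omega> \<phi> t]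
    by (simp add: full_pick_start_step double_pick_def full_of_double_sel)
qed

lemma double_tractable_imp_full_tractable_uniform:
  assumes "double_tractable X f"
  shows "full_tractable_uniform X f"
proof -
  obtain Q a where "double_algorithm X Q a"
    "\<forall>P. expert_instance X P \<longrightarrow> (\<exists>C. \<forall>t\<ge>1. expert_regret X Q (double_pick a) P t \<le> C * f t)"
    using assms unfolding double_tractable_def by blast
  then show ?thesis
    unfolding full_tractable_uniform_def
    by (intro exI[of _ Q] exI[of _ "full_of_double a"])
      (simp add: full_of_double_algorithm full_pick_full_of_double)
qed

lemma ex_superlogarithmic_below_sqrt:
  "\<exists>f :: nat \<Rightarrow> real. (\<forall>t\<ge>1. f t > 0) \<and> filterlim (\<lambda>t. f t / ln (real t)) at_top sequentially \<and>
    (\<lambda>t. f t / sqrt (real t)) \<longlonglongrightarrow> 0"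
proof (intro exI conjI)
  show "\<forall>t\<ge>1. real t powr (1 / 4) > 0"
    by simp
  show "filterlim (\<lambda>t. real t powr (1 / 4) / ln (real t)) at_top sequentially"
    by real_asymp
  show "(\<lambda>t. real t powr (1 / 4) / sqrt (real t)) \<longlonglongrightarrow> 0"
    by real_asymp
qed

theorem theorem7p1:
  fixes X :: "'a::metric_space set"
  assumes "compact X" and "X \<noteq> {}" and "diameter X \<le> 1"
  defines "mab_easy \<equiv>
      (\<forall>f::nat \<Rightarrow> real. (\<forall>t\<ge>1. f t > 0) \<and> filterlim (\<lambda>t. f t / ln (real t)) at_top sequentially
         \<longrightarrow> mab_tractable X f)"
    and "mab_hard \<equiv>
      (\<forall>g::nat \<Rightarrow> real. (\<lambda>t. g t / sqrt (real t)) \<longlonglongrightarrow> 0 \<longrightarrow> \<not> mab_tractable X g)"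
    and "experts_easy \<equiv> double_tractable X (\<lambda>_. 1)"
    and "experts_hard \<equiv>
      (\<forall>g::nat \<Rightarrow> real. (\<lambda>t. g t / sqrt (real t)) \<longlonglongrightarrow> 0 \<longrightarrow> \<not> full_tractable_uniform X g)"
  shows "(mab_easy \<or> mab_hard) \<and> \<not> (mab_easy \<and> mab_hard) \<and> (mab_easy \<longleftrightarrow> countable X) \<and>
         (experts_easy \<or> experts_hard) \<and> \<not> (experts_easy \<and> experts_hard) \<and>
         (experts_easy \<longleftrightarrow> countable X)"
proof -
  have mab_exclusive: "\<not> (mab_easy \<and> mab_hard)"
    unfolding mab_easy_def mab_hard_def using ex_superlogarithmic_below_sqrt by blast
  have "(\<lambda>t. 1 / sqrt (real t)) \<longlonglongrightarrow> 0"
    by real_asymp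
  then have experts_exclusive: "\<not> (experts_easy \<and> experts_hard)"
    unfolding experts_easy_def experts_hard_def
    using double_tractable_imp_full_tractable_uniform[of X "\<lambda>_. 1"] by (auto dest: spec[of _ "\<lambda>_. 1"])
  have easy: "mab_easy \<and> experts_easy" if "countable X"
    unfolding mab_easy_def experts_easy_def
    using countable_imp_mab_tractable[OF assms(1,2) that]
      countable_imp_double_tractable[OF assms(1,2) that]
    by blast
  have hard: "mab_hard \<and> experts_hard" if "uncountable X"
    unfolding mab_hard_def experts_hard_def
    using uncountable_imp_not_mab_tractable[OF assms(1) that]
      uncountable_imp_not_full_tractable_uniform[OF assms(1) that] by blast
  show ?thesis
    using mab_exclusive experts_exclusive easy hard by blast
qed

end
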